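(* Let $m,n\ge1$ and let $\lhd$ be an admissible order. The $\mathbb{C}(q^{1/2})$-linear map $\pi^{\lhd}$ from $\mathrm{U}_q(\mathfrak{osp}(2m+1|2n),\Pi^{\lhd})$ to $\mathrm{Cl}_q(m,n)^{\lhd}$ defined on generators by $$e_i \mapsto \Phi_{i}\Phi_{i+1}^{\dagger},\quad f_i \mapsto \Phi_{i+1}\Phi_i^{\dagger},\quad k_i\mapsto -(-1)^{[\Phi_{i+1}]}\mathfrak{U}_i \mathfrak{U}_{i+1}^{-1}\qquad (i=1,\dots,m+n-1),$$ $$e_{m+n} \mapsto \sqrt{-1}\,(q^{1/2}-q^{-1/2})^{-1}\Phi_{m+n},\quad f_{m+n}\mapsto \Phi_{m+n}^{\dagger},\quad k_{m+n}\mapsto \sqrt{-1}\, q^{1/2}\mathfrak{U}_{m+n}$$ is an associative superalgebra homomorphism.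
   Context: $q$ is an indeterminate over $\mathbb{C}$; all algebras are over $\mathbb{C}(q^{1/2})$; $\sqrt{-1}\in\mathbb{C}$ is the imaginary unit. For a superalgebra, $[x]\in\mathbb{Z}_2$ denotes the parity of a homogeneous element $x$. **Root data.** Let $\mathcal E_{m|n}$ be the real vector space with basis $\varepsilon_1,\dots,\varepsilon_m,\delta_1,\dots,\delta_n$ and symmetric bilinear form $(\varepsilon_i,\varepsilon_j)=-\delta_{ij}$, $(\delta_\mu,\delta_\nu)=\delta_{\mu\nu}$, $(\varepsilon_i,\delta_\mu)=0$. An admissible order $\lhd$ is a total order on this basis with $\varepsilon_i\lhd\varepsilon_{i+1}$ and $\delta_\mu\lhd\delta_{\mu+1}$ for all $i,\mu$. Write the ordered basis as $\mathcal E_1\lhd\mathcal E_2\lhd\cdots\lhd\mathcal E_{m+n}$. The simple roots are $\Pi^\lhd=\{\alpha_1,\dots,\alpha_{m+n}\}$ with $\alpha_i=\mathcal E_i-\mathcal E_{i+1}$ for $1\le i\le m+n-1$ and $\alpha_{m+n}=\mathcal E_{m+n}$. Let $\Theta$ be the set of indices of odd simple roots: for $i<m+n$, $i\in\Theta$ iff exactly one of $\mathcal E_i,\mathcal E_{i+1}$ is a $\delta_\mu$; and $m+n\in\Theta$ iff $\mathcal E_{m+n}=\delta_n$. Set $a_{ij}=2(\alpha_i,\alpha_j)/(\alpha_i,\alpha_i)$ and $d_i=(\alpha_i,\alpha_i)/2$ if $(\alpha_i,\alpha_i)\ne0$; $a_{ij}=-(\alpha_i,\alpha_j)$ and $d_i=-1$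 if $(\alpha_i,\alpha_i)=0$. Let $q_i=q^{d_i}$. **$q$-numbers.** $[k]_{p}=\frac{p^k-p^{-k}}{p-p^{-1}}$, $\{k\}_p=\frac{p^k-(-p)^{-k}}{p+p^{-1}}$, $[N]_p!=\prod_{i=1}^N[i]_p$, $\{N\}_p!=\prod_{i=1}^N\{i\}_p$, $[0]_p!=\{0\}_p!=1$, $\begin{bmatrix}N\\k\end{bmatrix}_p=\frac{[N]_p!}{[N-k]_p![k]_p!}$, $\left\{\begin{matrix}N\\k\end{matrix}\right\}_p=\frac{\{N\}_p!}{\{N-k\}_p!\{k\}_p!}$. **The quantum supergroup $\mathrm{U}_q(\mathfrak{osp}(2m+1|2n),\Pi^\lhd)$** is the associative superalgebra generated by $e_i,f_i,k_i^{\pm1}$ ($1\le i\le m+n$), with $e_s,f_s$ odd for $s\in\Theta$ and all other generators even, subject to: (R1) $k_ik_i^{-1}=k_i^{-1}k_i=1$, $k_ik_j=k_jk_i$; $k_ie_jk_i^{-1}=q_i^{a_{ij}}e_j$, $k_if_jk_i^{-1}=q_i^{-a_{ij}}f_j$; $e_if_j-(-1)^{[e_i][f_j]}f_je_i=\delta_{ij}\frac{k_i-k_i^{-1}}{q-q^{-1}}$. (R2) If $i\notin\Theta$, then for all $j\ne i$: $\sum_{k=0}^{1-a_{ij}}(-1)^k\begin{bmatrix}1-a_{ij}\\k\end{bmatrix}_{q_i}e_i^ke_je_i^{1-a_{ij}-k}=0$, and the same with all $e$'s replaced by $f$'s. If $s\in\Theta$ and $a_{ss}=2$, then for all $j\ne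 s$: $\sum_{k=0}^{1-a_{sj}}(-1)^{\frac12k(k+1)+k[e_j]}\left\{\begin{matrix}1-a_{sj}\\k\end{matrix}\right\}_{q_s}e_s^ke_je_s^{1-a_{sj}-k}=0$, and the same with all $e$'s replaced by $f$'s. If $a_{ss}=0$, then $e_s^2=f_s^2=0$. (R3) Higher order Serre relations. Put $$e_{i;s;j}=e_i\big(e_se_j-(-1)^{[e_j]}q_j^{a_{js}}e_je_s\big)-(-1)^{[e_i](1+[e_j])}q_i^{a_{is}+a_{ij}}\big(e_se_j-(-1)^{[e_j]}q_j^{a_{js}}e_je_s\big)e_i,$$ and define $f_{i;s;j}$ by the same formula with all $e$'s replaced by $f$'s. (a) If $1<s<m+n-1$, $a_{ss}=0$ (i.e. $\alpha_s$ is isotropic odd) and $a_{s-1,s}=-a_{s,s+1}$, then $e_se_{s-1;s;s+1}+(-1)^{[e_{s-1}]+[e_{s+1}]}e_{s-1;s;s+1}e_s=0$. (b) If $s=m+n-1>1$, $a_{ss}=0$ and $\alpha_{m+n}=\varepsilon_m$, then $e_se_{s-1;s;s+1}+(-1)^{[e_{s-1}]}e_{s-1;s;s+1}e_s=0$. (c) If $s=m+n-1>1$, $a_{ss}=0$ and $\alpha_{m+n}=\delta_n$, then $e_se_{s-1;s;s+1}-(-1)^{[e_{s-1}]}e_{s-1;s;s+1}e_s=0$. In each of (a), (b), (c) the same relation with all $e$'s replaced by $f$'s is also imposed. **The deformed Clifford superalgebra $\mathrm{Cl}_q(m,n)^\lhd$** is the associative superalgebra generated by $\Phi_i,\Phi_i^\dagger,\mathfrak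 U_i^{\pm1}$ ($1\le i\le m+n$), where $\mathfrak U_i^{\pm1}$ are even, and $\Phi_i,\Phi_i^\dagger$ are even if $\mathcal E_i\in\{\varepsilon_1,\dots,\varepsilon_m\}$ and odd if $\mathcal E_i\in\{\delta_1,\dots,\delta_n\}$, subject to - $\mathfrak U_i\mathfrak U_j=\mathfrak U_j\mathfrak U_i$, $\mathfrak U_i\mathfrak U_i^{-1}=\mathfrak U_i^{-1}\mathfrak U_i=1$; - $\mathfrak U_i\Phi_j\mathfrak U_i^{-1}=q^{-(-1)^{[\Phi_j]}\delta_{ij}}\Phi_j$, $\mathfrak U_i\Phi_j^\dagger\mathfrak U_i^{-1}=q^{(-1)^{[\Phi_j]}\delta_{ij}}\Phi_j^\dagger$; - $\Phi_i\Phi_j-(-1)^{[\Phi_i][\Phi_j]}\Phi_j\Phi_i=\Phi_i^\dagger\Phi_j^\dagger-(-1)^{[\Phi_i^\dagger][\Phi_j^\dagger]}\Phi_j^\dagger\Phi_i^\dagger=0$; - $\Phi_i\Phi_j^\dagger-(-1)^{[\Phi_i][\Phi_j^\dagger]}\Phi_j^\dagger\Phi_i=0$ for $i\ne j$; - $\Phi_i\Phi_i^\dagger-(-1)^{[\Phi_i]}q\Phi_i^\dagger\Phi_i=\mathfrak U_i^{-1}$, $\Phi_i\Phi_i^\dagger-(-1)^{[\Phi_i]}q^{-1}\Phi_i^\dagger\Phi_i=\mathfrak U_i$. *)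

theory Defs
  imports
    "HOL-Algebra.QuotRing"
    "HOL-Algebra.Module"
    "HOL-Library.Poly_Mapping"
    "HOL-Library.FuncSet"
    "HOL-Computational_Algebra.Polynomial"
    "HOL-Computational_Algebra.Fraction_Field"
    Complex_Main
begin

section \<open>Superalgebras given by generators and relations\<close>

text \<open>The component indexed by 0 is the even part, the one indexed by 1 the odd part.\<close>

record ('k, 'b) superalgebra = "('k, 'b) module" +
  component :: "nat \<Rightarrow> 'b set"

definition superalgebra_hom ::
  "('k, 'a, 'c) superalgebra_scheme \<Rightarrow> ('k, 'b, 'd) superalgebra_scheme \<Rightarrow> ('a \<Rightarrow> 'b) set" where
  "superalgebra_hom A B =
     {h \<in> ring_hom A B.
        (\<forall>c. \<forall>x\<in>carrier A. h (c \<odot>\<^bsub>A\<^esub> x) = c \<odot>\<^bsub>B\<^esub> h x) \<and>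
        (\<forall>p\<in>{0, 1}. h ` component A p \<subseteq> component B p)}"

text \<open>The free monoid, written additively: with this instance the convolution product of
  finitely supported functions on words is the product of noncommutative polynomials.\<close>

datatype 'x word = Word (letters: "'x list")

instantiation word :: (type) monoid_add
begin

definition zero_word :: "'a word" where
  "zero_word = Word []"

definition plus_word :: "'a word \<Rightarrow> 'a word \<Rightarrow> 'a word" where
  "plus_word u v = Word (letters u @ letters v)"

instance
  by standard (simp_all add: zero_word_def plus_word_def)

end

definition gen :: "'x \<Rightarrow> 'x word \<Rightarrow>\<^sub>0 'k::field" where
  "gen x = Poly_Mapping.single (Word [x]) 1"

definition const :: "'k \<Rightarrow> 'x word \<Rightarrow>\<^sub>0 'k::field" where
  "const c = Poly_Mapping.single 0 c"

definition free_algebra :: "'x set \<Rightarrow> ('x word \<Rightarrow>\<^sub>0 'k::field) ring" where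
  "free_algebra X =
     \<lparr>carrier = {p. \<forall>w\<in>Poly_Mapping.keys p. set (letters w) \<subseteq> X},
      monoid.mult = (*), one = 1, zero = 0, add = (+)\<rparr>"

definition word_parity :: "('x \<Rightarrow> nat) \<Rightarrow> 'x word \<Rightarrow> nat" where
  "word_parity par w = (\<Sum>x\<leftarrow>letters w. par x) mod 2"

definition relation_ideal ::
  "'x set \<Rightarrow> ('x word \<Rightarrow>\<^sub>0 'k::field) set \<Rightarrow> ('x word \<Rightarrow>\<^sub>0 'k) set" where
  "relation_ideal X R = genideal (free_algebra X) R"

definition residue_class ::
  "'x set \<Rightarrow> ('x word \<Rightarrow>\<^sub>0 'k::field) set \<Rightarrow> ('x word \<Rightarrow>\<^sub>0 'k) \<Rightarrow> ('x word \<Rightarrow>\<^sub>0 'k) set" where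
  "residue_class X R p = relation_ideal X R +>\<^bsub>free_algebra X\<^esub> p"

text \<open>The superalgebra with generators \<open>X\<close>, generator parities \<open>par\<close> and relations \<open>p = 0\<close> for
  \<open>p \<in> R\<close>. Scalar multiplication is written, like the multiplication of \<^const>\<open>FactRing\<close>, as a
  union over representatives.\<close>

definition presented_superalgebra ::
  "'x set \<Rightarrow> ('x \<Rightarrow> nat) \<Rightarrow> ('x word \<Rightarrow>\<^sub>0 'k::field) set \<Rightarrow>
   ('k, ('x word \<Rightarrow>\<^sub>0 'k) set) superalgebra" where
  "presented_superalgebra X par R =
     (let Q = free_algebra X Quot relation_ideal X R in
      \<lparr>carrier = carrier Q, monoid.mult = monoid.mult Q, one = one Q, zero = zero Q, add = add Q,
       module.smult = (\<lambda>c A. \<Union>p\<in>A. residue_class X R (const c * p)),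
       component = (\<lambda>s. residue_class X R `
         {p \<in> carrier (free_algebra X). \<forall>w\<in>Poly_Mapping.keys p. word_parity par w = s})\<rparr>)"


section \<open>The ground field and q-numbers\<close>

text \<open>The indeterminate of \<^typ>\<open>complex poly\<close> plays the role of \<open>q\<^sup>1\<^sup>/\<^sup>2\<close>.\<close>

type_synonym scalar = "complex poly fract"

definition qhalf :: scalar where
  "qhalf = Fract [:0, 1:] 1"

definition q :: scalar where
  "q = qhalf ^ 2"

definition imag_unit :: scalar where
  "imag_unit = Fract [:\<i>:] 1"

text \<open>The power \<open>q\<^sup>x\<close>, meaningful for half-integers \<open>x\<close> only.\<close>

definition qpow :: "real \<Rightarrow> scalar" where
  "qpow x = qhalf powi \<lfloor>2 * x\<rfloor>"

definition qint :: "scalar \<Rightarrow> nat \<Rightarrow> scalar" where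
  "qint p k = (p powi int k - p powi (- int k)) / (p - inverse p)"

definition qint_super :: "scalar \<Rightarrow> nat \<Rightarrow> scalar" where
  "qint_super p k = (p powi int k - (- p) powi (- int k)) / (p + inverse p)"

definition qfact :: "scalar \<Rightarrow> nat \<Rightarrow> scalar" where
  "qfact p N = (\<Prod>i=1..N. qint p i)"

definition qfact_super :: "scalar \<Rightarrow> nat \<Rightarrow> scalar" where
  "qfact_super p N = (\<Prod>i=1..N. qint_super p i)"

definition qbinom :: "scalar \<Rightarrow> nat \<Rightarrow> nat \<Rightarrow> scalar" where
  "qbinom p N k = qfact p N / (qfact p (N - k) * qfact p k)"

definition qbinom_super :: "scalar \<Rightarrow> nat \<Rightarrow> nat \<Rightarrow> scalar" where
  "qbinom_super p N k = qfact_super p N / (qfact_super p (N - k) * qfact_super p k)"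


section \<open>Root data\<close>

datatype basis = Eps nat | Del nat

definition basis_set :: "nat \<Rightarrow> nat \<Rightarrow> basis set" where
  "basis_set m n = Eps ` {1..m} \<union> Del ` {1..n}"

definition admissible :: "nat \<Rightarrow> nat \<Rightarrow> basis rel \<Rightarrow> bool" where
  "admissible m n r \<longleftrightarrow>
     r \<subseteq> basis_set m n \<times> basis_set m n \<and>
     strict_linear_order_on (basis_set m n) r \<and>
     (\<forall>i. 1 \<le> i \<and> i < m \<longrightarrow> (Eps i, Eps (i + 1)) \<in> r) \<and>
     (\<forall>\<mu>. 1 \<le> \<mu> \<and> \<mu> < n \<longrightarrow> (Del \<mu>, Del (\<mu> + 1)) \<in> r)"

text \<open>The \<open>i\<close>-th element of the ordered basis, counted from 1.\<close>

definition ordered_basis :: "nat \<Rightarrow> nat \<Rightarrow> basis rel \<Rightarrow> nat \<Rightarrow> basis" where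
  "ordered_basis m n r i =
     (THE b. b \<in> basis_set m n \<and> card {c \<in> basis_set m n. (c, b) \<in> r} + 1 = i)"

text \<open>Vectors are given by their coordinates with respect to the basis.\<close>

definition basis_vec :: "basis \<Rightarrow> basis \<Rightarrow> real" where
  "basis_vec b = (\<lambda>c. if c = b then 1 else 0)"

definition form :: "nat \<Rightarrow> nat \<Rightarrow> (basis \<Rightarrow> real) \<Rightarrow> (basis \<Rightarrow> real) \<Rightarrow> real" where
  "form m n x y = (\<Sum>i=1..m. - (x (Eps i) * y (Eps i))) + (\<Sum>\<mu>=1..n. x (Del \<mu>) * y (Del \<mu>))"

definition simple_root :: "nat \<Rightarrow> nat \<Rightarrow> basis rel \<Rightarrow> nat \<Rightarrow> basis \<Rightarrow> real" where
  "simple_root m n r i =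
     (if i < m + n
      then (\<lambda>c. basis_vec (ordered_basis m n r i) c - basis_vec (ordered_basis m n r (i + 1)) c)
      else basis_vec (ordered_basis m n r (m + n)))"

definition odd_roots :: "nat \<Rightarrow> nat \<Rightarrow> basis rel \<Rightarrow> nat set" where
  "odd_roots m n r =
     {i. 1 \<le> i \<and> i < m + n \<and>
         ((ordered_basis m n r i \<in> range Del) \<noteq> (ordered_basis m n r (i + 1) \<in> range Del))} \<union>
     {i. i = m + n \<and> ordered_basis m n r (m + n) = Del n}"

abbreviation root_form :: "nat \<Rightarrow> nat \<Rightarrow> basis rel \<Rightarrow> nat \<Rightarrow> nat \<Rightarrow> real" where
  "root_form m n r i j \<equiv> form m n (simple_root m n r i) (simple_root m n r j)"

text \<open>The real numbers under the floor brackets are integers; the floor only changes the type.\<close>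

definition cartan :: "nat \<Rightarrow> nat \<Rightarrow> basis rel \<Rightarrow> nat \<Rightarrow> nat \<Rightarrow> int" where
  "cartan m n r i j =
     (if root_form m n r i i \<noteq> 0 then \<lfloor>2 * root_form m n r i j / root_form m n r i i\<rfloor>
      else \<lfloor>- root_form m n r i j\<rfloor>)"

definition cartan_d :: "nat \<Rightarrow> nat \<Rightarrow> basis rel \<Rightarrow> nat \<Rightarrow> real" where
  "cartan_d m n r i = (if root_form m n r i i \<noteq> 0 then root_form m n r i i / 2 else - 1)"

definition qi :: "nat \<Rightarrow> nat \<Rightarrow> basis rel \<Rightarrow> nat \<Rightarrow> scalar" where
  "qi m n r i = qpow (cartan_d m n r i)"


section \<open>The quantum supergroup\<close>

datatype ugen = E nat | F nat | K nat | Kinv nat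

type_synonym ualg = "ugen word \<Rightarrow>\<^sub>0 scalar"

definition ugens :: "nat \<Rightarrow> nat \<Rightarrow> ugen set" where
  "ugens m n = (\<Union>i\<in>{1..m + n}. {E i, F i, K i, Kinv i})"

text \<open>The common parity of \<open>e\<^sub>i\<close> and \<open>f\<^sub>i\<close>.\<close>

definition par_e :: "nat \<Rightarrow> nat \<Rightarrow> basis rel \<Rightarrow> nat \<Rightarrow> nat" where
  "par_e m n r i = (if i \<in> odd_roots m n r then 1 else 0)"

fun upar :: "nat \<Rightarrow> nat \<Rightarrow> basis rel \<Rightarrow> ugen \<Rightarrow> nat" where
  "upar m n r (E i) = par_e m n r i"
| "upar m n r (F i) = par_e m n r i"
| "upar m n r (K i) = 0"
| "upar m n r (Kinv i) = 0"

definition rels_R1 :: "nat \<Rightarrow> nat \<Rightarrow> basis rel \<Rightarrow> ualg set" where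
  "rels_R1 m n r =
     (let e = \<lambda>i. gen (E i); f = \<lambda>i. gen (F i); k = \<lambda>i. gen (K i); kinv = \<lambda>i. gen (Kinv i) in
      \<Union>i\<in>{1..m + n}.
        {k i * kinv i - 1, kinv i * k i - 1} \<union>
        (\<Union>j\<in>{1..m + n}.
          {k i * k j - k j * k i,
           k i * e j * kinv i - const (qi m n r i powi cartan m n r i j) * e j,
           k i * f j * kinv i - const (qi m n r i powi (- cartan m n r i j)) * f j,
           e i * f j - (-1) ^ (par_e m n r i * par_e m n r j) * f j * e i -
             (if i = j then const (inverse (q - inverse q)) * (k i - kinv i) else 0)}))"

text \<open>In the Serre relations \<open>x\<close> is either the family of the \<open>e\<^sub>i\<close> or that of the \<open>f\<^sub>i\<close>.\<close>

definition serre :: "nat \<Rightarrow> nat \<Rightarrow> basis rel \<Rightarrow> (nat \<Rightarrow> ualg) \<Rightarrow> nat \<Rightarrow> nat \<Rightarrow> ualg" where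
  "serre m n r x i j =
     (let N = nat (1 - cartan m n r i j) in
      \<Sum>k=0..N. const ((-1) ^ k * qbinom (qi m n r i) N k) * x i ^ k * x j * x i ^ (N - k))"

definition serre_super :: "nat \<Rightarrow> nat \<Rightarrow> basis rel \<Rightarrow> (nat \<Rightarrow> ualg) \<Rightarrow> nat \<Rightarrow> nat \<Rightarrow> ualg" where
  "serre_super m n r x s j =
     (let N = nat (1 - cartan m n r s j) in
      \<Sum>k=0..N. const ((-1) ^ (k * (k + 1) div 2 + k * par_e m n r j) *
                        qbinom_super (qi m n r s) N k) * x s ^ k * x j * x s ^ (N - k))"

definition rels_R2 :: "nat \<Rightarrow> nat \<Rightarrow> basis rel \<Rightarrow> (nat \<Rightarrow> ualg) \<Rightarrow> ualg set" where
  "rels_R2 m n r x =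
     {serre m n r x i j | i j.
        i \<in> {1..m + n} \<and> j \<in> {1..m + n} \<and> j \<noteq> i \<and> i \<notin> odd_roots m n r} \<union>
     {serre_super m n r x s j | s j.
        s \<in> {1..m + n} \<and> j \<in> {1..m + n} \<and> j \<noteq> s \<and> s \<in> odd_roots m n r \<and>
        cartan m n r s s = 2} \<union>
     {x s ^ 2 | s. s \<in> {1..m + n} \<and> cartan m n r s s = 0}"

definition triple :: "nat \<Rightarrow> nat \<Rightarrow> basis rel \<Rightarrow> (nat \<Rightarrow> ualg) \<Rightarrow> nat \<Rightarrow> nat \<Rightarrow> nat \<Rightarrow> ualg" where
  "triple m n r x i s j =
     (let a = cartan m n r; p = par_e m n r;
          y = x s * x j - const ((-1) ^ p j * qi m n r j powi a j s) * x j * x s in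
      x i * y - const ((-1) ^ (p i * (1 + p j)) * qi m n r i powi (a i s + a i j)) * y * x i)"

definition rels_R3 :: "nat \<Rightarrow> nat \<Rightarrow> basis rel \<Rightarrow> (nat \<Rightarrow> ualg) \<Rightarrow> ualg set" where
  "rels_R3 m n r x =
     (let a = cartan m n r; p = par_e m n r; y = \<lambda>s. triple m n r x (s - 1) s (s + 1) in
      {x s * y s + (-1) ^ (p (s - 1) + p (s + 1)) * y s * x s | s.
         1 < s \<and> s < m + n - 1 \<and> a s s = 0 \<and> a (s - 1) s = - a s (s + 1)} \<union>
      {x s * y s + (-1) ^ p (s - 1) * y s * x s | s.
         s = m + n - 1 \<and> s > 1 \<and> a s s = 0 \<and> simple_root m n r (m + n) = basis_vec (Eps m)} \<union>
      {x s * y s - (-1) ^ p (s - 1) * y s * x s | s.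
         s = m + n - 1 \<and> s > 1 \<and> a s s = 0 \<and> simple_root m n r (m + n) = basis_vec (Del n)})"

definition urels :: "nat \<Rightarrow> nat \<Rightarrow> basis rel \<Rightarrow> ualg set" where
  "urels m n r =
     rels_R1 m n r \<union>
     (\<Union>x\<in>{\<lambda>i. gen (E i), \<lambda>i. gen (F i)}. rels_R2 m n r x \<union> rels_R3 m n r x)"

definition Uq_osp :: "nat \<Rightarrow> nat \<Rightarrow> basis rel \<Rightarrow> (scalar, ualg set) superalgebra" where
  "Uq_osp m n r = presented_superalgebra (ugens m n) (upar m n r) (urels m n r)"

definition ucls :: "nat \<Rightarrow> nat \<Rightarrow> basis rel \<Rightarrow> ugen \<Rightarrow> ualg set" where
  "ucls m n r x = residue_class (ugens m n) (urels m n r) (gen x)"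


section \<open>The deformed Clifford superalgebra\<close>

datatype cgen = Phi nat | Phid nat | Ups nat | Upsinv nat

type_synonym calg = "cgen word \<Rightarrow>\<^sub>0 scalar"

definition cgens :: "nat \<Rightarrow> nat \<Rightarrow> cgen set" where
  "cgens m n = (\<Union>i\<in>{1..m + n}. {Phi i, Phid i, Ups i, Upsinv i})"

text \<open>The common parity of \<open>\<Phi>\<^sub>i\<close> and \<open>\<Phi>\<^sub>i\<^sup>\<dagger>\<close>.\<close>

definition par_Phi :: "nat \<Rightarrow> nat \<Rightarrow> basis rel \<Rightarrow> nat \<Rightarrow> nat" where
  "par_Phi m n r i = (if ordered_basis m n r i \<in> range Del then 1 else 0)"

fun cpar :: "nat \<Rightarrow> nat \<Rightarrow> basis rel \<Rightarrow> cgen \<Rightarrow> nat" where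
  "cpar m n r (Phi i) = par_Phi m n r i"
| "cpar m n r (Phid i) = par_Phi m n r i"
| "cpar m n r (Ups i) = 0"
| "cpar m n r (Upsinv i) = 0"

definition crels :: "nat \<Rightarrow> nat \<Rightarrow> basis rel \<Rightarrow> calg set" where
  "crels m n r =
     (let \<Phi> = \<lambda>i. gen (Phi i); \<Phi>d = \<lambda>i. gen (Phid i);
          u = \<lambda>i. gen (Ups i); uinv = \<lambda>i. gen (Upsinv i); p = par_Phi m n r in
      \<Union>i\<in>{1..m + n}.
        {u i * uinv i - 1, uinv i * u i - 1,
         \<Phi> i * \<Phi>d i - const ((-1) ^ p i * q) * \<Phi>d i * \<Phi> i - uinv i,
         \<Phi> i * \<Phi>d i - const ((-1) ^ p i * inverse q) * \<Phi>d i * \<Phi> i - u i} \<union>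
        (\<Union>j\<in>{1..m + n}.
          {u i * u j - u j * u i,
           u i * \<Phi> j * uinv i - const (q powi (if i = j then - ((-1) ^ p j) else 0)) * \<Phi> j,
           u i * \<Phi>d j * uinv i - const (q powi (if i = j then (-1) ^ p j else 0)) * \<Phi>d j,
           \<Phi> i * \<Phi> j - (-1) ^ (p i * p j) * \<Phi> j * \<Phi> i,
           \<Phi>d i * \<Phi>d j - (-1) ^ (p i * p j) * \<Phi>d j * \<Phi>d i}) \<union>
        (\<Union>j\<in>{1..m + n} - {i}. {\<Phi> i * \<Phi>d j - (-1) ^ (p i * p j) * \<Phi>d j * \<Phi> i}))"

definition Clq :: "nat \<Rightarrow> nat \<Rightarrow> basis rel \<Rightarrow> (scalar, calg set) superalgebra" where
  "Clq m n r = presented_superalgebra (cgens m n) (cpar m n r) (crels m n r)"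

definition ccls :: "nat \<Rightarrow> nat \<Rightarrow> basis rel \<Rightarrow> cgen \<Rightarrow> calg set" where
  "ccls m n r x = residue_class (cgens m n) (crels m n r) (gen x)"

end

theory Submission
  imports Defs
begin

text \<open>
  A homomorphism out of a presented superalgebra is the same thing as an assignment of the generators
  that preserves parity and respects the relations (\<open>superalgebra_hom_exists\<close>,
  \<open>superalgebra_hom_eqI\<close>). The theorem prescribes the images of \<open>e\<^sub>i\<close>, \<open>f\<^sub>i\<close> and \<open>k\<^sub>i\<close>; the images of
  the inverses of the \<open>k\<^sub>i\<close> are then forced (\<open>hom_determines_inverse\<close>). What has to be checked is
  that these images satisfy the relations of the quantum supergroup.

  Write \<open>s = 1\<close> for an even and \<open>s = - 1\<close> for an odd node. The last two Clifford relations contain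
  one of the form \<open>\<Phi> \<Phi>\<^sup>\<dagger> = s q\<^sup>-\<^sup>s \<Phi>\<^sup>\<dagger> \<Phi> + W\<close>, where \<open>W\<close> is the torus element \<open>U\<close> or its inverse,
  chosen so that \<open>W \<Phi> = q\<^sup>-\<^sup>1 \<Phi> W\<close> and \<open>W \<Phi>\<^sup>\<dagger> = q \<Phi>\<^sup>\<dagger> W\<close>. Up to scalars the relation keeps this form when
  \<open>\<Phi>\<close> and \<open>\<Phi>\<^sup>\<dagger>\<close> are exchanged. Hence the images of the \<open>e\<^sub>i\<close> and those of the \<open>f\<^sub>i\<close> are both of the form
  \<open>x\<^sub>i y\<^sub>i\<^sub>+\<^sub>1\<close> for a chain of oscillators \<open>x\<^sub>i\<close>, \<open>y\<^sub>i\<close> that supercommute at different nodes, and the Serre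
  relations need to be proved only once, for such a chain (locale \<open>oscillator_chain\<close>). At an even node the
  quadratic relation restates the commutation rules of \<open>W\<close> (\<open>oscillator_serre\<close>), and the cubic relation at the
  short root is a commutator of the quadratic one. At an odd node squares vanish. In the higher order
  relations each \<open>q\<close>-commutator contracts the oscillator pair shared by two neighbouring root vectors to
  its \<open>W\<close> (\<open>contraction\<close>); the result \<open>x\<^sub>s\<^sub>-\<^sub>1 W\<^sub>s W\<^sub>s\<^sub>+\<^sub>1 y\<^sub>s\<^sub>+\<^sub>2\<close> supercommutes with \<open>x\<^sub>s y\<^sub>s\<^sub>+\<^sub>1\<close> because the two
  weights cancel (\<open>odd_reflection_serre\<close>). Conjugation by \<open>k\<^sub>i\<close> is a comparison of weights, and the
  commutator of \<open>e\<^sub>i\<close> and \<open>f\<^sub>i\<close> follows by expressing \<open>\<Phi>\<^sup>\<dagger> \<Phi>\<close> and \<open>\<Phi> \<Phi>\<^sup>\<dagger>\<close> through \<open>U\<close> (\<open>E_F_same\<close>).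

  These computations are equations in a ring, to be read modulo the ideal of the Clifford relations. This
  ideal depends on \<open>m\<close>, \<open>n\<close> and the order, which a type cannot. Therefore one suitable ideal is fixed
  once and for all: Hilbert choice picks an ideal modulo which the relations fail, if there is any. The
  quotient by it is a type on which the computations are carried out, and they show that the chosen ideal
  is no exception; so there is none (\<open>not_violates\<close>).
\<close>

section \<open>Free algebras and substitution\<close>

lemma const_0 [simp]: "const 0 = 0"
  by (simp add: const_def)

lemma const_1 [simp]: "const 1 = 1"
  by (simp add: const_def)

lemma const_add: "const (a + b) = const a + const b"
  by (simp add: const_def single_add)

lemma const_mult: "const (a * b) = const a * const b"
  by (simp add: const_def mult_single)

lemma single_eq_const_mult_gens:
  "Poly_Mapping.single w a = const a * prod_list (map gen (letters w))"
proof -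
  have "prod_list (map gen xs) = Poly_Mapping.single (Word xs) (1 :: 'b)" for xs :: "'a list"
    by (induction xs) (simp_all add: gen_def mult_single plus_word_def zero_word_def[symmetric])
  then show ?thesis
    by (simp add: const_def mult_single word.expand)
qed

lemma poly_mapping_add_induct [case_names zero single add]:
  fixes p :: "'a \<Rightarrow>\<^sub>0 'b::comm_monoid_add"
  assumes "P 0"
    and "\<And>w a. w \<in> Poly_Mapping.keys p \<Longrightarrow> P (Poly_Mapping.single w a)"
    and "\<And>x y. P x \<Longrightarrow> P y \<Longrightarrow> P (x + y)"
  shows "P p"
proof -
  have "P (\<Sum>w\<in>A. Poly_Mapping.single w (Poly_Mapping.lookup p w))"
    if "finite A" "A \<subseteq> Poly_Mapping.keys p" for A
    using that assms by (induction A rule: finite_induct) auto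
  then have "P (\<Sum>w\<in>Poly_Mapping.keys p. Poly_Mapping.single w (Poly_Mapping.lookup p w))"
    by simp
  moreover have "(\<Sum>w\<in>Poly_Mapping.keys p. Poly_Mapping.single w (Poly_Mapping.lookup p w)) = p"
    by (rule poly_mapping_eqI)
      (auto simp: lookup_sum lookup_single when_def in_keys_iff sum.delta)
  ultimately show ?thesis
    by simp
qed

lemma const_commute: "const a * p = p * const (a::'k::field)"
  by (induction p rule: poly_mapping_add_induct)
    (simp_all add: const_def mult_single distrib_left distrib_right mult.commute)

text \<open>The algebra homomorphism extending \<open>g\<close>. It is defined on all noncommutative polynomials,
  whatever letters occur in them, so that the homomorphism laws have no side conditions.\<close>

definition substitute ::
  "('x \<Rightarrow> 'y word \<Rightarrow>\<^sub>0 'k) \<Rightarrow> ('x word \<Rightarrow>\<^sub>0 'k::field) \<Rightarrow> 'y word \<Rightarrow>\<^sub>0 'k" where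
  "substitute g p =
     (\<Sum>w\<in>Poly_Mapping.keys p. const (Poly_Mapping.lookup p w) * prod_list (map g (letters w)))"

lemma substitute_superset:
  assumes "finite A" "Poly_Mapping.keys p \<subseteq> A"
  shows "substitute g p = (\<Sum>w\<in>A. const (Poly_Mapping.lookup p w) * prod_list (map g (letters w)))"
  unfolding substitute_def using assms
  by (intro sum.mono_neutral_left) (auto simp: in_keys_iff)

lemma substitute_add: "substitute g (x + y) = substitute g x + substitute g y"
proof -
  let ?A = "Poly_Mapping.keys x \<union> Poly_Mapping.keys y"
  have "Poly_Mapping.keys (x + y) \<subseteq> ?A"
    by (rule keys_add)
  then show ?thesis
    by (simp add: substitute_superset[of ?A] lookup_add const_add distrib_right sum.distrib)
qed

lemma substitute_0 [simp]: "substitute g 0 = 0"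
  by (simp add: substitute_def)

lemma substitute_single:
  "substitute g (Poly_Mapping.single w a) = const a * prod_list (map g (letters w))"
  by (cases "a = 0") (simp_all add: substitute_def)

lemma substitute_const [simp]: "substitute g (const a) = const a"
  using substitute_single[of g 0 a] by (simp add: const_def zero_word_def)

lemma substitute_1 [simp]: "substitute g 1 = 1"
  using substitute_const[of g 1] by simp

lemma substitute_gen [simp]: "substitute g (gen x) = g x"
  by (simp add: gen_def substitute_single)

lemma substitute_mult: "substitute g (x * y) = substitute g x * substitute g y"
proof (induction x rule: poly_mapping_add_induct)
  case (single w a)
  show ?case
  proof (induction y rule: poly_mapping_add_induct)
    case (single v b)
    show ?case
      using const_commute[of b "prod_list (map g (letters w))"]
      by (simp add: mult_single substitute_single plus_word_def const_mult mult.assoc)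
        (simp add: mult.assoc[symmetric])
  qed (simp_all add: distrib_left substitute_add)
qed (simp_all add: distrib_right substitute_add)

lemma substitute_uminus: "substitute g (- x) = - substitute g x"
  using substitute_add[of g "- x" x] by (simp add: eq_neg_iff_add_eq_0)

lemma substitute_diff: "substitute g (x - y) = substitute g x - substitute g y"
  using substitute_add[of g x "- y"] by (simp add: substitute_uminus)

lemma substitute_power: "substitute g (x ^ k) = substitute g x ^ k"
  by (induction k) (simp_all add: substitute_mult)

lemma substitute_sum: "substitute g (sum f A) = (\<Sum>a\<in>A. substitute g (f a))"
  by (induction A rule: infinite_finite_induct) (simp_all add: substitute_add)

lemmas substitute_simps =
  substitute_add substitute_mult substitute_diff substitute_uminus substitute_power substitute_sum

lemma carrier_free_algebra_iff:
  "p \<in> carrier (free_algebra X) \<longleftrightarrow> (\<forall>w\<in>Poly_Mapping.keys p. set (letters w) \<subseteq> X)"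
  by (simp add: free_algebra_def)

lemma free_algebra_simps [simp]:
  "x \<otimes>\<^bsub>free_algebra X\<^esub> y = x * y" "x \<oplus>\<^bsub>free_algebra X\<^esub> y = x + y"
  "\<one>\<^bsub>free_algebra X\<^esub> = 1" "\<zero>\<^bsub>free_algebra X\<^esub> = 0"
  by (simp_all add: free_algebra_def)

lemma single_in_free_algebra:
  "set (letters w) \<subseteq> X \<Longrightarrow> Poly_Mapping.single w a \<in> carrier (free_algebra X)"
  by (simp add: carrier_free_algebra_iff)

lemma const_in_free_algebra [simp]: "const a \<in> carrier (free_algebra X)"
  by (simp add: const_def single_in_free_algebra zero_word_def)

lemma zero_in_free_algebra [simp]: "0 \<in> carrier (free_algebra X)"
  using const_in_free_algebra[of 0] by simp

lemma one_in_free_algebra [simp]: "1 \<in> carrier (free_algebra X)"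
  using const_in_free_algebra[of 1] by simp

lemma gen_in_free_algebra: "x \<in> X \<Longrightarrow> gen x \<in> carrier (free_algebra X)"
  by (simp add: gen_def single_in_free_algebra)

lemma add_in_free_algebra:
  "x \<in> carrier (free_algebra X) \<Longrightarrow> y \<in> carrier (free_algebra X) \<Longrightarrow>
    x + y \<in> carrier (free_algebra X)"
  using keys_add[of x y] by (auto simp: carrier_free_algebra_iff)

lemma uminus_in_free_algebra:
  "x \<in> carrier (free_algebra X) \<Longrightarrow> - x \<in> carrier (free_algebra X)"
  by (simp add: carrier_free_algebra_iff in_keys_iff)

lemma diff_in_free_algebra:
  "x \<in> carrier (free_algebra X) \<Longrightarrow> y \<in> carrier (free_algebra X) \<Longrightarrow>
    x - y \<in> carrier (free_algebra X)"
  using add_in_free_algebra[of x X "- y"] by (simp add: uminus_in_free_algebra)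

lemma mult_in_free_algebra:
  assumes "x \<in> carrier (free_algebra X)" "y \<in> carrier (free_algebra X)"
  shows "x * y \<in> carrier (free_algebra X)"
  unfolding carrier_free_algebra_iff
proof
  fix w assume "w \<in> Poly_Mapping.keys (x * y)"
  then obtain u v where "w = u + v" "u \<in> Poly_Mapping.keys x" "v \<in> Poly_Mapping.keys y"
    using keys_mult[of x y] by blast
  then show "set (letters w) \<subseteq> X"
    using assms by (auto simp: carrier_free_algebra_iff plus_word_def)
qed

lemma power_in_free_algebra:
  "x \<in> carrier (free_algebra X) \<Longrightarrow> x ^ k \<in> carrier (free_algebra X)"
  by (induction k) (simp_all add: mult_in_free_algebra)

lemma sum_in_free_algebra:
  "(\<And>a. a \<in> A \<Longrightarrow> f a \<in> carrier (free_algebra X)) \<Longrightarrow> sum f A \<in> carrier (free_algebra X)"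
  by (induction A rule: infinite_finite_induct) (simp_all add: add_in_free_algebra)

lemmas free_algebra_closed =
  gen_in_free_algebra add_in_free_algebra uminus_in_free_algebra diff_in_free_algebra
  mult_in_free_algebra power_in_free_algebra sum_in_free_algebra

lemma ring_free_algebra: "ring (free_algebra X)"
proof (rule ringI)
  show "abelian_group (free_algebra X)"
  proof (rule abelian_groupI)
    fix x assume "x \<in> carrier (free_algebra X)"
    then show "\<exists>y\<in>carrier (free_algebra X). y \<oplus>\<^bsub>free_algebra X\<^esub> x = \<zero>\<^bsub>free_algebra X\<^esub>"
      by (intro bexI[of _ "- x"]) (simp_all add: uminus_in_free_algebra)
  qed (simp_all add: add_in_free_algebra ac_simps)
  show "Group.monoid (free_algebra X)"
    by (rule monoidI) (simp_all add: mult_in_free_algebra mult.assoc)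
qed (simp_all add: distrib_left distrib_right)

lemma free_algebra_induct [consumes 1, case_names const gen add mult]:
  assumes "p \<in> carrier (free_algebra X)"
    and const: "\<And>a. P (const a)"
    and gen: "\<And>x. x \<in> X \<Longrightarrow> P (gen x)"
    and add: "\<And>y z. y \<in> carrier (free_algebra X) \<Longrightarrow> z \<in> carrier (free_algebra X) \<Longrightarrow>
      P y \<Longrightarrow> P z \<Longrightarrow> P (y + z)"
    and mult: "\<And>y z. y \<in> carrier (free_algebra X) \<Longrightarrow> z \<in> carrier (free_algebra X) \<Longrightarrow>
      P y \<Longrightarrow> P z \<Longrightarrow> P (y * z)"
  shows "P p"
proof -
  have word: "P m \<and> m \<in> carrier (free_algebra X)"
    if "set xs \<subseteq> X" "m = prod_list (map gen xs)" for xs and m :: "'a word \<Rightarrow>\<^sub>0 'b"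
    using that
  proof (induction xs arbitrary: m)
    case Nil
    then show ?case using const[of 1] by simp
  next
    case (Cons x xs)
    then show ?case
      by (simp add: gen mult gen_in_free_algebra mult_in_free_algebra)
  qed
  have "P p \<and> p \<in> carrier (free_algebra X)"
  proof (induction p rule: poly_mapping_add_induct)
    case zero
    show ?case using const[of 0] by simp
  next
    case (single w a)
    then have "set (letters w) \<subseteq> X"
      using assms(1) by (simp add: carrier_free_algebra_iff)
    then show ?case
      unfolding single_eq_const_mult_gens
      using word[OF _ refl] const mult by (simp add: mult_in_free_algebra)
  qed (simp add: add add_in_free_algebra)
  then show ?thesis ..
qed

lemma substitute_in_free_algebra:
  assumes "p \<in> carrier (free_algebra X)" "\<And>x. x \<in> X \<Longrightarrow> g x \<in> carrier (free_algebra Y)"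
  shows "substitute g p \<in> carrier (free_algebra Y)"
  using assms(1)
  by (induction rule: free_algebra_induct) (simp_all add: assms(2) substitute_simps free_algebra_closed)

section \<open>Homomorphisms between presented superalgebras\<close>

text \<open>The polynomials whose residue classes form the component of parity \<open>s\<close>.\<close>

definition homogeneous ::
  "'x set \<Rightarrow> ('x \<Rightarrow> nat) \<Rightarrow> nat \<Rightarrow> ('x word \<Rightarrow>\<^sub>0 'k::field) set" where
  "homogeneous X par s =
     {p \<in> carrier (free_algebra X). \<forall>w\<in>Poly_Mapping.keys p. word_parity par w = s}"

lemma homogeneous_0: "0 \<in> homogeneous X par s"
  by (simp add: homogeneous_def)

lemma homogeneous_const: "const a \<in> homogeneous X par 0"
  by (auto simp: homogeneous_def const_def word_parity_def zero_word_def single_in_free_algebra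
      split: if_splits)

lemma homogeneous_gen: "x \<in> X \<Longrightarrow> gen x \<in> homogeneous X par (par x mod 2)"
  by (auto simp: homogeneous_def gen_in_free_algebra) (simp add: gen_def word_parity_def)

lemma homogeneous_add:
  "x \<in> homogeneous X par s \<Longrightarrow> y \<in> homogeneous X par s \<Longrightarrow> x + y \<in> homogeneous X par s"
  using keys_add[of x y] by (auto simp: homogeneous_def add_in_free_algebra)

lemma homogeneous_mult:
  assumes "x \<in> homogeneous X par s" "y \<in> homogeneous X par t"
  shows "x * y \<in> homogeneous X par ((s + t) mod 2)"
  unfolding homogeneous_def
proof (intro CollectI conjI ballI)
  fix w assume "w \<in> Poly_Mapping.keys (x * y)"
  then obtain u v where w: "w = u + v" "u \<in> Poly_Mapping.keys x" "v \<in> Poly_Mapping.keys y"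
    using keys_mult[of x y] by blast
  then have "word_parity par w = (word_parity par u + word_parity par v) mod 2"
    by (simp add: word_parity_def plus_word_def mod_add_eq)
  with w assms show "word_parity par w = (s + t) mod 2"
    by (simp add: homogeneous_def)
qed (use assms in \<open>simp add: homogeneous_def mult_in_free_algebra\<close>)

text \<open>The parity of \<open>g x\<close> is taken modulo 2 because the components are indexed by 0 and 1 only.\<close>

lemma substitute_homogeneous:
  assumes g: "\<And>x. x \<in> X \<Longrightarrow> g x \<in> homogeneous Y par' (par x mod 2)"
    and p: "p \<in> homogeneous X par s"
  shows "substitute g p \<in> homogeneous Y par' s"
proof (induction p rule: poly_mapping_add_induct)
  case (single w a)
  have word: "prod_list (map g xs) \<in> homogeneous Y par' ((\<Sum>x\<leftarrow>xs. par x) mod 2)"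
    if "set xs \<subseteq> X" for xs
    using that
  proof (induction xs)
    case Nil
    show ?case using homogeneous_const[of 1] by simp
  next
    case (Cons x xs)
    then show ?case
      using homogeneous_mult[OF g[of x]] by (fastforce simp: mod_add_eq)
  qed
  have "set (letters w) \<subseteq> X" "(\<Sum>x\<leftarrow>letters w. par x) mod 2 = s"
    using single p by (auto simp: homogeneous_def carrier_free_algebra_iff word_parity_def)
  then show ?case
    using homogeneous_mult[OF homogeneous_const word]
    by (fastforce simp: substitute_single)
qed (simp_all add: homogeneous_0 substitute_add homogeneous_add)

locale presentation =
  fixes X :: "'x set" and par :: "'x \<Rightarrow> nat" and R :: "('x word \<Rightarrow>\<^sub>0 'k::field) set"
  assumes relations: "R \<subseteq> carrier (free_algebra X)"
begin

abbreviation "A \<equiv> presented_superalgebra X par R"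
abbreviation "cls \<equiv> residue_class X R"

lemma relation_ideal: "ideal (relation_ideal X R) (free_algebra X)"
  unfolding relation_ideal_def
  using ring.genideal_ideal[OF ring_free_algebra relations] .

lemma relation_in_ideal: "\<rho> \<in> R \<Longrightarrow> \<rho> \<in> relation_ideal X R"
  unfolding relation_ideal_def
  using ring.genideal_self[OF ring_free_algebra relations] by blast

lemma cls_simps:
  assumes "x \<in> carrier (free_algebra X)" "y \<in> carrier (free_algebra X)"
  shows "cls x \<otimes>\<^bsub>A\<^esub> cls y = cls (x * y)" "cls x \<oplus>\<^bsub>A\<^esub> cls y = cls (x + y)"
proof -
  interpret ideal "relation_ideal X R" "free_algebra X" by (rule relation_ideal)
  have hom: "cls \<in> ring_hom (free_algebra X) (free_algebra X Quot relation_ideal X R)"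
    using rcos_ring_hom by (simp add: residue_class_def[abs_def])
  show "cls x \<otimes>\<^bsub>A\<^esub> cls y = cls (x * y)" "cls x \<oplus>\<^bsub>A\<^esub> cls y = cls (x + y)"
    using ring_hom_mult[OF hom assms] ring_hom_add[OF hom assms]
    by (simp_all add: presented_superalgebra_def Let_def)
qed

lemma one_eq_cls: "\<one>\<^bsub>A\<^esub> = cls 1"
  by (simp add: presented_superalgebra_def Let_def FactRing_def residue_class_def)

lemma carrier_eq: "carrier A = cls ` carrier (free_algebra X)"
proof -
  have "a_rcosets\<^bsub>free_algebra X\<^esub> relation_ideal X R = cls ` carrier (free_algebra X)"
    by (auto simp: A_RCOSETS_def' residue_class_def)
  then show ?thesis
    by (simp add: presented_superalgebra_def Let_def FactRing_def)
qed

lemma component_eq: "component A s = cls ` homogeneous X par s"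
  by (simp add: presented_superalgebra_def Let_def homogeneous_def)

lemma mem_cls_iff: "z \<in> cls x \<longleftrightarrow> z - x \<in> relation_ideal X R"
  by (auto simp: residue_class_def a_r_coset_defs free_algebra_def intro: bexI[of _ "z - x"])

lemma ideal_closed:
  "x \<in> relation_ideal X R \<Longrightarrow> y \<in> relation_ideal X R \<Longrightarrow> x + y \<in> relation_ideal X R"
  "a \<in> carrier (free_algebra X) \<Longrightarrow> x \<in> relation_ideal X R \<Longrightarrow> a * x \<in> relation_ideal X R"
  "a \<in> carrier (free_algebra X) \<Longrightarrow> x \<in> relation_ideal X R \<Longrightarrow> x * a \<in> relation_ideal X R"
  "x \<in> relation_ideal X R \<Longrightarrow> x \<in> carrier (free_algebra X)"
  "0 \<in> relation_ideal X R"
proof -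
  interpret ideal "relation_ideal X R" "free_algebra X" by (rule relation_ideal)
  show "x \<in> relation_ideal X R \<Longrightarrow> y \<in> relation_ideal X R \<Longrightarrow> x + y \<in> relation_ideal X R"
    using additive_subgroup.a_closed[OF is_additive_subgroup, of x y] by simp
  show "a \<in> carrier (free_algebra X) \<Longrightarrow> x \<in> relation_ideal X R \<Longrightarrow> a * x \<in> relation_ideal X R"
    using I_l_closed by simp
  show "a \<in> carrier (free_algebra X) \<Longrightarrow> x \<in> relation_ideal X R \<Longrightarrow> x * a \<in> relation_ideal X R"
    using I_r_closed by simp
  show "x \<in> relation_ideal X R \<Longrightarrow> x \<in> carrier (free_algebra X)"
    using a_Hcarr by simp
  show "0 \<in> relation_ideal X R"
    using additive_subgroup.zero_closed[OF is_additive_subgroup] by simp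
qed

lemma ideal_uminus: "x \<in> relation_ideal X R \<Longrightarrow> - x \<in> relation_ideal X R"
  using ideal_closed(2)[OF const_in_free_algebra[of "- 1"], of x]
  by (simp add: const_def single_uminus)

lemma cls_eq_iff: "cls x = cls y \<longleftrightarrow> x - y \<in> relation_ideal X R"
proof
  assume "cls x = cls y"
  moreover have "x \<in> cls x" by (simp add: mem_cls_iff ideal_closed)
  ultimately show "x - y \<in> relation_ideal X R" by (simp add: mem_cls_iff)
next
  assume xy: "x - y \<in> relation_ideal X R"
  have "z - x \<in> relation_ideal X R \<longleftrightarrow> z - y \<in> relation_ideal X R" for z
    using ideal_closed(1)[of "z - x" "x - y"] ideal_closed(1)[of "z - y" "- (x - y)"]
      ideal_uminus[OF xy] xy by (auto simp: algebra_simps)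
  then show "cls x = cls y"
    by (auto simp: mem_cls_iff)
qed

lemma smult_cls:
  assumes "x \<in> carrier (free_algebra X)"
  shows "c \<odot>\<^bsub>A\<^esub> cls x = cls (const c * x)"
proof -
  have "cls (const c * y) = cls (const c * x)" if "y \<in> cls x" for y
    using that ideal_closed(2)[OF const_in_free_algebra[of c], of "y - x"]
    by (simp add: mem_cls_iff cls_eq_iff algebra_simps)
  moreover have "x \<in> cls x" by (simp add: mem_cls_iff ideal_closed)
  ultimately have "(\<Union>y\<in>cls x. cls (const c * y)) = cls (const c * x)"
    by blast
  then show ?thesis
    by (simp add: presented_superalgebra_def Let_def)
qed

text \<open>Every element is built from generators and constants by sums and products, and on a constant, a
  scalar multiple of the unit, the value is determined by linearity.\<close>

lemma superalgebra_hom_eqI: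
  assumes h: "h \<in> superalgebra_hom A B" and h': "h' \<in> superalgebra_hom A B"
    and ext: "h \<in> extensional (carrier A)" "h' \<in> extensional (carrier A)"
    and gens: "\<And>x. x \<in> X \<Longrightarrow> h (cls (gen x)) = h' (cls (gen x))"
  shows "h = h'"
proof (rule extensionalityI[OF ext])
  have ring_hom: "h \<in> ring_hom A B" "h' \<in> ring_hom A B"
    using h h' by (simp_all add: superalgebra_hom_def)
  have agree: "h (cls x) = h' (cls x)" if "x \<in> carrier (free_algebra X)" for x
    using that
  proof (induction rule: free_algebra_induct)
    case (const a)
    have eq: "cls (const a) = a \<odot>\<^bsub>A\<^esub> \<one>\<^bsub>A\<^esub>"
      by (simp add: one_eq_cls smult_cls)
    have one: "\<one>\<^bsub>A\<^esub> \<in> carrier A"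
      by (simp add: one_eq_cls carrier_eq)
    have "h (a \<odot>\<^bsub>A\<^esub> \<one>\<^bsub>A\<^esub>) = a \<odot>\<^bsub>B\<^esub> h \<one>\<^bsub>A\<^esub>"
      "h' (a \<odot>\<^bsub>A\<^esub> \<one>\<^bsub>A\<^esub>) = a \<odot>\<^bsub>B\<^esub> h' \<one>\<^bsub>A\<^esub>"
      using h h' one unfolding superalgebra_hom_def by blast+
    then show ?case
      unfolding eq by (simp only: ring_hom_one[OF ring_hom(1)] ring_hom_one[OF ring_hom(2)])
  next
    case (gen x)
    then show ?case by (rule gens)
  next
    case (add y z)
    then have "cls y \<in> carrier A" "cls z \<in> carrier A" by (simp_all add: carrier_eq)
    with add show ?case
      using ring_hom_add[OF ring_hom(1)] ring_hom_add[OF ring_hom(2)] cls_simps(2) by metis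
  next
    case (mult y z)
    then have "cls y \<in> carrier A" "cls z \<in> carrier A" by (simp_all add: carrier_eq)
    with mult show ?case
      using ring_hom_mult[OF ring_hom(1)] ring_hom_mult[OF ring_hom(2)] cls_simps(1) by metis
  qed
  fix a assume "a \<in> carrier A"
  then obtain x where "x \<in> carrier (free_algebra X)" "a = cls x"
    unfolding carrier_eq by blast
  then show "h a = h' a"
    by (simp only: agree)
qed

end

text \<open>The universal property. The polynomials that substitution sends into the ideal of the target form
  an ideal; once it contains the relations of the source it contains the ideal that they generate, so the
  substitution is well defined on residue classes.\<close>

lemma superalgebra_hom_exists:
  fixes X :: "'x set" and Y :: "'y set" and R :: "('x word \<Rightarrow>\<^sub>0 'k::field) set"
  assumes "presentation X R" and "presentation Y S"
    and g: "\<And>x. x \<in> X \<Longrightarrow> g x \<in> homogeneous Y par' (par x mod 2)"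
    and rel: "\<And>\<rho>. \<rho> \<in> R \<Longrightarrow> substitute g \<rho> \<in> relation_ideal Y S"
  obtains h where "h \<in> extensional (carrier (presented_superalgebra X par R))"
    and "h \<in> superalgebra_hom (presented_superalgebra X par R) (presented_superalgebra Y par' S)"
    and "\<And>x. x \<in> carrier (free_algebra X) \<Longrightarrow>
      h (residue_class X R x) = residue_class Y S (substitute g x)"
proof -
  interpret source: presentation X par R by fact
  interpret target: presentation Y par' S by fact
  have g_closed: "g x \<in> carrier (free_algebra Y)" if "x \<in> X" for x
    using g[OF that] by (simp add: homogeneous_def)
  note closed = substitute_in_free_algebra[OF _ g_closed]
  define K where "K = {x \<in> carrier (free_algebra X). substitute g x \<in> relation_ideal Y S}"
  have "ideal K (free_algebra X)"
  proof (rule idealI[OF ring_free_algebra])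
    show "subgroup K (add_monoid (free_algebra X))"
    proof (rule subgroup.intro)
      show "K \<subseteq> carrier (add_monoid (free_algebra X))"
        by (auto simp: K_def)
      show "x \<otimes>\<^bsub>add_monoid (free_algebra X)\<^esub> y \<in> K" if "x \<in> K" "y \<in> K" for x y
        using that by (simp add: K_def substitute_add add_in_free_algebra target.ideal_closed(1))
      show "\<one>\<^bsub>add_monoid (free_algebra X)\<^esub> \<in> K"
        by (simp add: K_def target.ideal_closed(5))
      fix x assume x: "x \<in> K"
      then have "- x \<in> K"
        by (simp add: K_def substitute_uminus uminus_in_free_algebra target.ideal_uminus)
      moreover have "inv\<^bsub>add_monoid (free_algebra X)\<^esub> x = - x"
        using x abelian_group.minus_equality[OF ring.is_abelian_group[OF ring_free_algebra[of X]], of "- x" x]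
        by (simp add: K_def a_inv_def uminus_in_free_algebra)
      ultimately show "inv\<^bsub>add_monoid (free_algebra X)\<^esub> x \<in> K" by simp
    qed
    show "x \<otimes>\<^bsub>free_algebra X\<^esub> a \<in> K" "a \<otimes>\<^bsub>free_algebra X\<^esub> x \<in> K"
      if "a \<in> K" "x \<in> carrier (free_algebra X)" for a x
      using that target.ideal_closed(2,3)[OF closed, of x]
      by (simp_all add: K_def substitute_mult mult_in_free_algebra)
  qed
  moreover have "R \<subseteq> K"
    using source.relations rel by (auto simp: K_def)
  ultimately have "relation_ideal X R \<subseteq> K"
    unfolding relation_ideal_def by (rule ring.genideal_minimal[OF ring_free_algebra])
  then have respects: "substitute g x \<in> relation_ideal Y S" if "x \<in> relation_ideal X R" for x
    using that unfolding K_def by blast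
  define rep where "rep a = (SOME x. x \<in> carrier (free_algebra X) \<and> a = source.cls x)" for a
  have rep: "rep a \<in> carrier (free_algebra X) \<and> a = source.cls (rep a)" if "a \<in> carrier source.A" for a
  proof -
    have "\<exists>x. x \<in> carrier (free_algebra X) \<and> a = source.cls x"
      using that unfolding source.carrier_eq by blast
    then show ?thesis
      unfolding rep_def by (rule someI_ex)
  qed
  define h where "h = restrict (\<lambda>a. target.cls (substitute g (rep a))) (carrier source.A)"
  have h_cls: "h (source.cls x) = target.cls (substitute g x)" if x: "x \<in> carrier (free_algebra X)" for x
  proof -
    have mem: "source.cls x \<in> carrier source.A" using x by (simp add: source.carrier_eq)
    then have "rep (source.cls x) - x \<in> relation_ideal X R"
      using rep[OF mem] source.cls_eq_iff[of "rep (source.cls x)" x] by simp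
    then show ?thesis
      using mem respects[of "rep (source.cls x) - x"]
      by (simp add: h_def target.cls_eq_iff substitute_diff)
  qed
  have "h \<in> ring_hom source.A target.A"
  proof (rule ring_hom_memI)
    show "h \<one>\<^bsub>source.A\<^esub> = \<one>\<^bsub>target.A\<^esub>"
      by (simp add: source.one_eq_cls target.one_eq_cls h_cls)
  next
    fix a assume "a \<in> carrier source.A"
    then obtain x where x: "x \<in> carrier (free_algebra X)" "a = source.cls x"
      unfolding source.carrier_eq by blast
    then show "h a \<in> carrier target.A"
      by (simp add: target.carrier_eq h_cls closed)
    fix b assume "b \<in> carrier source.A"
    then obtain y where y: "y \<in> carrier (free_algebra X)" "b = source.cls y"
      unfolding source.carrier_eq by blast
    show "h (a \<otimes>\<^bsub>source.A\<^esub> b) = h a \<otimes>\<^bsub>target.A\<^esub> h b" "h (a \<oplus>\<^bsub>source.A\<^esub> b) = h a \<oplus>\<^bsub>target.A\<^esub> h b"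
      using x y by (simp_all add: h_cls source.cls_simps target.cls_simps closed
          substitute_simps mult_in_free_algebra add_in_free_algebra)
  qed
  moreover have "h (c \<odot>\<^bsub>source.A\<^esub> a) = c \<odot>\<^bsub>target.A\<^esub> h a" if a: "a \<in> carrier source.A" for c a
  proof -
    obtain x where "x \<in> carrier (free_algebra X)" "a = source.cls x"
      using a unfolding source.carrier_eq by blast
    then show ?thesis
      by (simp add: source.smult_cls h_cls target.smult_cls closed mult_in_free_algebra substitute_mult)
  qed
  moreover have "h ` component source.A s \<subseteq> component target.A s" for s
  proof -
    have "h (source.cls x) \<in> target.cls ` homogeneous Y par' s" if "x \<in> homogeneous X par s" for x
    proof -
      have "x \<in> carrier (free_algebra X)" using that by (simp add: homogeneous_def)
      then show ?thesis
        using h_cls substitute_homogeneous[OF g that] by simp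
    qed
    then show ?thesis
      by (simp add: source.component_eq target.component_eq image_subset_iff)
  qed
  ultimately have "h \<in> superalgebra_hom source.A target.A"
    by (simp add: superalgebra_hom_def)
  moreover have "h \<in> extensional (carrier source.A)"
    by (simp add: h_def)
  ultimately show thesis
    using h_cls by (intro that)
qed

section \<open>Supercommuting elements\<close>

text \<open>The sign rule. A ring type carries no grading, so the parities \<open>a\<close> of \<open>u\<close> and \<open>b\<close> of \<open>v\<close> are
  parameters; only the parity of their product matters.\<close>

definition supercommute :: "nat \<Rightarrow> nat \<Rightarrow> 'a::ring_1 \<Rightarrow> 'a \<Rightarrow> bool" where
  "supercommute a b u v \<longleftrightarrow> u * v = (-1) ^ (a * b) * (v * u)"

lemma sign_commute: "(-1) ^ k * u = u * (-1 :: 'a::ring_1) ^ k"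
  by (cases "even k") simp_all

lemma sign_square [simp]: "(-1) ^ k * ((-1) ^ k * u) = (u :: 'a::ring_1)"
  by (cases "even k") simp_all

lemma supercommuteD: "supercommute a b u v \<Longrightarrow> u * v = (-1) ^ (a * b) * (v * u)"
  by (simp add: supercommute_def)

lemma supercommute_sym: "supercommute a b u v \<Longrightarrow> supercommute b a v u"
  unfolding supercommute_def by (simp add: mult.commute[of b a])

lemma supercommute_mult_right:
  assumes "supercommute a b u v" "supercommute a d u w"
  shows "supercommute a (b + d) u (v * w)"
proof -
  have "u * (v * w) = (-1) ^ (a * b) * (v * (u * w))"
    using assms(1) by (simp add: supercommute_def mult.assoc[symmetric])
  also have "\<dots> = (-1) ^ (a * b) * (v * ((-1) ^ (a * d) * (w * u)))"
    using assms(2) by (simp add: supercommute_def)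
  also have "\<dots> = (-1) ^ (a * b) * ((-1) ^ (a * d) * (v * w * u))"
    using sign_commute[of "a * d" v] by (simp add: mult.assoc[symmetric])
  finally show ?thesis
    by (simp add: supercommute_def power_add distrib_left mult.assoc)
qed

lemma supercommute_mult_left:
  assumes "supercommute a d u w" "supercommute b d v w"
  shows "supercommute (a + b) d (u * v) w"
  using supercommute_mult_right[OF assms[THEN supercommute_sym]] by (rule supercommute_sym)

lemma supercommute_mult:
  assumes "supercommute a d u w" "supercommute a e u z" "supercommute b d v w" "supercommute b e v z"
  shows "supercommute (a + b) (d + e) (u * v) (w * z)"
  by (intro supercommute_mult_left supercommute_mult_right assms)

lemma supercommute_commute: "supercommute a b u v \<Longrightarrow> even (a * b) \<Longrightarrow> u * v = v * u"
  by (simp add: supercommute_def)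

section \<open>Oscillators\<close>

text \<open>A ring with a central copy of the field stands for an algebra over it.\<close>

locale scalar_action =
  fixes c :: "'k::field \<Rightarrow> 'a::ring_1"
  assumes c_1 [simp]: "c 1 = 1"
    and c_add: "c (a + b) = c a + c b"
    and c_mult: "c (a * b) = c a * c b"
    and c_commute: "c a * u = u * c a"
begin

lemma c_0 [simp]: "c 0 = 0"
  using c_add[of 0 0] by simp

lemma c_uminus: "c (- a) = - c a"
  using c_add[of "- a" a] by (simp add: eq_neg_iff_add_eq_0)

lemma c_diff: "c (a - b) = c a - c b"
  using c_add[of a "- b"] by (simp add: c_uminus)

lemma c_sign: "c ((-1) ^ k) = (-1) ^ k"
  by (cases "even k") (simp_all add: c_uminus)

lemma c_left_commute: "u * (c a * v) = c a * (u * v)"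
  using c_commute[of a u] by (simp add: mult.assoc[symmetric])

lemma c_c [simp]: "c a * c b = c (a * b)"
  by (simp add: c_mult)

lemma c_c_left [simp]: "c a * (c b * u) = c (a * b) * u"
  by (simp add: mult.assoc[symmetric])

lemma c_cancel_left: "a \<noteq> 0 \<Longrightarrow> c a * u = c a * v \<Longrightarrow> u = v"
  by (drule arg_cong[of _ _ "\<lambda>z. c (inverse a) * z"]) simp

lemma supercommute_c: "supercommute a 0 u (c k)"
  by (simp add: supercommute_def c_commute)

text \<open>Sorting both products on the left side into the order \<open>a\<close>, \<open>u\<close> and \<open>u'\<close>, \<open>b\<close> produces the sign in
  the coefficient, so that the left side is \<open>a (u' u - \<kappa>\<^sup>-\<^sup>1 u u') b\<close>, and the bracket is a multiple of
  \<open>w\<close>. Applied to neighbouring root vectors \<open>a u'\<close> and \<open>u b\<close>, this is what makes the higher order Serre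
  relations computable.\<close>

lemma contraction:
  assumes osc: "u * u' = c \<kappa> * (u' * u) + w" and "\<kappa> \<noteq> 0"
    and "supercommute p pa u a" "supercommute p pb u' b" "supercommute pa pb a b"
    and "supercommute p pa u' a" "supercommute p pb u b"
  shows "(a * u') * (u * b) - c ((-1) ^ (p * pa + pa * pb + p * pb) * inverse \<kappa>) * ((u * b) * (a * u'))
    = c (- inverse \<kappa>) * (a * w * b)"
proof -
  have "supercommute (p + pb) pa (u * b) a"
    by (intro supercommute_mult_left supercommute_sym[OF assms(5)] assms)
  then have "(u * b) * (a * u') = (-1) ^ ((p + pb) * pa) * (a * u * (b * u'))"
    by (simp add: supercommute_def mult.assoc[symmetric])
  also have "b * u' = (-1) ^ (p * pb) * (u' * b)"
    using supercommute_sym[OF assms(4)] by (simp add: supercommute_def mult.commute)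
  also have "(-1) ^ ((p + pb) * pa) * (a * u * ((-1) ^ (p * pb) * (u' * b))) =
      (-1) ^ (p * pa + pa * pb + p * pb) * (a * (u * u') * b)"
    by (cases "even p"; cases "even pa"; cases "even pb") (simp_all add: mult.assoc)
  finally have "(u * b) * (a * u') = (-1) ^ (p * pa + pa * pb + p * pb) * (a * (u * u') * b)" .
  then have "c ((-1) ^ (p * pa + pa * pb + p * pb) * inverse \<kappa>) * ((u * b) * (a * u')) =
      c (inverse \<kappa>) * (a * (u * u') * b)"
    by (cases "even (p * pa + pa * pb + p * pb)") (simp_all add: c_uminus del: even_mult_iff even_add)
  also have "\<dots> = a * (u' * u) * b + c (inverse \<kappa>) * (a * w * b)"
    using \<open>\<kappa> \<noteq> 0\<close> unfolding osc
    by (simp add: algebra_simps c_left_commute[of a])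
  finally show ?thesis
    by (simp add: c_uminus mult.assoc)
qed

text \<open>Substituting \<open>w = u u' - k\<^sup>-\<^sup>1 u' u\<close> into the weight relations of \<open>w\<close> with \<open>u\<close> and \<open>u'\<close> gives the
  two quadratic Serre relations.\<close>

lemma oscillator_serre:
  assumes osc: "u * u' = c (inverse k) * (u' * u) + w" and "k \<noteq> 0"
    and wu: "w * u = c (inverse k) * (u * w)" and wu': "w * u' = c k * (u' * w)"
  shows "u * u * u' - c (k + inverse k) * (u * u' * u) + u' * u * u = 0"
    and "u * u' * u' - c (k + inverse k) * (u' * u * u') + u' * u' * u = 0"
proof -
  have w: "w = u * u' - c (inverse k) * (u' * u)"
    using osc by simp
  have "c k * (w * u) = u * w"
    using \<open>k \<noteq> 0\<close> by (simp add: wu)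
  moreover have "u * u * u' - c (k + inverse k) * (u * u' * u) + u' * u * u = u * w - c k * (w * u)"
    unfolding w using \<open>k \<noteq> 0\<close> by (simp add: algebra_simps c_add c_left_commute[of u])
  ultimately show "u * u * u' - c (k + inverse k) * (u * u' * u) + u' * u * u = 0"
    by simp
  have "u * u' * u' - c (k + inverse k) * (u' * u * u') + u' * u' * u = w * u' - c k * (u' * w)"
    unfolding w using \<open>k \<noteq> 0\<close> by (simp add: algebra_simps c_add c_left_commute[of u'])
  then show "u * u' * u' - c (k + inverse k) * (u' * u * u') + u' * u' * u = 0"
    using wu' by simp
qed

text \<open>The difference of the quadratic relation multiplied by \<open>u\<close> on the right and on the left.\<close>

lemma oscillator_serre_cubic:
  assumes "u * u * u' - c k * (u * u' * u) + u' * u * u = 0"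
  shows "u' * u * u * u - c (k + 1) * (u * u' * u * u) + c (k + 1) * (u * u * u' * u) - u * u * u * u' = 0"
proof -
  let ?s = "u * u * u' - c k * (u * u' * u) + u' * u * u"
  have "u' * u * u * u - c (k + 1) * (u * u' * u * u) + c (k + 1) * (u * u * u' * u) - u * u * u * u'
      = ?s * u - u * ?s"
    by (simp add: algebra_simps c_add c_left_commute[of u])
  then show ?thesis
    by (simp add: assms)
qed

text \<open>Root vectors at neighbouring nodes are \<open>a z\<close> and \<open>h b\<close>, where \<open>z\<close>, \<open>h\<close> is the oscillator at the common
  node and \<open>a\<close>, \<open>b\<close> commute with it. Then the relation for \<open>z\<close> and \<open>h\<close> is multiplied by a power of \<open>a\<close> on
  the left and by \<open>b\<close> on the right.\<close>

lemma
  assumes "\<And>v. v \<in> {z, h, b} \<Longrightarrow> v * a = a * v" and "\<And>v. v \<in> {z, h} \<Longrightarrow> b * v = v * b"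
  shows serre_quadratic_dressed: "z * z * h - c k * (z * h * z) + h * z * z = 0 \<Longrightarrow>
      (a * z) * (a * z) * (h * b) - c k * ((a * z) * (h * b) * (a * z)) + (h * b) * (a * z) * (a * z) = 0"
    and serre_cubic_dressed: "h * z * z * z - c k * (z * h * z * z) + c k * (z * z * h * z) - z * z * z * h = 0 \<Longrightarrow>
      (h * b) * (a * z) * (a * z) * (a * z) - c k * ((a * z) * (h * b) * (a * z) * (a * z))
        + c k * ((a * z) * (a * z) * (h * b) * (a * z)) - (a * z) * (a * z) * (a * z) * (h * b) = 0"
proof -
  have comm: "z * a = a * z" "h * a = a * h" "b * a = a * b" "b * z = z * b" "b * h = h * b"
    by (rule assms, simp)+
  have comm': "z * (a * v) = a * (z * v)" "h * (a * v) = a * (h * v)" "b * (a * v) = a * (b * v)"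
    "b * (z * v) = z * (b * v)" "b * (h * v) = h * (b * v)" for v
    by (simp_all only: mult.assoc[symmetric] comm)
  have "(a * z) * (a * z) * (h * b) - c k * ((a * z) * (h * b) * (a * z)) + (h * b) * (a * z) * (a * z) =
      a * a * (z * z * h - c k * (z * h * z) + h * z * z) * b"
    by (simp add: algebra_simps comm comm' c_left_commute[of a])
  then show "z * z * h - c k * (z * h * z) + h * z * z = 0 \<Longrightarrow>
      (a * z) * (a * z) * (h * b) - c k * ((a * z) * (h * b) * (a * z)) + (h * b) * (a * z) * (a * z) = 0"
    by simp
  have "(h * b) * (a * z) * (a * z) * (a * z) - c k * ((a * z) * (h * b) * (a * z) * (a * z))
        + c k * ((a * z) * (a * z) * (h * b) * (a * z)) - (a * z) * (a * z) * (a * z) * (h * b) =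
      a * a * a * (h * z * z * z - c k * (z * h * z * z) + c k * (z * z * h * z) - z * z * z * h) * b"
    by (simp add: algebra_simps comm comm' c_left_commute[of a])
  then show "h * z * z * z - c k * (z * h * z * z) + c k * (z * z * h * z) - z * z * z * h = 0 \<Longrightarrow>
      (h * b) * (a * z) * (a * z) * (a * z) - c k * ((a * z) * (h * b) * (a * z) * (a * z))
        + c k * ((a * z) * (a * z) * (h * b) * (a * z)) - (a * z) * (a * z) * (a * z) * (h * b) = 0"
    by simp
qed

end

section \<open>Chains of oscillators\<close>

lemma scalar_two_neq_0: "(2 :: scalar) \<noteq> 0"
proof -
  have "(1 :: scalar) + 1 = Fract 2 1"
    by (simp only: One_fract_def) simp
  moreover have "Fract 2 1 \<noteq> (0 :: scalar)"
    by (simp add: Zero_fract_def eq_fract)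
  ultimately show ?thesis
    by simp
qed

lemma qhalf_neq_0 [simp]: "qhalf \<noteq> 0"
  by (simp add: qhalf_def Zero_fract_def eq_fract)

lemma q_neq_0 [simp]: "q \<noteq> 0"
  by (simp add: q_def)

text \<open>The sign of a parity as an integer, for use in exponents of \<open>q\<close>.\<close>

definition sgn_par :: "nat \<Rightarrow> int" where
  "sgn_par k = (-1) ^ k"

text \<open>The structure shared by the images of the \<open>e\<^sub>i\<close> and those of the \<open>f\<^sub>i\<close>: an oscillator \<open>x i\<close>, \<open>y i\<close> of
  parity \<open>p i\<close> at each node, with the torus element \<open>W i\<close> as defect of \<open>q\<close>-commutativity. The
  additional even element \<open>y (Suc N)\<close> makes the root vector \<open>x N * y (Suc N)\<close> of the short root uniform with the
  others; it will be a scalar.\<close>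

locale oscillator_chain = scalar_action c for c :: "scalar \<Rightarrow> 'a::ring_1" +
  fixes N :: nat and p :: "nat \<Rightarrow> nat" and x y W :: "nat \<Rightarrow> 'a"
  assumes p_le: "p i \<le> 1" and p_last: "p (Suc N) = 0"
    and xx: "i \<in> {1..N} \<Longrightarrow> j \<in> {1..N} \<Longrightarrow> supercommute (p i) (p j) (x i) (x j)"
    and yy: "i \<in> {1..Suc N} \<Longrightarrow> j \<in> {1..Suc N} \<Longrightarrow> supercommute (p i) (p j) (y i) (y j)"
    and xy: "i \<in> {1..N} \<Longrightarrow> j \<in> {1..Suc N} \<Longrightarrow> i \<noteq> j \<Longrightarrow> supercommute (p i) (p j) (x i) (y j)"
    and osc: "i \<in> {1..N} \<Longrightarrow>
      x i * y i = c ((-1) ^ p i * q powi (- sgn_par (p i))) * (y i * x i) + W i"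
    and Wx: "i \<in> {1..N} \<Longrightarrow> j \<in> {1..N} \<Longrightarrow>
      W i * x j = c (if i = j then inverse q else 1) * (x j * W i)"
    and Wy: "i \<in> {1..N} \<Longrightarrow> j \<in> {1..Suc N} \<Longrightarrow>
      W i * y j = c (if i = j then q else 1) * (y j * W i)"
begin

definition e :: "nat \<Rightarrow> 'a" where
  "e i = x i * y (Suc i)"

definition P :: "nat \<Rightarrow> nat" where
  "P i = p i + p (Suc i)"

lemma p_cases: "p i = 0 \<or> p i = 1"
  using p_le[of i] by linarith

lemma yx: "i \<in> {1..N} \<Longrightarrow> j \<in> {1..Suc N} \<Longrightarrow> i \<noteq> j \<Longrightarrow> supercommute (p j) (p i) (y j) (x i)"
  using xy by (rule supercommute_sym)

lemma W_supercommute: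
  assumes "i \<in> {1..N}" "j \<noteq> i"
  shows "j \<in> {1..N} \<Longrightarrow> supercommute a 0 (x j) (W i)" "j \<in> {1..Suc N} \<Longrightarrow> supercommute a 0 (y j) (W i)"
  using Wx[of i j] Wy[of i j] assms by (auto simp: supercommute_def)

lemma e_far:
  assumes "i \<in> {1..N}" "j \<in> {1..N}" "Suc i < j \<or> Suc j < i"
  shows "supercommute (P i) (P j) (e i) (e j)"
  unfolding P_def e_def using assms
  by (intro supercommute_mult xx xy yy yx) auto

text \<open>The sign rule only gives \<open>2 u\<^sup>2 = 0\<close>, and 2 is invertible in the field of scalars.\<close>

lemma square_zero:
  assumes "supercommute 1 1 u u"
  shows "u * u = (0 :: 'a)"
proof -
  have "c 2 * (u * u) = u * u + u * u"
    using c_add[of 1 1] by (simp add: mult_2)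
  also have "\<dots> = 0"
    unfolding eq_neg_iff_add_eq_0[symmetric] using supercommuteD[OF assms] by simp
  finally show ?thesis
    using c_cancel_left[OF scalar_two_neq_0, of "u * u" 0] by simp
qed

lemma x_square: "i \<in> {1..N} \<Longrightarrow> p i = 1 \<Longrightarrow> x i * x i = 0"
  using xx[of i i] square_zero[of "x i"] by simp

lemma y_square: "i \<in> {1..Suc N} \<Longrightarrow> p i = 1 \<Longrightarrow> y i * y i = 0"
  using yy[of i i] square_zero[of "y i"] by simp

lemma sandwich_zero:
  assumes "supercommute a b u v" "u * u = 0"
  shows "u * v * u = 0" "u * (v * u) = (0 :: 'a)"
proof -
  have "u * v * u = (-1) ^ (a * b) * (v * (u * u))"
    using assms(1) by (simp add: supercommute_def mult.assoc)
  then show "u * v * u = 0"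
    by (simp add: assms(2))
  then show "u * (v * u) = 0"
    by (simp add: mult.assoc)
qed

text \<open>An odd oscillator occurs twice, separated by a factor with which it supercommutes.\<close>

lemma e_square_odd:
  assumes "i \<in> {1..N}" "p i = 1 \<or> p (Suc i) = 1"
  shows "e i * e i = 0"
proof -
  have i: "Suc i \<in> {1..Suc N}" "i \<noteq> Suc i" using assms by auto
  show ?thesis
    using assms(2)
  proof
    assume "p i = 1"
    then have "x i * y (Suc i) * x i = 0"
      using sandwich_zero(1)[OF xy[OF assms(1) i]] x_square assms(1) by blast
    then show ?thesis by (simp add: e_def mult.assoc[symmetric])
  next
    assume "p (Suc i) = 1"
    then have "y (Suc i) * (x i * y (Suc i)) = 0"
      using sandwich_zero(2)[OF yx[OF assms(1) i]] y_square i by blast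
    then show ?thesis by (simp add: e_def mult.assoc)
  qed
qed

lemma e_neighbour_sandwich_odd:
  assumes "i \<in> {1..N}" "j \<in> {1..N}" "j = Suc i \<or> i = Suc j" "p i = 1" "p (Suc i) = 1"
  shows "e i * e j * e i = 0"
  using assms(3)
proof
  assume j: "j = Suc i"
  have "supercommute (p i) (p (Suc i) + (p j + p (Suc j))) (x i) (y (Suc i) * (x j * y (Suc j)))"
    using assms j by (intro supercommute_mult_right xx xy) auto
  then have "x i * (y (Suc i) * (x j * y (Suc j))) * x i = 0"
    using sandwich_zero(1) x_square assms by blast
  then have "x i * (y (Suc i) * (x j * y (Suc j))) * x i * y (Suc i) = 0"
    by simp
  then show ?thesis by (simp add: e_def mult.assoc)
next
  assume j: "i = Suc j"
  have "supercommute (p (Suc i)) (p j + p i + p i) (y (Suc i)) (x j * y i * x i)"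
    using assms j by (intro supercommute_mult_right yy yx) auto
  then have "y (Suc i) * ((x j * y i * x i) * y (Suc i)) = 0"
    using sandwich_zero(2) y_square[of "Suc i"] assms by simp
  then show ?thesis by (simp add: e_def j[symmetric] mult.assoc)
qed

lemma oscillator_even:
  assumes "i \<in> {1..N}" "p i = 0"
  shows "x i * x i * y i - c (q + inverse q) * (x i * y i * x i) + y i * x i * x i = 0"
    and "x i * y i * y i - c (q + inverse q) * (y i * x i * y i) + y i * y i * x i = 0"
  using oscillator_serre[of "x i" "y i" q "W i"] osc[OF assms(1)] Wx[of i i] Wy[of i i] assms
  by (simp_all add: sgn_par_def power_int_minus)

text \<open>Between two odd nodes every term vanishes; between two even nodes the relation is
  \<open>oscillator_serre\<close> of the common node, dressed by the outer factors.\<close>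

lemma serre_quadratic:
  assumes "i \<in> {1..N}" "j \<in> {1..N}" "j = Suc i \<or> i = Suc j" "p i = p (Suc i)"
  shows "e i * e i * e j - c (q + inverse q) * (e i * e j * e i) + e j * e i * e i = 0"
proof (cases "p i = 1")
  case True
  then have "e i * e i = 0" "e i * e j * e i = 0"
    using e_square_odd e_neighbour_sandwich_odd assms by auto
  moreover from this have "e j * e i * e i = 0"
    by (simp add: mult.assoc)
  ultimately show ?thesis by simp
next
  case False
  then have p: "p i = 0" "p (Suc i) = 0" using p_cases[of i] assms by auto
  show ?thesis
    using assms(3)
  proof
    assume j: "j = Suc i"
    have "v * x i = x i * v" if "v \<in> {y j, x j, y (Suc j)}" for v
      using that supercommute_commute[OF xx[of j i]] supercommute_commute[OF yx[of i j]]
        supercommute_commute[OF yx[of i "Suc j"]] assms j p by auto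
    moreover have "y (Suc j) * v = v * y (Suc j)" if "v \<in> {y j, x j}" for v
      using that supercommute_commute[OF yy[of "Suc j" j]] supercommute_commute[OF yx[of j "Suc j"]]
        assms j p by auto
    moreover have "y j * y j * x j - c (q + inverse q) * (y j * x j * y j) + x j * y j * y j = 0"
      using oscillator_even(2)[of j] assms j p by (simp add: algebra_simps)
    ultimately show ?thesis
      using serre_quadratic_dressed[where a = "x i" and z = "y j" and h = "x j" and b = "y (Suc j)"]
      unfolding e_def j[symmetric] by blast
  next
    assume i: "i = Suc j"
    have "v * y (Suc i) = y (Suc i) * v" if "v \<in> {x i, y i, x j}" for v
      using that supercommute_commute[OF xy[of i "Suc i"]] supercommute_commute[OF yy[of i "Suc i"]]
        supercommute_commute[OF xy[of j "Suc i"]] assms i p by auto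
    moreover have "x j * v = v * x j" if "v \<in> {x i, y i}" for v
      using that supercommute_commute[OF xx[of j i]] supercommute_commute[OF xy[of j i]]
        assms i p by auto
    ultimately show ?thesis
      using serre_quadratic_dressed[where a = "y (Suc i)" and z = "x i" and h = "y i" and b = "x j"]
        oscillator_even(1)[of i] assms p
      unfolding e_def i[symmetric] by simp
  qed
qed

lemma serre_cubic:
  assumes "p N = 0" "j \<in> {1..N}" "N = Suc j"
  shows "e j * e N * e N * e N - c (q + inverse q + 1) * (e N * e j * e N * e N)
    + c (q + inverse q + 1) * (e N * e N * e j * e N) - e N * e N * e N * e j = 0"
proof -
  have "v * y (Suc N) = y (Suc N) * v" if "v \<in> {x N, y N, x j}" for v
    using that supercommute_commute[OF xy[of N "Suc N"]] supercommute_commute[OF yy[of N "Suc N"]]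
      supercommute_commute[OF xy[of j "Suc N"]] assms p_last by auto
  moreover have "x j * v = v * x j" if "v \<in> {x N, y N}" for v
    using that supercommute_commute[OF xx[of j N]] supercommute_commute[OF xy[of j N]] assms by auto
  moreover have "N \<in> {1..N}" using assms by auto
  ultimately show ?thesis
    using serre_cubic_dressed[where a = "y (Suc N)" and z = "x N" and h = "y N" and b = "x j"]
      oscillator_serre_cubic[OF oscillator_even(1)[of N]] assms
    unfolding e_def assms(3)[symmetric] by simp
qed

text \<open>The coefficients in \<open>Y\<close> and \<open>T\<close> are those for which \<open>contraction\<close> applies, once at node \<open>s + 1\<close> and then
  at node \<open>s\<close>. So \<open>T\<close> is a multiple of \<open>x (s - 1) * (W s * W (s + 1)) * y (s + 2)\<close>. Moving \<open>e s\<close> through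
  \<open>W s * W (s + 1)\<close> produces the factors \<open>q\<^sup>-\<^sup>1\<close> from \<open>x s\<close> and \<open>q\<close> from \<open>y (s + 1)\<close>, which cancel, and moving it
  through the outer factors produces the sign.\<close>

lemma odd_reflection_serre:
  assumes s: "1 < s" "s < N" and odd: "odd (P s)"
    and Y: "Y = e s * e (Suc s) - c ((-1) ^ P (Suc s) * q powi sgn_par (p (Suc s))) * (e (Suc s) * e s)"
    and T: "T = e (s - 1) * Y
      - c ((-1) ^ (P (s - 1) * (1 + P (Suc s))) * q powi sgn_par (p s)) * (Y * e (s - 1))"
  shows "e s * T + (-1) ^ (P (s - 1) + P (Suc s)) * (T * e s) = 0"
proof -
  define r t where "r = s - 1" and "t = Suc s"
  have r: "Suc r = s" using s by (simp add: r_def)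
  have ind': "r \<in> {1..N}" "s \<in> {1..N}" "t \<in> {1..N}" "s \<in> {1..Suc N}" "t \<in> {1..Suc N}"
    "Suc t \<in> {1..Suc N}" "r \<noteq> s" "s \<noteq> t" "r \<noteq> t" "t \<noteq> s" "s \<noteq> r" "t \<noteq> r" "Suc t \<noteq> t" "Suc t \<noteq> s"
    "r \<noteq> Suc t" "s \<noteq> Suc t" "t \<noteq> Suc t"
    using s by (auto simp: r_def t_def)
  define \<kappa> where "\<kappa> i = (-1) ^ p i * q powi (- sgn_par (p i))" for i
  have \<kappa>: "\<kappa> i \<noteq> 0" "inverse (\<kappa> i) = (-1) ^ p i * q powi sgn_par (p i)" for i
    by (cases "even (p i)"; simp add: \<kappa>_def power_int_minus)+
  have ps: "p s = 0 \<and> p t = 1 \<or> p s = 1 \<and> p t = 0"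
    using odd p_cases[of s] p_cases[of t] by (auto simp: P_def t_def)
  have sign_t: "(-1) ^ P t * q powi sgn_par (p t) =
      (-1) ^ (p t * p s + p s * p (Suc t) + p t * p (Suc t)) * inverse (\<kappa> t)"
    using ps p_cases[of "Suc t"] by (auto simp: \<kappa> P_def)
  have sign_s: "(-1) ^ (P r * (1 + P t)) * q powi sgn_par (p s) =
      (-1) ^ (p s * p r + p r * p (Suc t) + p s * p (Suc t)) * inverse (\<kappa> s)"
    using ps p_cases[of "Suc t"] p_cases[of r] by (auto simp: \<kappa> P_def r)
  define b where "b = W t * y (Suc t)"
  have "Y = c (- inverse (\<kappa> t)) * (x s * W t * y (Suc t))"
    unfolding Y t_def[symmetric] sign_t unfolding e_def t_def[symmetric]
    by (intro contraction xx xy yy yx \<kappa> osc[folded \<kappa>_def] ind')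
  then have Y': "Y = c (- inverse (\<kappa> t)) * (x s * b)"
    by (simp add: b_def mult.assoc)
  have W_t: "supercommute a (0 + p (Suc t)) v b"
    if "supercommute a 0 v (W t)" "supercommute a (p (Suc t)) v (y (Suc t))" for a v
    unfolding b_def using that by (rule supercommute_mult_right)
  have "e r * (x s * b) - c ((-1) ^ (p s * p r + p r * p (Suc t) + p s * p (Suc t)) * inverse (\<kappa> s)) * (x s * b * e r)
      = c (- inverse (\<kappa> s)) * (x r * W s * b)"
    unfolding e_def r
    by (intro contraction xx xy yy yx \<kappa> osc[folded \<kappa>_def] W_t[simplified] W_supercommute ind')
  moreover have "T = c (- inverse (\<kappa> t)) * (e r * (x s * b) -
      c ((-1) ^ (p s * p r + p r * p (Suc t) + p s * p (Suc t)) * inverse (\<kappa> s)) * (x s * b * e r))"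
    unfolding T Y' r_def[symmetric] t_def[symmetric] sign_s
    by (simp add: c_left_commute[of "e r"] mult.assoc right_diff_distrib mult.commute[of "inverse (\<kappa> t)"])
  ultimately have T': "T = c (inverse (\<kappa> t) * inverse (\<kappa> s)) * (x r * (W s * W t) * y (Suc t))"
    by (simp add: b_def mult.assoc)
  have "W s * W t * (x s * y t) = W s * x s * (W t * y t)"
    using Wx[of t s] ind' by (simp add: mult.assoc) (simp flip: mult.assoc)
  also have "\<dots> = x s * (W s * y t) * W t"
    using Wx[of s s] Wy[of t t] ind' by (simp add: mult.assoc c_left_commute[of "W s"] c_left_commute[of "x s"])
  also have "\<dots> = x s * y t * (W s * W t)"
    using Wy[of s t] ind' by (simp add: mult.assoc)
  finally have "supercommute (P s) 0 (e s) (W s * W t)"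
    by (simp add: supercommute_def e_def t_def)
  then have "supercommute (P s) (p r + 0 + p (Suc t)) (e s) (x r * (W s * W t) * y (Suc t))"
    unfolding P_def e_def t_def[symmetric]
    by (intro supercommute_mult_right) (auto intro!: supercommute_mult_left xx xy yy yx ind')
  then have "e s * T = (-1) ^ (P s * (p r + p (Suc t))) * (T * e s)"
    unfolding T' by (simp add: supercommute_def c_left_commute[of "e s"] mult.assoc)
      (cases "even (P s * (p r + p (Suc t)))"; simp del: even_mult_iff)
  moreover have "(-1) ^ (P r + P t) = - ((-1) ^ (P s * (p r + p (Suc t))) :: 'a)"
    using ps p_cases[of r] p_cases[of "Suc t"] by (auto simp: P_def r t_def[symmetric])
  ultimately show ?thesis
    by (simp add: r_def t_def)
qed

end

section \<open>Realizations of the deformed Clifford relations\<close>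

lemma qhalf_power: "qhalf ^ k = Fract (monom 1 k) 1"
  by (induction k) (simp_all add: qhalf_def One_fract_def monom_Suc flip: one_pCons)

lemma qhalf_power_neq_1: "k > 0 \<Longrightarrow> qhalf ^ k \<noteq> 1"
  by (auto simp: qhalf_power One_fract_def eq_fract monom_eq_1_iff)

lemma q_power2_neq_1: "q ^ 2 \<noteq> 1"
  using qhalf_power_neq_1[of 4] by (simp add: q_def flip: power_mult)

lemma q_diff_inverse_neq_0: "q - inverse q \<noteq> 0"
proof
  assume "q - inverse q = 0"
  then have "q * q = 1" by (simp add: field_simps)
  then show False using q_power2_neq_1 by (simp add: power2_eq_square)
qed

lemma imag_unit_square: "imag_unit * imag_unit = - 1"
  by (simp add: imag_unit_def One_fract_def one_pCons)

lemma imag_unit_neq_0: "imag_unit \<noteq> 0"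
  using imag_unit_square by auto

text \<open>The bilinear form on the ordered basis and on the simple roots, in terms of the parities \<open>p\<close>: even
  nodes have square length \<open>- 1\<close>, odd ones \<open>1\<close>. The index \<open>N + 1\<close> stands for the zero vector, which makes
  the short root \<open>\<alpha>\<^sub>N\<close> a difference of consecutive basis vectors like the others.\<close>

definition basis_pairing :: "nat \<Rightarrow> (nat \<Rightarrow> nat) \<Rightarrow> nat \<Rightarrow> nat \<Rightarrow> int" where
  "basis_pairing N p i j = (if i = j \<and> i \<in> {1..N} then - sgn_par (p i) else 0)"

definition root_pairing :: "nat \<Rightarrow> (nat \<Rightarrow> nat) \<Rightarrow> nat \<Rightarrow> nat \<Rightarrow> int" where
  "root_pairing N p i j = basis_pairing N p i j - basis_pairing N p i (Suc j)
     - basis_pairing N p (Suc i) j + basis_pairing N p (Suc i) (Suc j)"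

lemma qhalf_diff_inverse_neq_0: "qhalf - inverse qhalf \<noteq> 0"
proof
  assume "qhalf - inverse qhalf = 0"
  then have "qhalf ^ 2 = 1" by (simp add: field_simps power2_eq_square)
  then show False using qhalf_power_neq_1[of 2] by simp
qed

text \<open>Elements \<open>\<Phi> i\<close>, \<open>\<Phi>d i\<close>, \<open>u i\<close>, \<open>v i\<close> of some algebra that satisfy the relations of \<open>\<Phi>\<^sub>i\<close>, \<open>\<Phi>\<^sub>i\<^sup>\<dagger>\<close>, the
  torus generators and their inverses.\<close>

locale clifford_realization = scalar_action c for c :: "scalar \<Rightarrow> 'a::ring_1" +
  fixes N :: nat and p :: "nat \<Rightarrow> nat" and \<Phi> \<Phi>d u v :: "nat \<Rightarrow> 'a"
  assumes p_le: "p i \<le> 1" and p_last: "p (Suc N) = 0"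
    and uv: "i \<in> {1..N} \<Longrightarrow> u i * v i = 1" and vu: "i \<in> {1..N} \<Longrightarrow> v i * u i = 1"
    and osc_v: "i \<in> {1..N} \<Longrightarrow> \<Phi> i * \<Phi>d i = c ((-1) ^ p i * q) * (\<Phi>d i * \<Phi> i) + v i"
    and osc_u: "i \<in> {1..N} \<Longrightarrow> \<Phi> i * \<Phi>d i = c ((-1) ^ p i * inverse q) * (\<Phi>d i * \<Phi> i) + u i"
    and uu: "i \<in> {1..N} \<Longrightarrow> j \<in> {1..N} \<Longrightarrow> u i * u j = u j * u i"
    and u_\<Phi>: "i \<in> {1..N} \<Longrightarrow> j \<in> {1..N} \<Longrightarrow>
      u i * \<Phi> j * v i = c (q powi (if i = j then - sgn_par (p j) else 0)) * \<Phi> j"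
    and u_\<Phi>d: "i \<in> {1..N} \<Longrightarrow> j \<in> {1..N} \<Longrightarrow>
      u i * \<Phi>d j * v i = c (q powi (if i = j then sgn_par (p j) else 0)) * \<Phi>d j"
    and \<Phi>\<Phi>: "i \<in> {1..N} \<Longrightarrow> j \<in> {1..N} \<Longrightarrow> supercommute (p i) (p j) (\<Phi> i) (\<Phi> j)"
    and \<Phi>d\<Phi>d: "i \<in> {1..N} \<Longrightarrow> j \<in> {1..N} \<Longrightarrow> supercommute (p i) (p j) (\<Phi>d i) (\<Phi>d j)"
    and \<Phi>\<Phi>d: "i \<in> {1..N} \<Longrightarrow> j \<in> {1..N} \<Longrightarrow> i \<noteq> j \<Longrightarrow> supercommute (p i) (p j) (\<Phi> i) (\<Phi>d j)"
begin

lemma p_cases: "p i = 0 \<or> p i = 1"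
  using p_le[of i] by linarith

lemma \<Phi>d\<Phi>: "i \<in> {1..N} \<Longrightarrow> j \<in> {1..N} \<Longrightarrow> i \<noteq> j \<Longrightarrow> supercommute (p i) (p j) (\<Phi>d i) (\<Phi> j)"
  using \<Phi>\<Phi>d supercommute_sym by metis

definition weight :: "(nat \<Rightarrow> int) \<Rightarrow> 'a \<Rightarrow> bool" where
  "weight \<omega> z \<longleftrightarrow> (\<forall>i\<in>{1..N}. u i * z = c (q powi \<omega> i) * (z * u i))"

lemma weight_mult:
  assumes "weight \<omega> z" "weight \<omega>' z'"
  shows "weight (\<lambda>i. \<omega> i + \<omega>' i) (z * z')"
  unfolding weight_def
proof
  fix i assume i: "i \<in> {1..N}"
  have "u i * (z * z') = c (q powi \<omega> i) * (z * (u i * z'))"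
    using assms(1) i by (simp add: weight_def mult.assoc[symmetric])
  also have "\<dots> = c (q powi (\<omega> i + \<omega>' i)) * (z * z' * u i)"
    using assms(2) i by (simp add: weight_def mult.assoc c_left_commute[of z] power_int_add)
  finally show "u i * (z * z') = c (q powi (\<omega> i + \<omega>' i)) * (z * z' * u i)" .
qed

lemma weight_c: "weight (\<lambda>_. 0) (c k)"
  by (simp add: weight_def c_commute[of k])

lemma weight_c_mult: "weight \<omega> z \<Longrightarrow> weight \<omega> (c k * z)"
  using weight_mult[OF weight_c[of k]] by simp

abbreviation "coord \<equiv> basis_pairing N p"

lemma weight_\<Phi>: "j \<in> {1..N} \<Longrightarrow> weight (\<lambda>i. coord i j) (\<Phi> j)"
  unfolding weight_def
proof
  fix i assume ij: "j \<in> {1..N}" "i \<in> {1..N}"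
  have "u i * \<Phi> j = u i * \<Phi> j * (v i * u i)"
    using vu ij by simp
  also have "\<dots> = u i * \<Phi> j * v i * u i"
    by (simp only: mult.assoc)
  also have "\<dots> = c (q powi coord i j) * \<Phi> j * u i"
    unfolding u_\<Phi>[OF ij(2) ij(1)] using ij by (simp add: basis_pairing_def)
  finally show "u i * \<Phi> j = c (q powi coord i j) * (\<Phi> j * u i)"
    by (simp only: mult.assoc)
qed

lemma weight_\<Phi>d: "j \<in> {1..N} \<Longrightarrow> weight (\<lambda>i. - coord i j) (\<Phi>d j)"
  unfolding weight_def
proof
  fix i assume ij: "j \<in> {1..N}" "i \<in> {1..N}"
  have "u i * \<Phi>d j = u i * \<Phi>d j * (v i * u i)"
    using vu ij by simp
  also have "\<dots> = u i * \<Phi>d j * v i * u i"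
    by (simp only: mult.assoc)
  also have "\<dots> = c (q powi (- coord i j)) * \<Phi>d j * u i"
    unfolding u_\<Phi>d[OF ij(2) ij(1)] using ij by (simp add: basis_pairing_def)
  finally show "u i * \<Phi>d j = c (q powi (- coord i j)) * (\<Phi>d j * u i)"
    by (simp only: mult.assoc)
qed

lemma weight_v:
  assumes "weight \<omega> z" "i \<in> {1..N}"
  shows "v i * z = c (q powi (- \<omega> i)) * (z * v i)"
proof -
  have "v i * z = v i * (z * (u i * v i))"
    using uv assms by simp
  also have "\<dots> = c (q powi (- \<omega> i)) * (v i * (c (q powi \<omega> i) * (z * u i)) * v i)"
    by (simp add: c_left_commute[of "v i"] mult.assoc power_int_minus)
  also have "\<dots> = c (q powi (- \<omega> i)) * (v i * (u i * z) * v i)"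
    using assms by (simp add: weight_def)
  also have "\<dots> = c (q powi (- \<omega> i)) * (v i * u i * z * v i)"
    by (simp only: mult.assoc)
  finally show ?thesis
    using vu assms by simp
qed

lemma v_v: "i \<in> {1..N} \<Longrightarrow> j \<in> {1..N} \<Longrightarrow> v i * v j = v j * v i"
  and u_v: "i \<in> {1..N} \<Longrightarrow> j \<in> {1..N} \<Longrightarrow> v i * u j = u j * v i"
proof -
  assume i: "i \<in> {1..N}" and j: "j \<in> {1..N}"
  have w: "weight (\<lambda>_. 0) (u j)" if "j \<in> {1..N}" for j
    using uu that by (simp add: weight_def)
  show uv_comm: "v i * u j = u j * v i"
    using weight_v[OF w[OF j] i] by simp
  have "weight (\<lambda>_. 0) (v j)"
    using weight_v[OF w] j by (simp add: weight_def)
  then show "v i * v j = v j * v i"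
    using weight_v i by fastforce
qed

text \<open>The two chains. For the \<open>f\<^sub>i\<close> the roles of \<open>\<Phi>\<close> and \<open>\<Phi>\<^sup>\<dagger>\<close> are exchanged, and the sign in \<open>y_F\<close> is the one
  from reordering \<open>\<Phi>\<^sub>i\<^sub>+\<^sub>1 \<Phi>\<^sub>i\<^sup>\<dagger>\<close>. The values of \<open>W_E\<close> and \<open>W_F\<close> are then dictated by the oscillator relation.\<close>

definition y_E :: "scalar \<Rightarrow> nat \<Rightarrow> 'a" where
  "y_E \<epsilon> i = (if i \<le> N then \<Phi>d i else c \<epsilon>)"

definition y_F :: "nat \<Rightarrow> 'a" where
  "y_F i = (if i \<le> N then c ((-1) ^ (p i * p (i - 1))) * \<Phi> i else 1)"

definition W_E :: "nat \<Rightarrow> 'a" where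
  "W_E i = (if p i = 0 then u i else v i)"

definition W_F :: "nat \<Rightarrow> 'a" where
  "W_F i = c ((-1) ^ (p i * p (i - 1))) * (if p i = 0 then c (- inverse q) * v i else c q * u i)"

lemma supercommute_c_mult_right: "supercommute a b z w \<Longrightarrow> supercommute a b z (c k * w)"
  using supercommute_mult_right[OF supercommute_c[of a z k]] by simp

lemma supercommute_c_mult_left: "supercommute a b z w \<Longrightarrow> supercommute a b (c k * z) w"
  using supercommute_c_mult_right supercommute_sym by metis

lemma supercommute_c_left: "supercommute 0 a (c k) z"
  using supercommute_c by (rule supercommute_sym)

lemma supercommute_1: "supercommute a 0 z 1" "supercommute 0 a 1 z"
  by (simp_all add: supercommute_def)

lemma E_chain: "oscillator_chain c N p \<Phi> (y_E \<epsilon>) W_E"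
proof unfold_locales
  fix i j
  show "p i \<le> 1" by (rule p_le)
  show "p (Suc N) = 0" by (rule p_last)
  { assume i: "i \<in> {1..N}"
    show "\<Phi> i * y_E \<epsilon> i = c ((-1) ^ p i * q powi (- sgn_par (p i))) * (y_E \<epsilon> i * \<Phi> i) + W_E i"
      using osc_u[OF i] osc_v[OF i] p_cases[of i] i
      by (auto simp: y_E_def W_E_def sgn_par_def power_int_minus)
    { assume j: "j \<in> {1..N}"
      show "supercommute (p i) (p j) (\<Phi> i) (\<Phi> j)" using i j by (rule \<Phi>\<Phi>)
      show "W_E i * \<Phi> j = c (if i = j then inverse q else 1) * (\<Phi> j * W_E i)"
        using weight_\<Phi>[OF j] weight_v[OF weight_\<Phi>[OF j] i] p_cases[of i] i
        by (auto simp: W_E_def weight_def basis_pairing_def sgn_par_def power_int_minus) }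
    assume j: "j \<in> {1..Suc N}"
    show "W_E i * y_E \<epsilon> j = c (if i = j then q else 1) * (y_E \<epsilon> j * W_E i)"
    proof (cases "j \<le> N")
      case True
      then have "j \<in> {1..N}" using j by auto
      then show ?thesis
        using weight_\<Phi>d[of j] weight_v[OF weight_\<Phi>d[of j] i] p_cases[of i] i True
        by (auto simp: W_E_def y_E_def weight_def basis_pairing_def sgn_par_def power_int_minus)
    next
      case False
      then show ?thesis using i by (auto simp: y_E_def c_commute)
    qed
    { assume "i \<noteq> j"
      then show "supercommute (p i) (p j) (\<Phi> i) (y_E \<epsilon> j)"
        using i j \<Phi>\<Phi>d p_last supercommute_c by (cases "j = Suc N") (auto simp: y_E_def) } }
  assume "i \<in> {1..Suc N}" "j \<in> {1..Suc N}"
  then show "supercommute (p i) (p j) (y_E \<epsilon> i) (y_E \<epsilon> j)"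
    using \<Phi>d\<Phi>d p_last supercommute_c supercommute_c_left
    by (cases "i = Suc N"; cases "j = Suc N") (auto simp: y_E_def)
qed

lemma F_chain: "oscillator_chain c N p \<Phi>d y_F W_F"
proof unfold_locales
  fix i j
  show "p i \<le> 1" by (rule p_le)
  show "p (Suc N) = 0" by (rule p_last)
  { assume i: "i \<in> {1..N}"
    have even: "\<Phi>d i * \<Phi> i = c (inverse q) * (\<Phi> i * \<Phi>d i) + c (- inverse q) * v i" if "p i = 0"
      using osc_v[OF i] that by (simp add: distrib_left c_uminus)
    have odd: "\<Phi>d i * \<Phi> i = c (- q) * (\<Phi> i * \<Phi>d i) + c q * u i" if "p i = 1"
      using osc_u[OF i] that by (simp add: right_diff_distrib c_uminus)
    show "\<Phi>d i * y_F i = c ((-1) ^ p i * q powi (- sgn_par (p i))) * (y_F i * \<Phi>d i) + W_F i"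
      using even odd p_cases[of i] i
      by (auto simp: y_F_def W_F_def sgn_par_def power_int_minus c_left_commute[of "\<Phi>d i"] mult.assoc
          distrib_left mult.commute)
    { assume j: "j \<in> {1..N}"
      show "supercommute (p i) (p j) (\<Phi>d i) (\<Phi>d j)" using i j by (rule \<Phi>d\<Phi>d)
      show "W_F i * \<Phi>d j = c (if i = j then inverse q else 1) * (\<Phi>d j * W_F i)"
        using weight_\<Phi>d[OF j] weight_v[OF weight_\<Phi>d[OF j] i] p_cases[of i] i
        by (auto simp: W_F_def weight_def basis_pairing_def sgn_par_def power_int_minus mult.assoc
            c_left_commute[of "\<Phi>d _"] mult.commute mult.left_commute) }
    assume j: "j \<in> {1..Suc N}"
    show "W_F i * y_F j = c (if i = j then q else 1) * (y_F j * W_F i)"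
    proof (cases "j \<le> N")
      case True
      then have "j \<in> {1..N}" using j by auto
      then show ?thesis
        using weight_\<Phi>[of j] weight_v[OF weight_\<Phi>[of j] i] p_cases[of i] i True
        by (auto simp: W_F_def y_F_def weight_def basis_pairing_def sgn_par_def power_int_minus mult.assoc
            c_left_commute[of "\<Phi> _"] c_left_commute[of "u _"] c_left_commute[of "v _"] mult.commute mult.left_commute)
    next
      case False
      then show ?thesis using i by (auto simp: y_F_def)
    qed
    { assume "i \<noteq> j"
      then show "supercommute (p i) (p j) (\<Phi>d i) (y_F j)"
        using i j \<Phi>d\<Phi> p_last supercommute_1 supercommute_c_mult_right
        by (cases "j = Suc N") (auto simp: y_F_def) } }
  assume "i \<in> {1..Suc N}" "j \<in> {1..Suc N}"
  then show "supercommute (p i) (p j) (y_F i) (y_F j)"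
    using \<Phi>\<Phi> p_last supercommute_1 supercommute_c_mult_left supercommute_c_mult_right
    by (cases "i = Suc N"; cases "j = Suc N") (auto simp: y_F_def)
qed

text \<open>The images of the generators of the quantum supergroup.\<close>

definition \<epsilon> :: scalar where
  "\<epsilon> = imag_unit * inverse (qhalf - inverse qhalf)"

definition E :: "nat \<Rightarrow> 'a" where
  "E i = (if i < N then \<Phi> i * \<Phi>d (Suc i) else c \<epsilon> * \<Phi> i)"

definition F :: "nat \<Rightarrow> 'a" where
  "F i = (if i < N then \<Phi> (Suc i) * \<Phi>d i else \<Phi>d i)"

definition k_scalar :: "nat \<Rightarrow> scalar" where
  "k_scalar i = (if i < N then - ((-1) ^ p (Suc i)) else imag_unit * qhalf)"

definition K :: "nat \<Rightarrow> 'a" where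
  "K i = c (k_scalar i) * (if i < N then u i * v (Suc i) else u i)"

definition Kinv :: "nat \<Rightarrow> 'a" where
  "Kinv i = c (inverse (k_scalar i)) * (if i < N then v i * u (Suc i) else v i)"

lemma E_eq: "i \<in> {1..N} \<Longrightarrow> E i = \<Phi> i * y_E \<epsilon> (Suc i)"
  by (auto simp: E_def y_E_def c_commute)

lemma F_eq:
  assumes "i \<in> {1..N}"
  shows "F i = \<Phi>d i * y_F (Suc i)"
proof (cases "i < N")
  case True
  then have "\<Phi> (Suc i) * \<Phi>d i = (-1) ^ (p (Suc i) * p i) * (\<Phi>d i * \<Phi> (Suc i))"
    using \<Phi>\<Phi>d[of "Suc i" i] assms by (simp add: supercommute_def)
  then show ?thesis
    using True by (simp add: F_def y_F_def c_left_commute[of "\<Phi>d i"]) (simp add: c_sign)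
qed (use assms in \<open>auto simp: F_def y_F_def\<close>)

lemma k_scalar_neq_0: "k_scalar i \<noteq> 0"
  by (simp add: k_scalar_def imag_unit_neq_0)

lemma K_Kinv:
  assumes "i \<in> {1..N}"
  shows "K i * Kinv i = 1" "Kinv i * K i = 1"
proof -
  have cancel: "u j * (v j * z) = z" "v j * (u j * z) = z" if "j \<in> {1..N}" for j z
    using uv vu that by (simp_all flip: mult.assoc)
  have "u i * (v (Suc i) * (v i * u (Suc i))) = 1" "v i * (u (Suc i) * (u i * v (Suc i))) = 1" if "i < N"
  proof -
    have ind: "i \<in> {1..N}" "Suc i \<in> {1..N}" using assms that by auto
    have "v (Suc i) * (v i * u (Suc i)) = v i * (v (Suc i) * u (Suc i))"
      using v_v[OF ind] by (simp flip: mult.assoc)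
    then show "u i * (v (Suc i) * (v i * u (Suc i))) = 1"
      using uv vu ind by simp
    have "u (Suc i) * (u i * v (Suc i)) = u i * (u (Suc i) * v (Suc i))"
      using uu[OF ind] by (simp flip: mult.assoc)
    then show "v i * (u (Suc i) * (u i * v (Suc i))) = 1"
      using uv vu ind by simp
  qed
  then show "K i * Kinv i = 1" "Kinv i * K i = 1"
    using k_scalar_neq_0[of i] uv vu assms
    by (auto simp: K_def Kinv_def mult.assoc c_left_commute[of "u _"] c_left_commute[of "v _"])
qed

lemma weight_u: "j \<in> {1..N} \<Longrightarrow> weight (\<lambda>_. 0) (u j)"
  using uu by (simp add: weight_def)

lemma weight_v': "j \<in> {1..N} \<Longrightarrow> weight (\<lambda>_. 0) (v j)"
  using weight_v[OF weight_u] by (simp add: weight_def)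

lemma weight_K:
  assumes "j \<in> {1..N}"
  shows "weight (\<lambda>_. 0) (K j)"
proof -
  have "weight (\<lambda>_. 0) (if j < N then u j * v (Suc j) else u j)"
    using weight_mult[OF weight_u[of j] weight_v'[of "Suc j"]] weight_u[of j] assms by simp
  then show ?thesis
    unfolding K_def by (rule weight_c_mult)
qed

lemma K_weight:
  assumes i: "i \<in> {1..N}" and \<omega>: "weight \<omega> z" "\<omega> (Suc N) = 0"
  shows "K i * z = c (q powi (\<omega> i - \<omega> (Suc i))) * (z * K i)"
proof (cases "i < N")
  case True
  then have i': "Suc i \<in> {1..N}" by auto
  have "K i * z = c (k_scalar i) * (u i * (v (Suc i) * z))"
    using True by (simp add: K_def mult.assoc)
  also have "\<dots> = c (k_scalar i * q powi (- \<omega> (Suc i))) * (u i * z * v (Suc i))"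
    using weight_v[OF \<omega>(1) i'] by (simp add: c_left_commute[of "u i"] mult.assoc)
  also have "\<dots> = c (k_scalar i * q powi (- \<omega> (Suc i)) * q powi \<omega> i) * (z * u i * v (Suc i))"
    using \<omega>(1) i by (simp add: weight_def mult.assoc)
  finally show ?thesis
    using True by (simp add: K_def mult.assoc c_left_commute[of z] power_int_diff power_int_minus
        divide_inverse ac_simps)
next
  case False
  then have "i = N" using i by auto
  then show ?thesis
    using \<omega> i by (simp add: K_def weight_def mult.assoc c_left_commute[of z] mult.commute[of "k_scalar N"])
qed

lemma K_conj:
  assumes "i \<in> {1..N}" "weight \<omega> z" "\<omega> (Suc N) = 0"
  shows "K i * z * Kinv i = c (q powi (\<omega> i - \<omega> (Suc i))) * z"
  using K_weight[OF assms] K_Kinv[OF assms(1)] by (simp add: mult.assoc)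

lemma K_K: "i \<in> {1..N} \<Longrightarrow> j \<in> {1..N} \<Longrightarrow> K i * K j = K j * K i"
  using K_weight[OF _ weight_K] by simp

lemma weight_E: "j \<in> {1..N} \<Longrightarrow> weight (\<lambda>i. coord i j - coord i (Suc j)) (E j)"
  using weight_mult[OF weight_\<Phi>[of j] weight_\<Phi>d[of "Suc j"]] weight_c_mult[OF weight_\<Phi>[of j]]
  by (cases "j < N") (auto simp: E_def basis_pairing_def weight_def)

lemma weight_F: "j \<in> {1..N} \<Longrightarrow> weight (\<lambda>i. - (coord i j - coord i (Suc j))) (F j)"
  using weight_mult[OF weight_\<Phi>[of "Suc j"] weight_\<Phi>d[of j]] weight_\<Phi>d[of j]
  by (cases "j < N") (auto simp: F_def basis_pairing_def weight_def)

abbreviation "B \<equiv> root_pairing N p"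

lemma K_E: "i \<in> {1..N} \<Longrightarrow> j \<in> {1..N} \<Longrightarrow> K i * E j * Kinv i = c (q powi B i j) * E j"
  using K_conj[OF _ weight_E, of i j] by (simp add: root_pairing_def basis_pairing_def algebra_simps)

lemma K_F: "i \<in> {1..N} \<Longrightarrow> j \<in> {1..N} \<Longrightarrow> K i * F j * Kinv i = c (q powi (- B i j)) * F j"
  using K_conj[OF _ weight_F, of i j] by (simp add: root_pairing_def basis_pairing_def algebra_simps)

lemma E_F:
  assumes "i \<in> {1..N}" "j \<in> {1..N}" "i \<noteq> j"
  shows "supercommute (p i + p (Suc i)) (p j + p (Suc j)) (E i) (F j)"
proof -
  have "supercommute (p i) (p (Suc j)) (\<Phi> i) (y_F (Suc j))"
    using assms \<Phi>\<Phi> supercommute_1 p_last supercommute_c_mult_right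
    by (cases "j = N") (auto simp: y_F_def)
  moreover have "supercommute (p (Suc i)) (p j) (y_E \<epsilon> (Suc i)) (\<Phi>d j)"
    using assms \<Phi>d\<Phi>d supercommute_c_left p_last
    by (cases "i = N") (auto simp: y_E_def)
  moreover have "supercommute (p (Suc i)) (p (Suc j)) (y_E \<epsilon> (Suc i)) (y_F (Suc j))"
    using assms \<Phi>d\<Phi> supercommute_c_left p_last supercommute_1 supercommute_c_mult_right
    by (cases "i = N"; cases "j = N") (auto simp: y_E_def y_F_def)
  ultimately show ?thesis
    unfolding E_eq[OF assms(1)] F_eq[OF assms(2)]
    by (intro supercommute_mult \<Phi>\<Phi>d assms)
qed

text \<open>The two oscillator relations of a node are linear equations for \<open>\<Phi> \<Phi>\<^sup>\<dagger>\<close> and \<open>\<Phi>\<^sup>\<dagger> \<Phi>\<close>, and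
  \<open>q - q\<^sup>-\<^sup>1\<close> is invertible.\<close>

lemma \<Phi>d_\<Phi>_eq:
  assumes "i \<in> {1..N}"
  shows "\<Phi>d i * \<Phi> i = c ((-1) ^ p i * inverse (q - inverse q)) * (u i - v i)"
proof -
  have "c ((-1) ^ p i * (q - inverse q)) * (\<Phi>d i * \<Phi> i) = u i - v i"
    using osc_u[OF assms] osc_v[OF assms] by (simp add: right_diff_distrib c_diff left_diff_distrib)
      (simp add: algebra_simps)
  then have "c ((-1) ^ p i * inverse (q - inverse q)) * (c ((-1) ^ p i * (q - inverse q)) * (\<Phi>d i * \<Phi> i)) =
      c ((-1) ^ p i * inverse (q - inverse q)) * (u i - v i)"
    by simp
  then show ?thesis
    using q_diff_inverse_neq_0 by (simp add: ac_simps)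
qed

lemma \<Phi>_\<Phi>d_eq:
  assumes "i \<in> {1..N}"
  shows "\<Phi> i * \<Phi>d i = c (inverse (q - inverse q)) * (c q * u i - c (inverse q) * v i)"
proof -
  have "1 = inverse (q - inverse q) * (q - inverse q)"
    using q_diff_inverse_neq_0 by simp
  then have "v i = c (inverse (q - inverse q)) * (c (q - inverse q) * v i)"
    by simp
  also have "\<dots> = c (inverse (q - inverse q)) * (c q * v i - c (inverse q) * v i)"
    by (simp only: c_diff left_diff_distrib)
  finally have v: "v i = c (inverse (q - inverse q)) * (c q * v i - c (inverse q) * v i)" .
  have "\<Phi> i * \<Phi>d i = c (inverse (q - inverse q)) * (c q * (u i - v i)) + v i"
    using osc_v[OF assms] by (simp add: \<Phi>d_\<Phi>_eq[OF assms] ac_simps)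
  then show ?thesis
    by (subst (asm) v) (simp add: right_diff_distrib)
qed

text \<open>For a long or isotropic root both products factor into \<open>\<Phi> \<Phi>\<^sup>\<dagger>\<close> at one node and \<open>\<Phi>\<^sup>\<dagger> \<Phi>\<close> at the next, hence into
  torus elements. For the short root the scalar \<open>\<epsilon>\<close> absorbs the factor \<open>q\<^sup>1\<^sup>/\<^sup>2 - q\<^sup>-\<^sup>1\<^sup>/\<^sup>2\<close> of both \<open>q - 1\<close> and
  \<open>1 - q\<^sup>-\<^sup>1\<close>.\<close>

lemma E_F_same:
  assumes i: "i \<in> {1..N}"
  shows "E i * F i - (-1) ^ (p i + p (Suc i)) * (F i * E i) = c (inverse (q - inverse q)) * (K i - Kinv i)"
proof (cases "i < N")
  case True
  define t h where "t = Suc i" and "h = inverse (q - inverse q)"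
  have t: "t \<in> {1..N}" "i \<noteq> t" "t \<noteq> i" using i True by (auto simp: t_def)
  have comm: "u t * \<Phi>d i = \<Phi>d i * u t" "v t * \<Phi>d i = \<Phi>d i * v t"
    "u i * \<Phi>d t = \<Phi>d t * u i" "v i * \<Phi>d t = \<Phi>d t * v i"
    using weight_\<Phi>d[OF i] weight_\<Phi>d[OF t(1)] weight_v[OF weight_\<Phi>d[OF i] t(1)]
      weight_v[OF weight_\<Phi>d[OF t(1)] i] i t by (auto simp: weight_def basis_pairing_def)
  have "E i * F i = \<Phi> i * (\<Phi>d t * \<Phi> t) * \<Phi>d i"
    using True by (simp add: E_def F_def t_def mult.assoc)
  also have "\<dots> = c ((-1) ^ p t * h) * (\<Phi> i * \<Phi>d i * (u t - v t))"
    by (simp add: \<Phi>d_\<Phi>_eq[OF t(1)] c_left_commute[of "\<Phi> i"] mult.assoc left_diff_distrib right_diff_distrib comm h_def)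
  finally have EF: "E i * F i = c ((-1) ^ p t * h * h) * ((c q * u i - c (inverse q) * v i) * (u t - v t))"
    by (simp add: \<Phi>_\<Phi>d_eq[OF i] h_def mult.assoc)
  have "F i * E i = \<Phi> t * (\<Phi>d i * \<Phi> i) * \<Phi>d t"
    using True by (simp add: E_def F_def t_def mult.assoc)
  also have "\<dots> = c ((-1) ^ p i * h) * (\<Phi> t * \<Phi>d t * (u i - v i))"
    by (simp add: \<Phi>d_\<Phi>_eq[OF i] c_left_commute[of "\<Phi> t"] mult.assoc left_diff_distrib right_diff_distrib comm h_def)
  finally have "F i * E i = c ((-1) ^ p i * h * h) * ((c q * u t - c (inverse q) * v t) * (u i - v i))"
    by (simp add: \<Phi>_\<Phi>d_eq[OF t(1)] h_def mult.assoc)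
  then have "(-1) ^ (p i + p t) * (F i * E i) =
      c ((-1) ^ p t * h * h) * ((c q * u t - c (inverse q) * v t) * (u i - v i))"
    by (cases "even (p i)"; cases "even (p t)") (simp_all add: power_add c_uminus)
  then have "E i * F i - (-1) ^ (p i + p t) * (F i * E i) =
      c ((-1) ^ p t * h * h) * ((c q * u i - c (inverse q) * v i) * (u t - v t)
        - (c q * u t - c (inverse q) * v t) * (u i - v i))"
    unfolding EF by (simp only: right_diff_distrib)
  also have "(c q * u i - c (inverse q) * v i) * (u t - v t) - (c q * u t - c (inverse q) * v t) * (u i - v i)
      = c (- (q - inverse q)) * (u i * v t - v i * u t)"
    by (simp add: c_diff c_uminus left_diff_distrib right_diff_distrib mult.assoc
        uu[OF t(1) i] v_v[OF t(1) i] u_v[OF i t(1)] u_v[OF t(1) i])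
  also have "c ((-1) ^ p t * h * h) * (c (- (q - inverse q)) * (u i * v t - v i * u t)) =
      c (- ((-1) ^ p t) * h * (h * (q - inverse q))) * (u i * v t - v i * u t)"
  proof -
    have "(-1) ^ p t * h * h * - (q - inverse q) = - ((-1) ^ p t) * h * (h * (q - inverse q))"
      by (simp add: algebra_simps)
    then show ?thesis by (simp only: c_c_left)
  qed
  also have "h * (q - inverse q) = 1"
    using q_diff_inverse_neq_0 by (simp add: h_def)
  also have "c (- ((-1) ^ p t) * h * 1) * (u i * v t - v i * u t) = c h * (K i - Kinv i)"
    using True by (cases "even (p t)")
      (simp_all add: K_def Kinv_def k_scalar_def t_def right_diff_distrib c_uminus)
  finally show ?thesis
    by (simp add: t_def h_def)
next
  case False
  then have N: "i = N" using i by auto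
  define h where "h = inverse (q - inverse q)"
  have scal: "\<epsilon> * (q - 1) = imag_unit * qhalf" "\<epsilon> * (1 - inverse q) = - inverse (imag_unit * qhalf)"
  proof -
    have "q - 1 = (qhalf - inverse qhalf) * qhalf" "1 - inverse q = (qhalf - inverse qhalf) * inverse qhalf"
      by (simp_all add: q_def power2_eq_square field_simps)
    moreover have "imag_unit = - inverse imag_unit"
      using imag_unit_square imag_unit_neq_0 by (simp add: field_simps)
    moreover have "inverse (qhalf - inverse qhalf) * ((qhalf - inverse qhalf) * z) = z" for z
      using qhalf_diff_inverse_neq_0 by (simp flip: mult.assoc)
    ultimately show "\<epsilon> * (q - 1) = imag_unit * qhalf" "\<epsilon> * (1 - inverse q) = - inverse (imag_unit * qhalf)"
      by (simp_all only: \<epsilon>_def mult.assoc inverse_mult_distrib minus_mult_left)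
  qed
  have "E N * F N - (-1) ^ (p N + p (Suc N)) * (F N * E N) =
      c \<epsilon> * (\<Phi> N * \<Phi>d N) - c \<epsilon> * ((-1) ^ p N * (\<Phi>d N * \<Phi> N))"
    using p_last by (cases "even (p N)") (simp_all add: E_def F_def mult.assoc c_left_commute[of "\<Phi>d N"])
  also have "(-1) ^ p N * (\<Phi>d N * \<Phi> N) = c h * (u N - v N)"
    using \<Phi>d_\<Phi>_eq[OF i] N by (cases "even (p N)") (simp_all add: h_def c_uminus)
  also have "\<Phi> N * \<Phi>d N = c h * (c q * u N - c (inverse q) * v N)"
    using \<Phi>_\<Phi>d_eq[OF i] N by (simp add: h_def)
  also have "c \<epsilon> * (c h * (c q * u N - c (inverse q) * v N)) - c \<epsilon> * (c h * (u N - v N)) =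
      c h * (c (\<epsilon> * (q - 1)) * u N + c (\<epsilon> * (1 - inverse q)) * v N)"
    by (simp add: right_diff_distrib left_diff_distrib distrib_left c_diff ac_simps)
  also have "\<dots> = c h * (K N - Kinv N)"
    unfolding scal by (simp add: K_def Kinv_def k_scalar_def c_uminus)
  finally show ?thesis by (simp add: N h_def)
qed

end

section \<open>Root data\<close>

locale root_datum =
  fixes m n :: nat and r :: "basis rel"
  assumes m_pos: "m \<ge> 1" and admissible: "admissible m n r"
begin

abbreviation "N \<equiv> m + n"
abbreviation "\<E> \<equiv> ordered_basis m n r"

definition p :: "nat \<Rightarrow> nat" where
  "p i = (if i \<le> N then par_Phi m n r i else 0)"

text \<open>The number of predecessors enumerates the basis, since the order is strict and total.\<close>

definition below :: "basis \<Rightarrow> basis set" where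
  "below b = {c \<in> basis_set m n. (c, b) \<in> r}"

lemma finite_basis_set: "finite (basis_set m n)"
  by (simp add: basis_set_def)

lemma card_basis_set: "card (basis_set m n) = N"
  unfolding basis_set_def
  by (subst card_Un_disjoint) (auto simp: card_image inj_on_def)

lemma order:
  "trans r" "irrefl r" "\<And>b c. b \<in> basis_set m n \<Longrightarrow> c \<in> basis_set m n \<Longrightarrow> b \<noteq> c \<Longrightarrow> (b, c) \<in> r \<or> (c, b) \<in> r"
  using admissible by (auto simp: admissible_def strict_linear_order_on_def total_on_def)

lemma below_less:
  assumes "b \<in> basis_set m n" "(b, c) \<in> r"
  shows "card (below b) < card (below c)"
proof (rule psubset_card_mono)
  show "finite (below c)"
    using finite_basis_set by (simp add: below_def)
  have "below b \<subseteq> below c"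
    using assms order(1) by (auto simp: below_def dest: transD)
  moreover have "b \<in> below c - below b"
    using assms order(2) by (auto simp: below_def irrefl_def)
  ultimately show "below b \<subset> below c" by blast
qed

lemma below_inj: "inj_on (\<lambda>b. card (below b)) (basis_set m n)"
  using below_less order(3) by (intro inj_onI) (metis less_irrefl)

lemma below_bound: "b \<in> basis_set m n \<Longrightarrow> card (below b) < N"
proof -
  assume b: "b \<in> basis_set m n"
  have "below b \<subset> basis_set m n"
    using b order(2) by (auto simp: below_def irrefl_def)
  then show ?thesis
    using psubset_card_mono[OF finite_basis_set] card_basis_set by metis
qed

lemma below_image: "(\<lambda>b. card (below b)) ` basis_set m n = {..<N}"
  using below_bound card_basis_set card_image[OF below_inj]
  by (intro card_subset_eq) auto

lemma \<E>:
  assumes "i \<in> {1..N}"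
  shows "\<E> i \<in> basis_set m n" "card (below (\<E> i)) + 1 = i"
proof -
  have "i - 1 \<in> (\<lambda>b. card (below b)) ` basis_set m n"
    using assms unfolding below_image by auto
  then obtain b where b: "b \<in> basis_set m n" "card (below b) + 1 = i"
    using assms by auto
  have "\<E> i = b"
    unfolding ordered_basis_def
  proof (rule the_equality)
    show "b' = b" if "b' \<in> basis_set m n \<and> card {c \<in> basis_set m n. (c, b') \<in> r} + 1 = i" for b'
      using that b inj_onD[OF below_inj, of b' b] by (simp add: below_def)
  qed (use b in \<open>simp add: below_def\<close>)
  with b show "\<E> i \<in> basis_set m n" "card (below (\<E> i)) + 1 = i" by auto
qed

lemma \<E>_eq_iff: "i \<in> {1..N} \<Longrightarrow> j \<in> {1..N} \<Longrightarrow> \<E> i = \<E> j \<longleftrightarrow> i = j"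
  using \<E>(2) by metis

text \<open>The last basis vector is maximal, while \<open>\<delta>\<^sub>k\<close> with \<open>k < n\<close> precedes \<open>\<delta>\<^sub>k\<^sub>+\<^sub>1\<close>. So the parity of the short root,
  defined by \<open>\<delta>\<^sub>n\<close>, is the parity of the last basis vector.\<close>

lemma \<E>_last:
  shows "\<E> N \<in> range Del \<longleftrightarrow> \<E> N = Del n"
proof
  have N: "N \<in> {1..N}" using m_pos by auto
  assume "\<E> N \<in> range Del"
  then obtain k where k: "\<E> N = Del k" by auto
  with \<E>(1)[OF N] have kn: "1 \<le> k" "k \<le> n" by (auto simp: basis_set_def)
  have "\<not> k < n"
  proof
    assume "k < n"
    then have "(Del k, Del (k + 1)) \<in> r" "Del (k + 1) \<in> basis_set m n"
      using admissible kn by (auto simp: admissible_def basis_set_def)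
    then have "card (below (Del k)) < card (below (Del (k + 1)))" "card (below (Del (k + 1))) < N"
      using below_less[of "Del k"] below_bound \<E>(1)[OF N] k by auto
    then show False using \<E>(2)[OF N] k by simp
  qed
  then show "\<E> N = Del n" using k kn by simp
qed auto

lemma p_le: "p i \<le> 1"
  by (simp add: p_def par_Phi_def)

lemma p_cases: "p i = 0 \<or> p i = 1"
  using p_le[of i] by linarith

lemma p_last: "p (Suc N) = 0"
  by (simp add: p_def)

lemma p_eq_1_iff: "i \<le> N \<Longrightarrow> p i = 1 \<longleftrightarrow> \<E> i \<in> range Del"
  by (simp add: p_def par_Phi_def)

lemma odd_roots_iff: "i \<in> {1..N} \<Longrightarrow> i \<in> odd_roots m n r \<longleftrightarrow> odd (p i + p (Suc i))"
proof (cases "i < N")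
  case True
  assume "i \<in> {1..N}"
  then show ?thesis
    using True p_cases[of i] p_cases[of "Suc i"] p_eq_1_iff[of i] p_eq_1_iff[of "Suc i"]
    by (auto simp: odd_roots_def)
next
  case False
  assume "i \<in> {1..N}"
  with False have "i = N" by auto
  then show ?thesis
    using p_cases[of N] p_eq_1_iff[of N] p_last \<E>_last by (auto simp: odd_roots_def)
qed

lemma par_e_eq: "i \<in> {1..N} \<Longrightarrow> par_e m n r i = (p i + p (Suc i)) mod 2"
  using odd_roots_iff[of i] p_cases[of i] p_cases[of "Suc i"] by (auto simp: par_e_def)

lemma form_diff:
  "form m n (\<lambda>b. f b - g b) h = form m n f h - form m n g h"
  "form m n h (\<lambda>b. f b - g b) = form m n h f - form m n h g"
  by (simp_all add: form_def algebra_simps sum.distrib sum_subtractf sum_negf)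

lemma form_basis_vec:
  assumes "b \<in> basis_set m n" "b' \<in> basis_set m n"
  shows "form m n (basis_vec b) (basis_vec b') =
    (if b = b' then if b \<in> range Del then 1 else - 1 else 0)"
  using assms
  by (auto simp: form_def basis_vec_def basis_set_def if_distrib[of "\<lambda>t. t * _"] if_distrib[of uminus]
      sum.delta cong: if_cong)

text \<open>The ordered basis vectors, continued by the zero vector.\<close>

definition vec :: "nat \<Rightarrow> basis \<Rightarrow> real" where
  "vec i = (if i \<le> N then basis_vec (\<E> i) else (\<lambda>_. 0))"

lemma simple_root_eq: "i \<in> {1..N} \<Longrightarrow> simple_root m n r i = (\<lambda>b. vec i b - vec (Suc i) b)"
  by (auto simp: simple_root_def vec_def fun_eq_iff)

lemma form_vec:
  assumes "i \<ge> 1" "j \<ge> 1"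
  shows "form m n (vec i) (vec j) = basis_pairing N p i j"
proof (cases "i \<le> N \<and> j \<le> N")
  case True
  then show ?thesis
    using assms form_basis_vec[OF \<E>(1) \<E>(1), of i j] \<E>_eq_iff[of i j] p_eq_1_iff[of i] p_cases[of i]
    by (auto simp: vec_def basis_pairing_def sgn_par_def)
next
  case False
  then show ?thesis
    by (auto simp: vec_def basis_pairing_def form_def)
qed

abbreviation "B \<equiv> root_pairing N p"

lemma root_form_eq: "i \<in> {1..N} \<Longrightarrow> j \<in> {1..N} \<Longrightarrow> root_form m n r i j = B i j"
  by (simp add: simple_root_eq form_diff form_vec root_pairing_def)

lemma B_diag:
  assumes "i \<in> {1..N}"
  shows "B i i = (if i = N then - sgn_par (p i) else if p i = p (Suc i) then - 2 * sgn_par (p i) else 0)"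
  using assms p_cases[of i] p_cases[of "Suc i"]
  by (auto simp: root_pairing_def basis_pairing_def sgn_par_def)

lemma B_off_diag:
  assumes "i \<in> {1..N}" "j \<in> {1..N}" "i \<noteq> j"
  shows "B i j = (if j = Suc i then sgn_par (p j) else if i = Suc j then sgn_par (p i) else 0)"
  using assms by (auto simp: root_pairing_def basis_pairing_def)

lemma cartan_eq:
  assumes "i \<in> {1..N}" "j \<in> {1..N}"
  shows "cartan m n r i j = (if B i i \<noteq> 0 then 2 * B i j div B i i else - B i j)"
proof -
  have "\<lfloor>2 * real_of_int (B i j) / real_of_int (B i i)\<rfloor> = 2 * B i j div B i i"
    using floor_divide_of_int_eq[of "2 * B i j" "B i i"] by simp
  then show ?thesis
    using assms by (simp add: cartan_def root_form_eq)
qed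

lemma qi_eq:
  assumes "i \<in> {1..N}"
  shows "qi m n r i = (if B i i \<noteq> 0 then qhalf powi B i i else inverse q)"
  using assms by (simp add: qi_def qpow_def cartan_d_def root_form_eq q_def power_int_minus)

lemma B_diag_cases: "i \<in> {1..N} \<Longrightarrow> B i i \<in> {0, 1, - 1, 2, - 2}"
  using B_diag[of i] p_cases[of i] by (auto simp: sgn_par_def)

lemma q_powi: "q powi k = qhalf powi (2 * k)"
  by (simp add: q_def power_int_mult)

text \<open>In both cases of the definition of the Cartan matrix the normalizations of \<open>q\<^sub>i\<close> and \<open>a\<^sub>i\<^sub>j\<close> cancel. The
  division is exact because \<open>(\<alpha>\<^sub>i, \<alpha>\<^sub>i)\<close> divides 2.\<close>

lemma qi_powi_cartan:
  assumes "i \<in> {1..N}" "j \<in> {1..N}"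
  shows "qi m n r i powi cartan m n r i j = q powi B i j"
    and "qi m n r i powi (- cartan m n r i j) = q powi (- B i j)"
proof -
  show "qi m n r i powi cartan m n r i j = q powi B i j"
  proof (cases "B i i = 0")
    case True
    then show ?thesis
      using assms by (simp add: qi_eq cartan_eq power_int_minus power_int_inverse)
  next
    case False
    then have "B i i * (2 * B i j div B i i) = 2 * B i j"
      using B_diag_cases[OF assms(1)] by auto
    then show ?thesis
      using assms False by (simp add: qi_eq cartan_eq q_powi flip: power_int_mult)
  qed
  then show "qi m n r i powi (- cartan m n r i j) = q powi (- B i j)"
    by (simp add: power_int_minus)
qed

lemma cartan_diag:
  assumes "i \<in> {1..N}"
  shows "cartan m n r i i = (if B i i \<noteq> 0 then 2 else 0)"
  using assms by (simp add: cartan_eq)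

end

section \<open>The Serre relations hold for the images\<close>

text \<open>If one of the denominators occurring in \<open>q\<close>-binomials up to order 3 vanishes, then \<open>k\<^sup>2 = 1\<close>,
  \<open>k\<^sup>4 = 1\<close> or \<open>k\<^sup>6 = 1\<close>, hence \<open>k\<^sup>1\<^sup>2 = 1\<close>; for powers of \<open>q\<^sup>1\<^sup>/\<^sup>2\<close> this is impossible.\<close>

lemma qint_1: "k ^ 12 \<noteq> 1 \<Longrightarrow> k \<noteq> 0 \<Longrightarrow> k - inverse k \<noteq> 0"
  and qint_2: "k ^ 12 \<noteq> 1 \<Longrightarrow> k \<noteq> 0 \<Longrightarrow> k + inverse k \<noteq> 0"
  and qint_3: "k ^ 12 \<noteq> 1 \<Longrightarrow> k \<noteq> 0 \<Longrightarrow> k ^ 2 + 1 + inverse k ^ 2 \<noteq> (0 :: scalar)"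
proof -
  assume k: "k ^ 12 \<noteq> 1" "k \<noteq> 0"
  have "k ^ 12 = 1" if "k ^ 2 = 1 \<or> k ^ 2 = - 1 \<or> k ^ 6 = 1"
  proof -
    have "(k ^ 2) ^ 6 = k ^ 12" "(k ^ 6) ^ 2 = k ^ 12"
      by (simp_all flip: power_mult)
    with that show ?thesis by (elim disjE) simp_all
  qed
  then have neq: "k ^ 2 \<noteq> 1" "k ^ 2 \<noteq> - 1" "k ^ 6 \<noteq> 1"
    using k by blast+
  show "k - inverse k \<noteq> 0"
  proof
    assume "k - inverse k = 0"
    then have "k ^ 2 = 1" using k by (simp add: field_simps power2_eq_square)
    then show False using neq by simp
  qed
  show "k + inverse k \<noteq> 0"
  proof
    assume "k + inverse k = 0"
    then have "k ^ 2 + 1 = 0" using k by (simp add: field_simps power2_eq_square)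
    then show False using neq by (simp add: eq_neg_iff_add_eq_0)
  qed
  show "k ^ 2 + 1 + inverse k ^ 2 \<noteq> 0"
  proof
    define K where "K = k ^ 2"
    have K: "K \<noteq> 0" using k by (simp add: K_def)
    assume "k ^ 2 + 1 + inverse k ^ 2 = 0"
    then have "(K + 1 + inverse K) * (K * (K - 1)) = 0"
      by (simp add: K_def power_inverse)
    moreover have "(K + 1 + inverse K) * (K * (K - 1)) = (K * K + K + 1) * (K - 1)"
      using K by (simp add: distrib_right)
    moreover have "(K * K + K + 1) * (K - 1) = k ^ 6 - 1"
      by (simp add: algebra_simps K_def eval_nat_numeral)
    ultimately show False using neq by simp
  qed
qed

lemma
  assumes k: "k ^ 12 \<noteq> 1" "k \<noteq> 0"
  shows qint_eqs: "qint k 1 = 1" "qint k 2 = k + inverse k" "qint k 3 = k ^ 2 + 1 + inverse k ^ 2"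
    and qint_super_eq: "qint_super k 1 = 1"
proof -
  note nz = qint_1[OF k] qint_2[OF k]
  have p2: "k powi 2 = k ^ 2" "k powi 3 = k ^ 3" "k powi (- 2) = inverse k ^ 2" "k powi (- 3) = inverse k ^ 3"
    by (simp_all add: power_int_def)
  show "qint k 1 = 1" "qint_super k 1 = 1"
    using nz by (simp_all add: qint_def qint_super_def power_int_minus)
  have "k ^ 2 - inverse k ^ 2 = (k + inverse k) * (k - inverse k)"
    by (simp add: algebra_simps power2_eq_square)
  then show "qint k 2 = k + inverse k"
    using nz p2 by (simp add: qint_def)
  have "k ^ 3 - l ^ 3 = (k ^ 2 + k * l + l ^ 2) * (k - l)" for l
    by (simp add: algebra_simps power2_eq_square power3_eq_cube)
  from this[of "inverse k"] have "k ^ 3 - inverse k ^ 3 = (k ^ 2 + 1 + inverse k ^ 2) * (k - inverse k)"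
    using k by simp
  then show "qint k 3 = k ^ 2 + 1 + inverse k ^ 2"
    using nz p2 by (simp add: qint_def)
qed

lemma
  assumes k: "k ^ 12 \<noteq> 1" "k \<noteq> 0"
  shows qbinom_1: "qbinom k 1 0 = 1" "qbinom k 1 1 = 1"
    and qbinom_2: "qbinom k 2 0 = 1" "qbinom k 2 1 = k + inverse k" "qbinom k 2 2 = 1"
    and qbinom_3: "qbinom k 3 0 = 1" "qbinom k 3 1 = k ^ 2 + 1 + inverse k ^ 2"
      "qbinom k 3 2 = k ^ 2 + 1 + inverse k ^ 2" "qbinom k 3 3 = 1"
    and qbinom_super_1: "qbinom_super k 1 0 = 1" "qbinom_super k 1 1 = 1"
proof -
  note nz = qint_1[OF k] qint_2[OF k] qint_3[OF k]
  have set: "{Suc 0..2} = {1, 2}" "{Suc 0..3} = {1, 2, 3}" by auto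
  have fact: "qfact k 0 = 1" "qfact k 1 = 1" "qfact k 2 = k + inverse k"
    "qfact k 3 = (k + inverse k) * (k ^ 2 + 1 + inverse k ^ 2)"
    using qint_eqs[OF k] by (simp_all add: qfact_def set)
  show "qbinom k 1 0 = 1" "qbinom k 1 1 = 1" "qbinom k 2 0 = 1" "qbinom k 2 1 = k + inverse k" "qbinom k 2 2 = 1"
    "qbinom k 3 0 = 1" "qbinom k 3 1 = k ^ 2 + 1 + inverse k ^ 2"
    "qbinom k 3 2 = k ^ 2 + 1 + inverse k ^ 2" "qbinom k 3 3 = 1"
    using nz fact by (simp_all add: qbinom_def)
  show "qbinom_super k 1 0 = 1" "qbinom_super k 1 1 = 1"
    using qint_super_eq[OF k] by (simp_all add: qbinom_super_def qfact_super_def)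
qed

lemma (in root_datum) qi_generic:
  assumes "i \<in> {1..N}"
  shows "qi m n r i \<noteq> 0" "qi m n r i ^ 12 \<noteq> 1"
proof -
  show "qi m n r i \<noteq> 0"
    using assms by (simp add: qi_eq)
  have "(qhalf powi d) ^ 12 \<noteq> 1" if "d \<in> {1, - 1, 2, - 2}" for d
    using that qhalf_power_neq_1[of 12] qhalf_power_neq_1[of 24]
    by (auto simp: power_int_minus power_inverse simp flip: power_mult)
  from this[of "B i i"] this[of "- 2"] show "qi m n r i ^ 12 \<noteq> 1"
    using assms B_diag_cases[OF assms] by (auto simp: qi_eq q_def power_int_minus)
qed

text \<open>Ring homomorphisms from noncommutative polynomials that are compatible with the scalars.\<close>

locale algebra_map = scalar_action c for c :: "'k::field \<Rightarrow> 'a::ring_1" +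
  fixes H :: "('x word \<Rightarrow>\<^sub>0 'k) \<Rightarrow> 'a"
  assumes H_add: "H (z + z') = H z + H z'" and H_mult: "H (z * z') = H z * H z'"
    and H_const: "H (const a) = c a"
begin

lemma H_0: "H 0 = 0"
  using H_const[of 0] by simp

lemma H_1: "H 1 = 1"
  using H_const[of 1] by simp

lemma H_uminus: "H (- z) = - H z"
  using H_add[of "- z" z] by (simp add: eq_neg_iff_add_eq_0 H_0)

lemma H_diff: "H (z - z') = H z - H z'"
  using H_add[of z "- z'"] by (simp add: H_uminus)

lemma H_power: "H (z ^ k) = H z ^ k"
  by (induction k) (simp_all add: H_1 H_mult)

lemma H_sum: "H (sum f A) = (\<Sum>a\<in>A. H (f a))"
  by (induction A rule: infinite_finite_induct) (simp_all add: H_0 H_add)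

lemmas H_simps = H_0 H_1 H_add H_mult H_const H_uminus H_diff H_power H_sum

end

text \<open>\<open>X\<close> is the family of the \<open>e\<^sub>i\<close> or that of the \<open>f\<^sub>i\<close>, sent by \<open>H\<close> to the root vectors of a chain whose parities
  come from the root datum.\<close>

locale chain_image =
  root: root_datum m n r + chain: oscillator_chain c "m + n" "root_datum.p m n r" x y W +
  algebra_map c H
  for m n r and c :: "scalar \<Rightarrow> 'a::ring_1" and x y W and H :: "ualg \<Rightarrow> 'a" +
  fixes X :: "nat \<Rightarrow> ualg"
  assumes H_X: "i \<in> {1..m + n} \<Longrightarrow> H (X i) = chain.e i"
begin

lemma far_commute:
  assumes "i \<in> {1..m + n}" "j \<in> {1..m + n}" "j \<noteq> i" "j \<noteq> Suc i" "i \<noteq> Suc j"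
  shows "chain.e i * chain.e j = (-1) ^ (chain.P i * chain.P j) * (chain.e j * chain.e i)"
proof -
  have "Suc i < j \<or> Suc j < i" using assms by linarith
  then show ?thesis
    using chain.e_far[OF assms(1,2)] by (simp add: supercommute_def)
qed

text \<open>The order \<open>1 - a\<^sub>i\<^sub>j\<close> of the relation is 1 for distant nodes, 2 for neighbours of a long even root, and 3
  for the neighbour of the even short root.\<close>

lemma serre_image:
  assumes i: "i \<in> {1..m + n}" and j: "j \<in> {1..m + n}" "j \<noteq> i" and even: "i \<notin> odd_roots m n r"
  shows "H (serre m n r X i j) = 0"
proof -
  note generic = root.qi_generic(2,1)[OF i]
  have P: "even (chain.P i)"
    using root.odd_roots_iff[OF i] even by (simp add: chain.P_def)
  have H: "H (serre m n r X i j) = (\<Sum>k=0..M. c ((-1) ^ k * qbinom (qi m n r i) M k) *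
      chain.e i ^ k * chain.e j * chain.e i ^ (M - k))" if "nat (1 - cartan m n r i j) = M" for M
    using i j that by (simp add: serre_def Let_def H_simps H_X)
  consider (far) "j \<noteq> Suc i" "i \<noteq> Suc j" | (near) "j = Suc i \<or> i = Suc j" by blast
  then show ?thesis
  proof cases
    case far
    then have "nat (1 - cartan m n r i j) = 1"
      using i j by (auto simp: root.cartan_eq root.B_off_diag)
    then show ?thesis
      using far_commute[OF i j far] P qbinom_1[OF generic, unfolded One_nat_def] by (simp add: H chain.c_uminus)
  next
    case near
    show ?thesis
    proof (cases "i = m + n")
      case False
      then have lt: "i < m + n" using i by simp
      have p: "root.p (Suc i) = root.p i"
        using P root.p_cases[of i] root.p_cases[of "Suc i"] by (auto simp: chain.P_def)
      have B: "root.B i i = - 2 * sgn_par (root.p i)"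
        using i lt p by (simp add: root.B_diag)
      have "root.B i j = sgn_par (root.p i)"
        using near i j p by (auto simp: root.B_off_diag)
      then have cartan: "cartan m n r i j = - 1"
        using B root.p_cases[of i] i j by (auto simp: root.cartan_eq sgn_par_def)
      define \<kappa> where "\<kappa> = q + inverse q"
      have "qi m n r i + inverse (qi m n r i) = \<kappa>"
        using B i root.p_cases[of i] by (auto simp: root.qi_eq sgn_par_def power_int_minus q_def \<kappa>_def)
      then show ?thesis
        using chain.serre_quadratic[OF i j(1) near p[symmetric], folded \<kappa>_def] qbinom_2[OF generic] cartan
        by (simp add: H numeral_2_eq_2 chain.c_uminus algebra_simps)
    next
      case True
      then have p: "root.p i = 0"
        using P root.p_cases[of i] root.p_last by (auto simp: chain.P_def)
      have j': "m + n = Suc j" using near j True by auto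
      have B: "root.B i i = - 1"
        using i p True by (simp add: root.B_diag sgn_par_def)
      have "root.B i j = 1"
        using root.B_off_diag[OF i j(1)] j(2) j' True p by (simp add: sgn_par_def)
      then have cartan: "cartan m n r i j = - 2"
        using B i j by (simp add: root.cartan_eq)
      define \<kappa> where "\<kappa> = q + inverse q + 1"
      have "qi m n r i ^ 2 + 1 + inverse (qi m n r i) ^ 2 = \<kappa>"
        using B i by (simp add: root.qi_eq power_int_minus q_def power_inverse \<kappa>_def)
      then show ?thesis
        using chain.serre_cubic[OF _ j(1) j', folded True \<kappa>_def] p qbinom_3[OF generic] cartan
        by (simp add: H eval_nat_numeral chain.c_uminus algebra_simps)
    qed
  qed
qed

text \<open>An odd root that is not isotropic is the short root; for its neighbour each of the four terms contains a
  square of the odd root vector.\<close>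

lemma serre_super_image:
  assumes i: "i \<in> {1..m + n}" and j: "j \<in> {1..m + n}" "j \<noteq> i" and odd: "i \<in> odd_roots m n r"
    and cartan: "cartan m n r i i = 2"
  shows "H (serre_super m n r X i j) = 0"
proof -
  note generic = root.qi_generic(2,1)[OF i]
  have P: "odd (chain.P i)"
    using root.odd_roots_iff[OF i] odd by (simp add: chain.P_def)
  have iN: "i = m + n"
    using P cartan i root.B_diag[OF i] by (auto simp: root.cartan_diag chain.P_def split: if_splits)
  then have p: "root.p i = 1"
    using P root.p_cases[of i] root.p_last by (auto simp: chain.P_def)
  have H: "H (serre_super m n r X i j) = (\<Sum>k=0..M. c ((-1) ^ (k * (k + 1) div 2 + k * par_e m n r j) *
      qbinom_super (qi m n r i) M k) * chain.e i ^ k * chain.e j * chain.e i ^ (M - k))"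
    if "nat (1 - cartan m n r i j) = M" for M
    using i j that by (simp add: serre_super_def Let_def H_simps H_X)
  have B: "root.B i i = 1"
    using i p iN by (simp add: root.B_diag sgn_par_def)
  show ?thesis
  proof (cases "i = Suc j")
    case False
    then have "nat (1 - cartan m n r i j) = 1"
      using i j iN by (auto simp: root.cartan_eq root.B_off_diag)
    moreover have "chain.e i * chain.e j = (-1) ^ (par_e m n r j) * (chain.e j * chain.e i)"
      using far_commute[OF i j _ False] iN j P
      by (auto simp: root.par_e_eq chain.P_def minus_one_power_iff)
    ultimately show ?thesis
      using qbinom_super_1[OF generic, unfolded One_nat_def]
      by (cases "even (par_e m n r j)") (simp_all add: H chain.c_uminus)
  next
    case True
    have "root.B i j = - 1"
      using True i j p by (auto simp: root.B_off_diag sgn_par_def)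
    then have M: "nat (1 - cartan m n r i j) = 3"
      using B i j by (simp add: root.cartan_eq)
    have sq: "chain.e i * chain.e i = 0"
      by (rule chain.e_square_odd[OF i disjI1[OF p]])
    then have "chain.e i ^ k = 0" if k: "k \<ge> 2" for k
    proof -
      obtain l where "k = 2 + l" using le_Suc_ex[OF k] by blast
      then show ?thesis by (simp only: power_add power2_eq_square sq mult_zero_left)
    qed
    then have "chain.e i ^ k * chain.e j * chain.e i ^ (3 - k) = 0" for k
      by (cases "k \<ge> 2") auto
    then show ?thesis
      unfolding H[OF M] by (intro sum.neutral) (simp add: mult.assoc)
  qed
qed

lemma isotropic_image:
  assumes i: "i \<in> {1..m + n}" and "cartan m n r i i = 0"
  shows "H (X i ^ 2) = 0"
proof -
  have "root.p i \<noteq> root.p (Suc i)"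
    using assms root.B_diag[OF i] by (auto simp: root.cartan_diag sgn_par_def split: if_splits)
  then have "root.p i = 1 \<or> root.p (Suc i) = 1"
    using root.p_cases[of i] root.p_cases[of "Suc i"] by auto
  then show ?thesis
    using chain.e_square_odd[OF i] i by (simp add: H_simps H_X power2_eq_square)
qed

lemma rels_R2_image: "\<rho> \<in> rels_R2 m n r X \<Longrightarrow> H \<rho> = 0"
  unfolding rels_R2_def
  by (elim UnE CollectE exE conjE) (simp_all only: serre_image serre_super_image isotropic_image not_False_eq_True)

text \<open>All higher order relations are instances of this identity: in the two families at the short root its
  parity is known and only the resulting sign is written.\<close>

lemma reflection_image:
  assumes s: "1 < s" "s < m + n" "cartan m n r s s = 0"
  shows "H (X s * triple m n r X (s - 1) s (s + 1) +
    (-1) ^ (par_e m n r (s - 1) + par_e m n r (s + 1)) * triple m n r X (s - 1) s (s + 1) * X s) = 0"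
proof -
  have ind: "s - 1 \<in> {1..m + n}" "s \<in> {1..m + n}" "Suc s \<in> {1..m + n}" "Suc (s - 1) = s"
    using s by auto
  have "root.p s \<noteq> root.p (Suc s)"
    using s root.B_diag[OF ind(2)] by (auto simp: root.cartan_diag ind sgn_par_def split: if_splits)
  then have odd: "odd (chain.P s)"
    using root.p_cases[of s] root.p_cases[of "Suc s"] by (auto simp: chain.P_def)
  have par: "par_e m n r i = chain.P i mod 2" if "i \<in> {1..m + n}" for i
    using root.par_e_eq[OF that] by (simp add: chain.P_def)
  have mod: "(-1 :: 'b::ring_1) ^ (k mod 2) = (-1) ^ k" for k
    by (simp add: minus_one_power_iff)
  have weights: "qi m n r (Suc s) powi cartan m n r (Suc s) s = q powi sgn_par (root.p (Suc s))"
    "qi m n r (s - 1) powi (cartan m n r (s - 1) s + cartan m n r (s - 1) (Suc s)) = q powi sgn_par (root.p s)"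
    using ind root.B_off_diag[of "Suc s" s] root.B_off_diag[of "s - 1" s] root.B_off_diag[of "s - 1" "Suc s"]
      root.qi_generic(1)[of "s - 1"]
    by (simp_all add: root.qi_powi_cartan power_int_add)
  define Y where "Y = chain.e s * chain.e (Suc s) -
    c ((-1) ^ chain.P (Suc s) * q powi sgn_par (root.p (Suc s))) * (chain.e (Suc s) * chain.e s)"
  define T where "T = chain.e (s - 1) * Y - c ((-1) ^ (chain.P (s - 1) * (1 + chain.P (Suc s))) *
    q powi sgn_par (root.p s)) * (Y * chain.e (s - 1))"
  have "H (triple m n r X (s - 1) s (s + 1)) = T"
  proof -
    have "(-1 :: scalar) ^ (chain.P (s - 1) mod 2 * (1 + chain.P (Suc s) mod 2)) =
        (-1) ^ (chain.P (s - 1) * (1 + chain.P (Suc s)))"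
      by (simp add: minus_one_power_iff)
    then show ?thesis
      using ind weights by (simp add: triple_def Let_def H_simps H_X T_def Y_def par mod mult.assoc)
  qed
  moreover have "H ((-1) ^ k) = (-1) ^ k" for k
    by (simp add: H_simps)
  moreover have "(-1 :: 'a) ^ (chain.P (s - 1) mod 2 + chain.P (Suc s) mod 2) =
      (-1) ^ (chain.P (s - 1) + chain.P (Suc s))"
    by (simp add: minus_one_power_iff)
  ultimately show ?thesis
    using chain.odd_reflection_serre[OF s(1,2) odd Y_def T_def] ind par
    by (simp add: H_add H_mult H_X mult.assoc)
qed

lemma rels_R3_image: "\<rho> \<in> rels_R3 m n r X \<Longrightarrow> H \<rho> = 0"
proof -
  assume \<rho>: "\<rho> \<in> rels_R3 m n r X"
  let ?y = "\<lambda>s. triple m n r X (s - 1) s (s + 1)"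
  have basis_vec_inj: "b = b'" if "basis_vec b = basis_vec b'" for b b'
    using fun_cong[OF that, of b] by (simp add: basis_vec_def split: if_splits)
  have root_N: "root.\<E> (m + n) = b" if "simple_root m n r (m + n) = basis_vec b" for b
    using that by (intro basis_vec_inj) (simp add: simple_root_def)
  have par_0: "par_e m n r (m + n) = 0" if "simple_root m n r (m + n) = basis_vec (Eps m)"
    using root_N[OF that] by (simp add: par_e_def odd_roots_def)
  have par_1: "par_e m n r (m + n) = 1" if "simple_root m n r (m + n) = basis_vec (Del n)"
    using root_N[OF that] by (simp add: par_e_def odd_roots_def)
  consider
    s where "1 < s" "s < m + n" "cartan m n r s s = 0"
      "\<rho> = X s * ?y s + (-1) ^ (par_e m n r (s - 1) + par_e m n r (s + 1)) * ?y s * X s" |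
    s where "1 < s" "s = m + n - 1" "cartan m n r s s = 0" "simple_root m n r (m + n) = basis_vec (Eps m)"
      "\<rho> = X s * ?y s + (-1) ^ par_e m n r (s - 1) * ?y s * X s" |
    s where "1 < s" "s = m + n - 1" "cartan m n r s s = 0" "simple_root m n r (m + n) = basis_vec (Del n)"
      "\<rho> = X s * ?y s - (-1) ^ par_e m n r (s - 1) * ?y s * X s"
    using \<rho> unfolding rels_R3_def Let_def by (elim UnE CollectE exE conjE) simp_all
  then show ?thesis
  proof cases
    case 1
    then show ?thesis using reflection_image by simp
  next
    case (2 s)
    then have "s < m + n" "s + 1 = m + n" by auto
    with par_0[OF 2(4)] reflection_image[OF 2(1) _ 2(3)] 2(5) show ?thesis by simp
  next
    case (3 s)
    then have "s < m + n" "s + 1 = m + n" by auto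
    with par_1[OF 3(4)] reflection_image[OF 3(1) _ 3(3)] 3(5) show ?thesis by simp
  qed
qed

end

section \<open>The relations hold modulo every ideal\<close>

text \<open>Ideals of the whole ring of polynomials, without a carrier set.\<close>

definition two_sided_ideal :: "'a::ring_1 set \<Rightarrow> bool" where
  "two_sided_ideal J \<longleftrightarrow> 0 \<in> J \<and> (\<forall>x\<in>J. \<forall>y\<in>J. x + y \<in> J) \<and> (\<forall>x\<in>J. \<forall>a. a * x \<in> J \<and> x * a \<in> J)"

lemma two_sided_idealD:
  assumes "two_sided_ideal J"
  shows "0 \<in> J" "x \<in> J \<Longrightarrow> y \<in> J \<Longrightarrow> x + y \<in> J" "x \<in> J \<Longrightarrow> a * x \<in> J" "x \<in> J \<Longrightarrow> x * a \<in> J"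
    "x \<in> J \<Longrightarrow> - x \<in> J" "x \<in> J \<Longrightarrow> y \<in> J \<Longrightarrow> x - y \<in> J"
proof -
  have add: "x \<in> J \<Longrightarrow> y \<in> J \<Longrightarrow> x + y \<in> J" for x y
    using assms unfolding two_sided_ideal_def by blast
  have mult: "x \<in> J \<Longrightarrow> a * x \<in> J" "x \<in> J \<Longrightarrow> x * a \<in> J" for x a
    using assms unfolding two_sided_ideal_def by blast+
  have minus: "x \<in> J \<Longrightarrow> - x \<in> J" for x
    using mult(1)[of x "- 1"] by simp
  show "0 \<in> J" using assms unfolding two_sided_ideal_def by blast
  show "x \<in> J \<Longrightarrow> y \<in> J \<Longrightarrow> x + y \<in> J" "x \<in> J \<Longrightarrow> a * x \<in> J" "x \<in> J \<Longrightarrow> x * a \<in> J"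
    "x \<in> J \<Longrightarrow> - x \<in> J"
    by (fact add mult minus)+
  show "x \<in> J \<Longrightarrow> y \<in> J \<Longrightarrow> x - y \<in> J"
    using add[OF _ minus, of x y] by simp
qed

fun image_gen :: "nat \<Rightarrow> nat \<Rightarrow> basis rel \<Rightarrow> ugen \<Rightarrow> calg" where
  "image_gen m n r (E i) =
    (if i < m + n then gen (Phi i) * gen (Phid (Suc i))
     else const (imag_unit * inverse (qhalf - inverse qhalf)) * gen (Phi i))"
| "image_gen m n r (F i) = (if i < m + n then gen (Phi (Suc i)) * gen (Phid i) else gen (Phid i))"
| "image_gen m n r (K i) =
    (if i < m + n then const (- ((-1) ^ par_Phi m n r (Suc i))) * (gen (Ups i) * gen (Upsinv (Suc i)))
     else const (imag_unit * qhalf) * gen (Ups i))"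
| "image_gen m n r (Kinv i) =
    (if i < m + n then const (inverse (- ((-1) ^ par_Phi m n r (Suc i)))) * (gen (Upsinv i) * gen (Ups (Suc i)))
     else const (inverse (imag_unit * qhalf)) * gen (Upsinv i))"

text \<open>A violation is an ideal that contains the Clifford relations but not all images of the relations of the
  quantum supergroup. The critical ideal is a violation if there is one. Otherwise it is the zero ideal, so
  that the quotient ring is nontrivial in either case.\<close>

definition violates :: "nat \<Rightarrow> nat \<Rightarrow> basis rel \<Rightarrow> calg set \<Rightarrow> bool" where
  "violates m n r J \<longleftrightarrow> root_datum m n r \<and> two_sided_ideal J \<and> crels m n r \<subseteq> J \<and>
     \<not> substitute (image_gen m n r) ` urels m n r \<subseteq> J"

definition critical_ideal :: "calg set" where
  "critical_ideal =
    (if \<exists>J m n r. violates m n r J then SOME J. \<exists>m n r. violates m n r J else {0})"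

lemma critical_ideal_violates:
  assumes "\<exists>J m n r. violates m n r J"
  shows "\<exists>m n r. violates m n r critical_ideal"
proof -
  have "\<exists>m n r. violates m n r (SOME J. \<exists>m n r. violates m n r J)"
    using assms by (rule someI_ex[of "\<lambda>J. \<exists>m n r. violates m n r J"])
  then show ?thesis
    unfolding critical_ideal_def using assms by (simp only: if_True)
qed

lemma critical_ideal: "two_sided_ideal critical_ideal" "1 \<notin> critical_ideal"
proof -
  have "two_sided_ideal critical_ideal \<and> 1 \<notin> critical_ideal"
  proof (cases "\<exists>J m n r. violates m n r J")
    case True
    then obtain m n r where v: "violates m n r critical_ideal"
      using critical_ideal_violates by blast
    (* an ideal containing 1 contains everything and cannot be a violation *)
    have "x \<in> critical_ideal" if "1 \<in> critical_ideal" for x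
      using v two_sided_idealD(3)[of critical_ideal 1 x] that by (simp add: violates_def)
    then show ?thesis using v unfolding violates_def by blast
  next
    case False
    then have zero: "critical_ideal = {0}" unfolding critical_ideal_def by (simp only: if_False)
    show ?thesis unfolding zero by (simp add: two_sided_ideal_def)
  qed
  then show "two_sided_ideal critical_ideal" "1 \<notin> critical_ideal" by auto
qed

lemmas critical_ideal_closed = two_sided_idealD[OF critical_ideal(1)]

quotient_type critical_ring = calg / "\<lambda>x y. x - y \<in> critical_ideal"
proof (rule equivpI)
  show "reflp (\<lambda>x y. x - y \<in> critical_ideal)"
    by (simp add: reflp_def critical_ideal_closed)
  show "symp (\<lambda>x y. x - y \<in> critical_ideal)"
    using critical_ideal_closed(5) by (fastforce simp: symp_def)
  show "transp (\<lambda>x y. x - y \<in> critical_ideal)"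
    using critical_ideal_closed(2) by (fastforce simp: transp_def)
qed

instantiation critical_ring :: ring_1
begin

lift_definition zero_critical_ring :: critical_ring is 0 .
lift_definition one_critical_ring :: critical_ring is 1 .
lift_definition plus_critical_ring :: "critical_ring \<Rightarrow> critical_ring \<Rightarrow> critical_ring" is "(+)"
  using critical_ideal_closed(2) by (fastforce simp: algebra_simps)
lift_definition uminus_critical_ring :: "critical_ring \<Rightarrow> critical_ring" is uminus
  using critical_ideal_closed(5) by (fastforce simp: algebra_simps)
lift_definition minus_critical_ring :: "critical_ring \<Rightarrow> critical_ring \<Rightarrow> critical_ring" is "(-)"
  using critical_ideal_closed(6) by (fastforce simp: algebra_simps)
lift_definition times_critical_ring :: "critical_ring \<Rightarrow> critical_ring \<Rightarrow> critical_ring" is "(*)"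
proof -
  fix x x' y y' assume "x - x' \<in> critical_ideal" "y - y' \<in> critical_ideal"
  then have "(x - x') * y + x' * (y - y') \<in> critical_ideal"
    using critical_ideal_closed by blast
  then show "x * y - x' * y' \<in> critical_ideal"
    by (simp add: algebra_simps)
qed

lemmas critical_ring_abs =
  zero_critical_ring_def one_critical_ring_def plus_critical_ring.abs_eq uminus_critical_ring.abs_eq
  minus_critical_ring.abs_eq times_critical_ring.abs_eq

instance
proof
  fix a b d :: critical_ring
  obtain x y z where abs: "a = abs_critical_ring x" "b = abs_critical_ring y" "d = abs_critical_ring z"
    using critical_ring.abs_induct[of "\<lambda>a. \<exists>x. a = abs_critical_ring x"] by blast
  show "a * b * d = a * (b * d)" "a + b + d = a + (b + d)" "a + b = b + a" "0 + a = a" "1 * a = a" "a * 1 = a"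
    "- a + a = 0" "a - b = a + - b" "(a + b) * d = a * d + b * d" "d * (a + b) = d * a + d * b"
    unfolding abs critical_ring_abs by (simp_all add: algebra_simps)
  show "(0 :: critical_ring) \<noteq> 1"
    using critical_ideal(2) critical_ideal_closed(5)[of "- 1"]
    by (auto simp: critical_ring_abs critical_ring.abs_eq_iff)
qed

end

abbreviation to_ring :: "calg \<Rightarrow> critical_ring" where
  "to_ring \<equiv> abs_critical_ring"

lemma to_ring_eq_0_iff: "to_ring x = 0 \<longleftrightarrow> x \<in> critical_ideal"
  by (simp add: zero_critical_ring_def critical_ring.abs_eq_iff)

abbreviation ring_scalar :: "scalar \<Rightarrow> critical_ring" where
  "ring_scalar a \<equiv> to_ring (const a)"

interpretation ring_map: algebra_map ring_scalar to_ring
proof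
  fix a b :: scalar and x :: critical_ring
  show "ring_scalar 1 = 1" "ring_scalar (a + b) = ring_scalar a + ring_scalar b"
    "ring_scalar (a * b) = ring_scalar a * ring_scalar b"
    by (simp_all only: critical_ring_abs const_1 const_add const_mult)
  obtain z where "x = to_ring z"
    using critical_ring.abs_induct[of "\<lambda>a. \<exists>x. a = abs_critical_ring x"] by blast
  then show "ring_scalar a * x = x * ring_scalar a"
    using const_commute[of a z] by (simp only: critical_ring_abs)
qed (simp_all only: critical_ring_abs)

lemmas to_ring_simps =
  ring_map.H_0 ring_map.H_1 ring_map.H_add ring_map.H_mult ring_map.H_uminus ring_map.H_diff ring_map.H_power

interpretation image_map: algebra_map ring_scalar "\<lambda>z. to_ring (substitute (image_gen m n r) z)" for m n r
  by unfold_locales (simp_all only: substitute_add substitute_mult substitute_const to_ring_simps)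

lemma (in root_datum) critical_realization:
  assumes "crels m n r \<subseteq> critical_ideal"
  shows "clifford_realization ring_scalar N p (\<lambda>i. to_ring (gen (Phi i))) (\<lambda>i. to_ring (gen (Phid i)))
    (\<lambda>i. to_ring (gen (Ups i))) (\<lambda>i. to_ring (gen (Upsinv i)))"
proof
  have rel: "to_ring \<rho> = 0" if "\<rho> \<in> crels m n r" for \<rho>
    using that assms by (auto simp: to_ring_eq_0_iff)
  have par: "par_Phi m n r i = p i" if "i \<in> {1..N}" for i
    using that by (simp add: p_def)
  show "p i \<le> 1" for i by (rule p_le)
  show "p (Suc N) = 0" by (rule p_last)
  fix i assume i: "i \<in> {1..N}"
  note simps = par[OF i] to_ring_simps mult.assoc ring_map.c_sign
  have "gen (Ups i) * gen (Upsinv i) - 1 \<in> crels m n r"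
    "gen (Upsinv i) * gen (Ups i) - 1 \<in> crels m n r"
    "gen (Phi i) * gen (Phid i) - const ((-1) ^ par_Phi m n r i * q) * gen (Phid i) * gen (Phi i) - gen (Upsinv i)
      \<in> crels m n r"
    "gen (Phi i) * gen (Phid i) - const ((-1) ^ par_Phi m n r i * inverse q) * gen (Phid i) * gen (Phi i) - gen (Ups i)
      \<in> crels m n r"
    unfolding crels_def Let_def using i by blast+
  note this[THEN rel]
  then show "to_ring (gen (Ups i)) * to_ring (gen (Upsinv i)) = 1"
    "to_ring (gen (Upsinv i)) * to_ring (gen (Ups i)) = 1"
    "to_ring (gen (Phi i)) * to_ring (gen (Phid i)) =
      ring_scalar ((-1) ^ p i * q) * (to_ring (gen (Phid i)) * to_ring (gen (Phi i))) + to_ring (gen (Upsinv i))"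
    "to_ring (gen (Phi i)) * to_ring (gen (Phid i)) =
      ring_scalar ((-1) ^ p i * inverse q) * (to_ring (gen (Phid i)) * to_ring (gen (Phi i))) + to_ring (gen (Ups i))"
    by (simp_all add: simps algebra_simps)
  fix j assume j: "j \<in> {1..N}"
  note simps = simps par[OF j]
  have "gen (Ups i) * gen (Ups j) - gen (Ups j) * gen (Ups i) \<in> crels m n r"
    "gen (Ups i) * gen (Phi j) * gen (Upsinv i) -
      const (q powi (if i = j then - ((-1) ^ par_Phi m n r j) else 0)) * gen (Phi j) \<in> crels m n r"
    "gen (Ups i) * gen (Phid j) * gen (Upsinv i) -
      const (q powi (if i = j then (-1) ^ par_Phi m n r j else 0)) * gen (Phid j) \<in> crels m n r"
    "gen (Phi i) * gen (Phi j) - (-1) ^ (par_Phi m n r i * par_Phi m n r j) * gen (Phi j) * gen (Phi i) \<in> crels m n r"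
    "gen (Phid i) * gen (Phid j) - (-1) ^ (par_Phi m n r i * par_Phi m n r j) * gen (Phid j) * gen (Phid i) \<in> crels m n r"
    unfolding crels_def Let_def using i j by blast+
  note this[THEN rel]
  then show "to_ring (gen (Ups i)) * to_ring (gen (Ups j)) = to_ring (gen (Ups j)) * to_ring (gen (Ups i))"
    "to_ring (gen (Ups i)) * to_ring (gen (Phi j)) * to_ring (gen (Upsinv i)) =
      ring_scalar (q powi (if i = j then - sgn_par (p j) else 0)) * to_ring (gen (Phi j))"
    "to_ring (gen (Ups i)) * to_ring (gen (Phid j)) * to_ring (gen (Upsinv i)) =
      ring_scalar (q powi (if i = j then sgn_par (p j) else 0)) * to_ring (gen (Phid j))"
    "supercommute (p i) (p j) (to_ring (gen (Phi i))) (to_ring (gen (Phi j)))"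
    "supercommute (p i) (p j) (to_ring (gen (Phid i))) (to_ring (gen (Phid j)))"
    by (simp_all add: simps supercommute_def sgn_par_def)
  assume "i \<noteq> j"
  then have "gen (Phi i) * gen (Phid j) - (-1) ^ (par_Phi m n r i * par_Phi m n r j) * gen (Phid j) * gen (Phi i)
      \<in> crels m n r"
    unfolding crels_def Let_def using i j by blast
  from rel[OF this] show "supercommute (p i) (p j) (to_ring (gen (Phi i))) (to_ring (gen (Phid j)))"
    by (simp add: simps supercommute_def)
qed

text \<open>If there were a violation then the critical ideal would be one. But its quotient is a ring in which the
  generators form a realization of the Clifford relations, and there the images satisfy all relations.\<close>

lemma not_violates: "\<not> violates m n r J"
proof
  assume "violates m n r J"
  then obtain m n r where v: "violates m n r critical_ideal"
    using critical_ideal_violates by blast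
  interpret root: root_datum m n r
    using v by (simp add: violates_def)
  let ?\<Phi> = "\<lambda>i. to_ring (gen (Phi i))" and ?\<Phi>d = "\<lambda>i. to_ring (gen (Phid i))"
  interpret cl: clifford_realization ring_scalar "m + n" root.p ?\<Phi> ?\<Phi>d
    "\<lambda>i. to_ring (gen (Ups i))" "\<lambda>i. to_ring (gen (Upsinv i))"
    using v by (intro root.critical_realization) (simp add: violates_def)
  define H where "H z = to_ring (substitute (image_gen m n r) z)" for z
  note H_simps = image_map.H_simps[where m = m and n = n and r = r, folded H_def]
  have par: "par_Phi m n r (Suc i) = root.p (Suc i)" if "i < m + n" for i
    using that by (simp add: root.p_def)
  have H_gen: "H (gen (E i)) = cl.E i" "H (gen (F i)) = cl.F i" "H (gen (K i)) = cl.K i" "H (gen (Kinv i)) = cl.Kinv i"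
    for i
    by (simp_all add: H_def cl.E_def cl.F_def cl.K_def cl.Kinv_def cl.k_scalar_def cl.\<epsilon>_def
        to_ring_simps substitute_simps par)
  interpret H: algebra_map ring_scalar H
    unfolding H_def by (rule image_map.algebra_map_axioms)
  interpret EC: oscillator_chain ring_scalar "m + n" root.p ?\<Phi> "cl.y_E cl.\<epsilon>" cl.W_E
    by (rule cl.E_chain)
  interpret FC: oscillator_chain ring_scalar "m + n" root.p ?\<Phi>d cl.y_F cl.W_F
    by (rule cl.F_chain)
  interpret EI: chain_image m n r ring_scalar ?\<Phi> "cl.y_E cl.\<epsilon>" cl.W_E H "\<lambda>i. gen (E i)"
    by unfold_locales (simp add: H_gen cl.E_eq EC.e_def)
  interpret FI: chain_image m n r ring_scalar ?\<Phi>d cl.y_F cl.W_F H "\<lambda>i. gen (F i)"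
    by unfold_locales (simp add: H_gen cl.F_eq FC.e_def)
  have R1: "H \<rho> = 0" if R1: "\<rho> \<in> rels_R1 m n r" for \<rho>
  proof -
    have sign: "(-1 :: critical_ring) ^ (par_e m n r i * par_e m n r j) =
        (-1) ^ ((root.p i + root.p (Suc i)) * (root.p j + root.p (Suc j)))"
      if "i \<in> {1..m + n}" "j \<in> {1..m + n}" for i j
      using that by (simp add: root.par_e_eq minus_one_power_iff)
    have EF: "cl.E i * cl.F j - (-1) ^ (par_e m n r i * par_e m n r j) * (cl.F j * cl.E i) =
        (if i = j then ring_scalar (inverse (q - inverse q)) * (cl.K i - cl.Kinv i) else 0)"
      if ij: "i \<in> {1..m + n}" "j \<in> {1..m + n}" for i j
    proof (cases "i = j")
      case True
      have "(-1 :: critical_ring) ^ (par_e m n r i * par_e m n r i) = (-1) ^ (root.p i + root.p (Suc i))"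
        unfolding sign[OF ij(1) ij(1)] by (simp add: minus_one_power_iff)
      then show ?thesis using True cl.E_F_same[OF ij(1)] by simp
    next
      case False
      then show ?thesis
        using cl.E_F[OF ij False] sign[OF ij] by (simp add: supercommute_def)
    qed
    obtain i j where ij: "i \<in> {1..m + n}" "j \<in> {1..m + n}" and
      \<rho>: "\<rho> \<in> {gen (K i) * gen (Kinv i) - 1, gen (Kinv i) * gen (K i) - 1,
        gen (K i) * gen (K j) - gen (K j) * gen (K i),
        gen (K i) * gen (E j) * gen (Kinv i) - const (qi m n r i powi cartan m n r i j) * gen (E j),
        gen (K i) * gen (F j) * gen (Kinv i) - const (qi m n r i powi (- cartan m n r i j)) * gen (F j),
        gen (E i) * gen (F j) - (-1) ^ (par_e m n r i * par_e m n r j) * gen (F j) * gen (E i) -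
          (if i = j then const (inverse (q - inverse q)) * (gen (K i) - gen (Kinv i)) else 0)}"
      using R1 unfolding rels_R1_def Let_def by blast
    have "H (if i = j then const (inverse (q - inverse q)) * (gen (K i) - gen (Kinv i)) else 0) =
        (if i = j then ring_scalar (inverse (q - inverse q)) * (cl.K i - cl.Kinv i) else 0)"
      by (simp add: H_simps H_gen)
    with \<rho> show ?thesis
      using cl.K_Kinv[OF ij(1)] cl.K_K[OF ij] cl.K_E[OF ij] cl.K_F[OF ij] EF[OF ij]
        root.qi_powi_cartan[OF ij]
      by (elim insertE emptyE) (simp_all add: H_simps H_gen mult.assoc del: if_split)
  qed
  have "H \<rho> = 0" if "\<rho> \<in> urels m n r" for \<rho>
    using that R1 EI.rels_R2_image EI.rels_R3_image FI.rels_R2_image FI.rels_R3_image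
    unfolding urels_def by blast
  then have "substitute (image_gen m n r) ` urels m n r \<subseteq> critical_ideal"
    by (auto simp: H_def to_ring_eq_0_iff)
  then show False using v by (simp add: violates_def)
qed

section \<open>Existence and uniqueness of the homomorphism\<close>

lemma sign_in_free_algebra [simp]: "(-1) ^ k \<in> carrier (free_algebra X)"
  by (intro power_in_free_algebra uminus_in_free_algebra) simp

lemma crels_in_free_algebra: "crels m n r \<subseteq> carrier (free_algebra (cgens m n))"
proof -
  have gens: "gen (Phi i) \<in> carrier (free_algebra (cgens m n))" "gen (Phid i) \<in> carrier (free_algebra (cgens m n))"
    "gen (Ups i) \<in> carrier (free_algebra (cgens m n))" "gen (Upsinv i) \<in> carrier (free_algebra (cgens m n))"
    if "i \<in> {1..m + n}" for i
    using that by (auto intro!: gen_in_free_algebra simp: cgens_def)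
  show ?thesis
    unfolding crels_def Let_def
    by (intro UN_least Un_least insert_subsetI empty_subsetI free_algebra_closed(2-) gens
        const_in_free_algebra one_in_free_algebra sign_in_free_algebra; simp)
qed

lemma serre_in_free_algebra:
  assumes "X i \<in> carrier (free_algebra Y)" "X j \<in> carrier (free_algebra Y)"
  shows "serre m n r X i j \<in> carrier (free_algebra Y)" "serre_super m n r X i j \<in> carrier (free_algebra Y)"
  unfolding serre_def serre_super_def Let_def
  by (intro free_algebra_closed(2-) const_in_free_algebra assms)+

lemma triple_in_free_algebra:
  assumes "X i \<in> carrier (free_algebra Y)" "X s \<in> carrier (free_algebra Y)" "X j \<in> carrier (free_algebra Y)"
  shows "triple m n r X i s j \<in> carrier (free_algebra Y)"
  unfolding triple_def Let_def
  by (intro free_algebra_closed(2-) const_in_free_algebra assms)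

lemma urels_in_free_algebra: "urels m n r \<subseteq> carrier (free_algebra (ugens m n))"
proof -
  have gens: "gen (E i) \<in> carrier (free_algebra (ugens m n))" "gen (F i) \<in> carrier (free_algebra (ugens m n))"
    "gen (K i) \<in> carrier (free_algebra (ugens m n))" "gen (Kinv i) \<in> carrier (free_algebra (ugens m n))"
    if "i \<in> {1..m + n}" for i
    using that by (auto intro!: gen_in_free_algebra simp: ugens_def)
  have "rels_R1 m n r \<subseteq> carrier (free_algebra (ugens m n))"
  proof -
    have "(if i = j then const a * (gen (K i) - gen (Kinv i)) else 0) \<in> carrier (free_algebra (ugens m n))"
      if i: "i \<in> {1..m + n}" for i j a
    proof (cases "i = j")
      case True
      show ?thesis
        unfolding if_P[OF True] by (intro free_algebra_closed(2-) const_in_free_algebra gens i)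
    qed simp
    then show ?thesis
      unfolding rels_R1_def Let_def
      by (intro UN_least Un_least insert_subsetI empty_subsetI free_algebra_closed(2-) gens
        const_in_free_algebra one_in_free_algebra sign_in_free_algebra)
  qed
  moreover have R23: "rels_R2 m n r X \<union> rels_R3 m n r X \<subseteq> carrier (free_algebra (ugens m n))"
    if X: "\<And>i. i \<in> {1..m + n} \<Longrightarrow> X i \<in> carrier (free_algebra (ugens m n))" for X
  proof -
    have R2: "rels_R2 m n r X \<subseteq> carrier (free_algebra (ugens m n))"
    proof
      fix \<rho> assume "\<rho> \<in> rels_R2 m n r X"
      then show "\<rho> \<in> carrier (free_algebra (ugens m n))"
        unfolding rels_R2_def
        by (elim UnE CollectE exE conjE) (simp_all only: serre_in_free_algebra power_in_free_algebra X)
    qed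
    have "X s * triple m n r X (s - 1) s (s + 1) + (-1) ^ k * triple m n r X (s - 1) s (s + 1) * X s
        \<in> carrier (free_algebra (ugens m n))"
      "X s * triple m n r X (s - 1) s (s + 1) - (-1) ^ k * triple m n r X (s - 1) s (s + 1) * X s
        \<in> carrier (free_algebra (ugens m n))"
      if "1 < s" "s < m + n" for s k
      using that by (intro free_algebra_closed(2-) triple_in_free_algebra sign_in_free_algebra X; auto)+
    moreover have "s < m + n" if "s < m + n - 1 \<or> s = m + n - 1 \<and> 1 < s" for s
      using that by auto
    ultimately have "rels_R3 m n r X \<subseteq> carrier (free_algebra (ugens m n))"
      unfolding rels_R3_def Let_def by blast
    with R2 show ?thesis by blast
  qed
  ultimately show ?thesis
    unfolding urels_def
    using R23[of "\<lambda>i. gen (E i)", OF gens(1)] R23[of "\<lambda>i. gen (F i)", OF gens(2)] by blast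
qed

text \<open>The ideal of the presentation lives in the polynomials over the given generators. Its preimage under the
  retraction that sends all other letters to 0 is an ideal of the whole polynomial ring.\<close>

lemma image_gen_relations:
  assumes "root_datum m n r" and \<rho>: "\<rho> \<in> urels m n r"
    and closed: "substitute (image_gen m n r) \<rho> \<in> carrier (free_algebra (cgens m n))"
  shows "substitute (image_gen m n r) \<rho> \<in> relation_ideal (cgens m n) (crels m n r)"
proof -
  interpret cl: presentation "cgens m n" "cpar m n r" "crels m n r"
    by unfold_locales (rule crels_in_free_algebra)
  define g :: "cgen \<Rightarrow> calg" where "g x = (if x \<in> cgens m n then gen x else 0)" for x
  have retract: "substitute g z = z" if "z \<in> carrier (free_algebra (cgens m n))" for z
    using that by (induction rule: free_algebra_induct) (simp_all add: substitute_simps g_def)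
  have into: "substitute g z \<in> carrier (free_algebra (cgens m n))" for z
    by (rule substitute_in_free_algebra[where X = UNIV])
      (simp_all add: g_def gen_in_free_algebra, simp add: carrier_free_algebra_iff)
  define J where "J = {z. substitute g z \<in> relation_ideal (cgens m n) (crels m n r)}"
  have "two_sided_ideal J"
    using cl.ideal_closed(1-3,5) into
    unfolding two_sided_ideal_def J_def mem_Collect_eq substitute_add substitute_mult substitute_0 by blast
  moreover have "crels m n r \<subseteq> J"
  proof
    fix \<sigma> assume "\<sigma> \<in> crels m n r"
    then show "\<sigma> \<in> J"
      using retract[of \<sigma>] crels_in_free_algebra[of m n r] cl.relation_in_ideal[of \<sigma>] by (auto simp: J_def)
  qed
  ultimately have "substitute (image_gen m n r) \<rho> \<in> J"
    using not_violates[of m n r J] assms(1) \<rho> by (auto simp: violates_def)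
  then show ?thesis
    using retract[OF closed] by (simp add: J_def)
qed

lemma homogeneous_const_mult: "z \<in> homogeneous X par (s mod 2) \<Longrightarrow> const a * z \<in> homogeneous X par (s mod 2)"
  using homogeneous_mult[OF homogeneous_const] by fastforce

lemma image_gen_homogeneous:
  assumes "root_datum m n r" "x \<in> ugens m n"
  shows "image_gen m n r x \<in> homogeneous (cgens m n) (cpar m n r) (upar m n r x mod 2)"
proof -
  interpret root_datum m n r by fact
  have gens: "gen (Phi i) \<in> homogeneous (cgens m n) (cpar m n r) (p i mod 2)"
    "gen (Phid i) \<in> homogeneous (cgens m n) (cpar m n r) (p i mod 2)"
    "gen (Ups i) \<in> homogeneous (cgens m n) (cpar m n r) (0 mod 2)"
    "gen (Upsinv i) \<in> homogeneous (cgens m n) (cpar m n r) (0 mod 2)"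
    if "i \<in> {1..m + n}" for i
    using that homogeneous_gen[of "Phi i" "cgens m n" "cpar m n r"] homogeneous_gen[of "Phid i" "cgens m n" "cpar m n r"]
      homogeneous_gen[of "Ups i" "cgens m n" "cpar m n r"] homogeneous_gen[of "Upsinv i" "cgens m n" "cpar m n r"]
    by (auto simp: cgens_def p_def)
  note mult = homogeneous_mult[where s = "s mod 2" and t = "t mod 2" for s t, unfolded mod_add_eq]
  obtain i where i: "i \<in> {1..m + n}" and x: "x \<in> {E i, F i, K i, Kinv i}"
    using assms(2) unfolding ugens_def by blast
  show ?thesis
  proof (cases "i < m + n")
    case True
    then have "Suc i \<in> {1..m + n}" by simp
    note gens = gens[OF i] gens[OF this]
    have "image_gen m n r (E i) \<in> homogeneous (cgens m n) (cpar m n r) ((p i + p (Suc i)) mod 2)"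
      "image_gen m n r (F i) \<in> homogeneous (cgens m n) (cpar m n r) ((p (Suc i) + p i) mod 2)"
      "image_gen m n r (K i) \<in> homogeneous (cgens m n) (cpar m n r) ((0 + 0) mod 2)"
      "image_gen m n r (Kinv i) \<in> homogeneous (cgens m n) (cpar m n r) ((0 + 0) mod 2)"
      unfolding image_gen.simps if_P[OF True] by (intro homogeneous_const_mult mult gens)+
    then show ?thesis
      using x i by (auto simp: par_e_eq add.commute)
  next
    case False
    then have "i = m + n" using i by simp
    then have "upar m n r x mod 2 = (if x = E i \<or> x = F i then p i else 0) mod 2"
      using x i p_last by (auto simp: par_e_eq)
    moreover have "image_gen m n r (E i) \<in> homogeneous (cgens m n) (cpar m n r) (p i mod 2)"
      "image_gen m n r (F i) \<in> homogeneous (cgens m n) (cpar m n r) (p i mod 2)"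
      "image_gen m n r (K i) \<in> homogeneous (cgens m n) (cpar m n r) (0 mod 2)"
      "image_gen m n r (Kinv i) \<in> homogeneous (cgens m n) (cpar m n r) (0 mod 2)"
      unfolding image_gen.simps if_not_P[OF False] by (intro homogeneous_const_mult gens[OF i])+
    ultimately show ?thesis
      using x by auto
  qed
qed

text \<open>Homomorphisms preserve inverses, and inverses are unique.\<close>

lemma hom_determines_inverse:
  assumes "presentation X R" "presentation Y S"
    and "h \<in> superalgebra_hom (presented_superalgebra X par R) (presented_superalgebra Y par' S)"
    and "h' \<in> superalgebra_hom (presented_superalgebra X par R) (presented_superalgebra Y par' S)"
    and k: "k \<in> carrier (free_algebra X)" and l: "l \<in> carrier (free_algebra X)"
    and kl: "k * l - 1 \<in> R" "l * k - 1 \<in> R"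
    and eq: "h (residue_class X R k) = h' (residue_class X R k)"
  shows "h (residue_class X R l) = h' (residue_class X R l)"
proof -
  interpret source: presentation X par R by fact
  interpret target: presentation Y par' S by fact
  have hom: "h \<in> ring_hom source.A target.A" "h' \<in> ring_hom source.A target.A"
    using assms(3,4) by (simp_all add: superalgebra_hom_def)
  have mem: "source.cls k \<in> carrier source.A" "source.cls l \<in> carrier source.A"
    using k l by (simp_all add: source.carrier_eq)
  have inv: "source.cls k \<otimes>\<^bsub>source.A\<^esub> source.cls l = \<one>\<^bsub>source.A\<^esub>"
    "source.cls l \<otimes>\<^bsub>source.A\<^esub> source.cls k = \<one>\<^bsub>source.A\<^esub>"
    using kl[THEN source.relation_in_ideal] k l
    by (simp_all add: source.cls_simps source.one_eq_cls source.cls_eq_iff)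
  obtain a where a: "a \<in> carrier (free_algebra Y)" "h (source.cls k) = target.cls a"
    using ring_hom_closed[OF hom(1) mem(1)] unfolding target.carrier_eq by blast
  obtain b where b: "b \<in> carrier (free_algebra Y)" "h (source.cls l) = target.cls b"
    using ring_hom_closed[OF hom(1) mem(2)] unfolding target.carrier_eq by blast
  obtain b' where b': "b' \<in> carrier (free_algebra Y)" "h' (source.cls l) = target.cls b'"
    using ring_hom_closed[OF hom(2) mem(2)] unfolding target.carrier_eq by blast
  have ba: "target.cls (b * a) = target.cls 1"
    using ring_hom_mult[OF hom(1) mem(2) mem(1)] a b inv(2) ring_hom_one[OF hom(1)]
    by (simp add: target.cls_simps target.one_eq_cls)
  have ab': "target.cls (a * b') = target.cls 1"
    using ring_hom_mult[OF hom(2) mem(1) mem(2)] a b' inv(1) ring_hom_one[OF hom(2)] eq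
    by (simp add: target.cls_simps target.one_eq_cls)
  have "target.cls b = target.cls b \<otimes>\<^bsub>target.A\<^esub> target.cls (a * b')"
    unfolding ab' using b by (simp add: target.cls_simps)
  also have "\<dots> = target.cls (b * a) \<otimes>\<^bsub>target.A\<^esub> target.cls b'"
    using a b b' by (simp add: target.cls_simps mult_in_free_algebra mult.assoc)
  also have "\<dots> = target.cls b'"
    unfolding ba using b' by (simp add: target.cls_simps)
  finally show ?thesis using b b' by simp
qed

theorem theorem3p7:
  fixes m n :: nat and r :: "basis rel"
  assumes "m \<ge> 1" and "n \<ge> 1" and "admissible m n r"
  shows "\<exists>!\<pi>. \<pi> \<in> extensional (carrier (Uq_osp m n r)) \<and>
    \<pi> \<in> superalgebra_hom (Uq_osp m n r) (Clq m n r) \<and>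
    (\<forall>i\<in>{1..m + n - 1}.
       \<pi> (ucls m n r (E i)) = ccls m n r (Phi i) \<otimes>\<^bsub>Clq m n r\<^esub> ccls m n r (Phid (i + 1)) \<and>
       \<pi> (ucls m n r (F i)) = ccls m n r (Phi (i + 1)) \<otimes>\<^bsub>Clq m n r\<^esub> ccls m n r (Phid i) \<and>
       \<pi> (ucls m n r (K i)) =
         (- ((-1) ^ par_Phi m n r (i + 1))) \<odot>\<^bsub>Clq m n r\<^esub>
           (ccls m n r (Ups i) \<otimes>\<^bsub>Clq m n r\<^esub> ccls m n r (Upsinv (i + 1)))) \<and>
    \<pi> (ucls m n r (E (m + n))) =
      (imag_unit * inverse (qhalf - inverse qhalf)) \<odot>\<^bsub>Clq m n r\<^esub> ccls m n r (Phi (m + n)) \<and>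
    \<pi> (ucls m n r (F (m + n))) = ccls m n r (Phid (m + n)) \<and>
    \<pi> (ucls m n r (K (m + n))) = (imag_unit * qhalf) \<odot>\<^bsub>Clq m n r\<^esub> ccls m n r (Ups (m + n))"
proof -
  have root: "root_datum m n r"
    using assms by unfold_locales
  have U: "presentation (ugens m n) (urels m n r)"
    by unfold_locales (rule urels_in_free_algebra)
  have C: "presentation (cgens m n) (crels m n r)"
    by unfold_locales (rule crels_in_free_algebra)
  interpret source: presentation "ugens m n" "upar m n r" "urels m n r" by (rule U)
  interpret target: presentation "cgens m n" "cpar m n r" "crels m n r" by (rule C)
  have closed: "substitute (image_gen m n r) z \<in> carrier (free_algebra (cgens m n))"
    if "z \<in> carrier (free_algebra (ugens m n))" for z
    using that image_gen_homogeneous[OF root]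
    by (intro substitute_in_free_algebra) (auto simp: homogeneous_def)
  have relations: "substitute (image_gen m n r) \<rho> \<in> relation_ideal (cgens m n) (crels m n r)"
    if "\<rho> \<in> urels m n r" for \<rho>
    using image_gen_relations[OF root that] closed urels_in_free_algebra that by blast
  obtain h where h: "h \<in> extensional (carrier source.A)" "h \<in> superalgebra_hom source.A target.A"
    and h_cls: "\<And>z. z \<in> carrier (free_algebra (ugens m n)) \<Longrightarrow>
      h (source.cls z) = target.cls (substitute (image_gen m n r) z)"
    using superalgebra_hom_exists[OF U C image_gen_homogeneous[OF root] relations] by blast
  have gens: "gen (Phi i) \<in> carrier (free_algebra (cgens m n))" "gen (Phid i) \<in> carrier (free_algebra (cgens m n))"
    "gen (Ups i) \<in> carrier (free_algebra (cgens m n))" "gen (Upsinv i) \<in> carrier (free_algebra (cgens m n))"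
    "gen (E i) \<in> carrier (free_algebra (ugens m n))" "gen (F i) \<in> carrier (free_algebra (ugens m n))"
    "gen (K i) \<in> carrier (free_algebra (ugens m n))" "gen (Kinv i) \<in> carrier (free_algebra (ugens m n))"
    if "i \<in> {1..m + n}" for i
    using that by (auto intro!: gen_in_free_algebra simp: cgens_def ugens_def)
  have last: "m + n \<in> {1..m + n}" using assms by simp
  define spec where "spec \<pi> \<longleftrightarrow> (\<forall>i\<in>{1..m + n - 1}.
       \<pi> (source.cls (gen (E i))) = target.cls (gen (Phi i)) \<otimes>\<^bsub>target.A\<^esub> target.cls (gen (Phid (i + 1))) \<and>
       \<pi> (source.cls (gen (F i))) = target.cls (gen (Phi (i + 1))) \<otimes>\<^bsub>target.A\<^esub> target.cls (gen (Phid i)) \<and>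
       \<pi> (source.cls (gen (K i))) = (- ((-1) ^ par_Phi m n r (i + 1))) \<odot>\<^bsub>target.A\<^esub>
         (target.cls (gen (Ups i)) \<otimes>\<^bsub>target.A\<^esub> target.cls (gen (Upsinv (i + 1))))) \<and>
     \<pi> (source.cls (gen (E (m + n)))) =
       (imag_unit * inverse (qhalf - inverse qhalf)) \<odot>\<^bsub>target.A\<^esub> target.cls (gen (Phi (m + n))) \<and>
     \<pi> (source.cls (gen (F (m + n)))) = target.cls (gen (Phid (m + n))) \<and>
     \<pi> (source.cls (gen (K (m + n)))) = (imag_unit * qhalf) \<odot>\<^bsub>target.A\<^esub> target.cls (gen (Ups (m + n)))"
    for \<pi>
  have spec_h: "spec h"
    unfolding spec_def
  proof (intro conjI ballI)
    fix i assume "i \<in> {1..m + n - 1}"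
    then have i: "i < m + n" "i \<in> {1..m + n}" "Suc i \<in> {1..m + n}" by auto
    note simps = gens[OF i(2)] gens[OF i(3)] i(1) h_cls target.cls_simps target.smult_cls mult_in_free_algebra
    show "h (source.cls (gen (E i))) = target.cls (gen (Phi i)) \<otimes>\<^bsub>target.A\<^esub> target.cls (gen (Phid (i + 1)))"
      "h (source.cls (gen (F i))) = target.cls (gen (Phi (i + 1))) \<otimes>\<^bsub>target.A\<^esub> target.cls (gen (Phid i))"
      "h (source.cls (gen (K i))) = (- ((-1) ^ par_Phi m n r (i + 1))) \<odot>\<^bsub>target.A\<^esub>
        (target.cls (gen (Ups i)) \<otimes>\<^bsub>target.A\<^esub> target.cls (gen (Upsinv (i + 1))))"
      by (simp_all add: simps)
  qed (simp_all only: h_cls gens[OF last] target.smult_cls substitute_gen image_gen.simps less_irrefl if_False)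
  have unique: "h' = h"
    if h': "h' \<in> extensional (carrier source.A)" "h' \<in> superalgebra_hom source.A target.A" "spec h'" for h'
  proof -
    have EFK: "h' (source.cls (gen (E i))) = h (source.cls (gen (E i)))"
      "h' (source.cls (gen (F i))) = h (source.cls (gen (F i)))"
      "h' (source.cls (gen (K i))) = h (source.cls (gen (K i)))" if i: "i \<in> {1..m + n}" for i
    proof -
      consider "i = m + n" | "i \<in> {1..m + n - 1}" using i by fastforce
      then have "h' (source.cls (gen (E i))) = h (source.cls (gen (E i))) \<and>
        h' (source.cls (gen (F i))) = h (source.cls (gen (F i))) \<and>
        h' (source.cls (gen (K i))) = h (source.cls (gen (K i)))"
        using spec_h h'(3) unfolding spec_def by cases (simp_all only:)
      then show "h' (source.cls (gen (E i))) = h (source.cls (gen (E i)))"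
        "h' (source.cls (gen (F i))) = h (source.cls (gen (F i)))"
        "h' (source.cls (gen (K i))) = h (source.cls (gen (K i)))" by blast+
    qed
    show "h' = h"
    proof (rule source.superalgebra_hom_eqI)
      fix x assume "x \<in> ugens m n"
      then obtain i where i: "i \<in> {1..m + n}" and x: "x \<in> {E i, F i, K i, Kinv i}"
        unfolding ugens_def by blast
      have "gen (K i) * gen (Kinv i) - 1 \<in> urels m n r" "gen (Kinv i) * gen (K i) - 1 \<in> urels m n r"
        unfolding urels_def rels_R1_def Let_def using i by blast+
      then have "h' (source.cls (gen (Kinv i))) = h (source.cls (gen (Kinv i)))"
        by (rule hom_determines_inverse[OF U C h'(2) h(2) gens(7,8)[OF i] _ _ EFK(3)[OF i]])
      then show "h' (source.cls (gen x)) = h (source.cls (gen x))"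
        using x EFK[OF i] by (elim insertE emptyE) (simp_all only:)
    qed (fact h h')+
  qed
  show ?thesis
    unfolding Uq_osp_def Clq_def ucls_def ccls_def spec_def[symmetric]
    using h spec_h unique by blast
qed

end
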